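(* Let $V$ be the variety of symmetric $n\times n$ matrices of rank at most $2$ over an algebraically closed field of characteristic $0$. The collection of bases of the algebraic matroid of $V$ is the union, over all regular combinatorial $n+n$ symbic trees $\mathcal T$, of the collections of bases of the algebraic matroids of $\mathcal T$. Moreover, it suffices to take the union over only those regular symbic trees all of whose branches are caterpillar.
   Context: **Algebraic matroids.** Let $E=\{(i,j):1\le i\le j\le n\}$ index the entries of a symmetric matrix. The algebraic matroid of the irreducible variety $V\subset K^E$ is the matroid on $E$ in which $S\subseteq E$ is independent iff the projection of $V$ to $K^S$ is dominant. For a linear subspace $W\subseteq\mathbb{R}^E$, the matroid $M(W)$ on $E$ has $S$ independent iff the projection $W\to\mathbb{R}^S$ is surjective. The algebraic matroid of a symbic tree $\mathcal T$ is $M(\mathrm{span}(C_{\mathcal T}))$ with $C_{\mathcal T}$ as below. **Symbic trees.** A split of a tree is a partition of the leaf labels obtained by removing an internal (non-leaf) edge. An $n+n$ symbic tree is a metric tree on leaves labelled $1,\dots,n,1',\dots,n'$ (unprimed and primed labels are two colors; no unlabelled vertices of degree 2; lengths of leaf edges disregarded) such that (1) each split contains both colors on both sides; (2) internal edges have positive lengths; (3) the metric tree is symmetric with respect to the involution swapping $i$ and $i'$ for all $i$; (4) the fixed points of the involution form a path, called the trunk (possibly a single point; if it is the midpoint of an edge, it is regarded as a trunk vertex of degree 2). A combinatorial symbic tree is a symbic tree without the metric data. It is regular if it has $n-1$ internal edges up to symmetry (i.e. $n-1$ orbits of splits). A branch is a maximal subtree that branches out from a trunk vertex and meets the trunk only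 in that vertex. A cherry is a pair of leaves $i$, $j'$ adjacent to the same internal vertex. A branch is caterpillar if it contains only one cherry (branches consisting of a single leaf edge are also allowed), i.e. all its internal edges lie on a single path starting at the trunk. **The cone $C_{\mathcal T}$.** It is the set of symmetric $n\times n$ real matrices of symmetric tropical rank $2$ whose associated symbic tree has combinatorial type $\mathcal T$. Explicitly, $C_{\mathcal T}=\{A_T\mid T\text{ a symbic tree of type }\mathcal T\}+L$, where $L=\{(X_i+X_j)_{i,j}\mid X\in\mathbb{R}^n\}$ and, for a chosen vertex $O$ of the tree fixed by the involution, $A_T$ is the symmetric matrix whose $(i,j)$ entry is the distance in $T$ from $O$ to the vertex where the path from $O$ to leaf $i$ and the path from $O$ to leaf $j'$ diverge. *)

theory Defs
  imports
    "HOL-Analysis.Analysis"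
    "HOL-Computational_Algebra.Polynomial"
    "HOL-Library.Poly_Mapping"
    "HOL-Library.Sublist"
begin

section \<open>Matroids of varieties and of linear spaces of symmetric matrices\<close>

text \<open>
  The index set \<open>{1, ..., n}\<close> is a finite linearly ordered type \<open>'n\<close>, with \<open>n = CARD('n) \<ge> 1\<close>.
  Points of \<open>K^S\<close> are the functions in \<open>S \<rightarrow>\<^sub>E UNIV\<close>; a symmetric matrix is identified
  with the point of \<open>K^E\<close> given by its entries on and above the diagonal.
\<close>

definition sym_entries :: "('n::{finite,linorder} \<times> 'n) set" where
  "sym_entries = {(i, j). i \<le> j}"

definition entries_proj :: "('n \<times> 'n) set \<Rightarrow> 'a^'n^'n \<Rightarrow> 'n \<times> 'n \<Rightarrow> 'a" where
  "entries_proj S A = restrict (\<lambda>(i, j). A $ i $ j) S"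

definition matroid_bases :: "'e set \<Rightarrow> ('e set \<Rightarrow> bool) \<Rightarrow> 'e set set" where
  "matroid_bases E indep =
     {B. B \<subseteq> E \<and> indep B \<and> (\<forall>B'. B \<subset> B' \<and> B' \<subseteq> E \<longrightarrow> \<not> indep B')}"

text \<open>
  A multivariate polynomial with variables in \<open>'x\<close> is a finitely supported map from monomials
  (finitely supported exponent vectors) to coefficients.
\<close>

definition mpoly_eval :: "(('x \<Rightarrow>\<^sub>0 nat) \<Rightarrow>\<^sub>0 'k::field) \<Rightarrow> ('x \<Rightarrow> 'k) \<Rightarrow> 'k" where
  "mpoly_eval p x =
     (\<Sum>m\<in>Poly_Mapping.keys p. Poly_Mapping.lookup p m *
        (\<Prod>v\<in>Poly_Mapping.keys m. x v ^ Poly_Mapping.lookup m v))"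

definition mpolys_on :: "'x set \<Rightarrow> (('x \<Rightarrow>\<^sub>0 nat) \<Rightarrow>\<^sub>0 'k::field) set" where
  "mpolys_on S = {p. \<forall>m\<in>Poly_Mapping.keys p. Poly_Mapping.keys m \<subseteq> S}"

definition zariski_closure :: "'x set \<Rightarrow> ('x \<Rightarrow> 'k::field) set \<Rightarrow> ('x \<Rightarrow> 'k) set" where
  "zariski_closure S X =
     {x \<in> S \<rightarrow>\<^sub>E UNIV. \<forall>p\<in>mpolys_on S. (\<forall>a\<in>X. mpoly_eval p a = 0) \<longrightarrow> mpoly_eval p x = 0}"

text \<open>Independence in the algebraic matroid: the projection of \<open>V\<close> to \<open>K^S\<close> is dominant.\<close>

definition alg_indep :: "('k::field^'n^'n) set \<Rightarrow> ('n \<times> 'n) set \<Rightarrow> bool" where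
  "alg_indep V S \<longleftrightarrow> zariski_closure S (entries_proj S ` V) = S \<rightarrow>\<^sub>E UNIV"

definition linear_indep :: "(real^'n^'n) set \<Rightarrow> ('n \<times> 'n) set \<Rightarrow> bool" where
  "linear_indep W S \<longleftrightarrow> entries_proj S ` W = S \<rightarrow>\<^sub>E UNIV"

definition sym_rank_le_2 :: "('k::field^'n^'n) set" where
  "sym_rank_le_2 = {A. transpose A = A \<and> rank A \<le> 2}"


section \<open>Trees\<close>

datatype 'n label = Unprimed 'n | Primed 'n

primrec prime_swap :: "'n label \<Rightarrow> 'n label" where
  "prime_swap (Unprimed i) = Primed i"
| "prime_swap (Primed i) = Unprimed i"

definition is_path :: "'v set \<Rightarrow> 'v set set \<Rightarrow> 'v list \<Rightarrow> bool" where
  "is_path V E p \<longleftrightarrow>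
     p \<noteq> [] \<and> distinct p \<and> set p \<subseteq> V \<and> successively (\<lambda>u v. {u, v} \<in> E) p"

definition path_between :: "'v set \<Rightarrow> 'v set set \<Rightarrow> 'v \<Rightarrow> 'v list \<Rightarrow> 'v \<Rightarrow> bool" where
  "path_between V E u p v \<longleftrightarrow> is_path V E p \<and> hd p = u \<and> last p = v"

definition is_tree :: "'v set \<Rightarrow> 'v set set \<Rightarrow> bool" where
  "is_tree V E \<longleftrightarrow>
     finite V \<and> V \<noteq> {} \<and>
     (\<forall>e\<in>E. \<exists>u\<in>V. \<exists>v\<in>V. u \<noteq> v \<and> e = {u, v}) \<and>
     (\<forall>u\<in>V. \<forall>v\<in>V. \<exists>!p. path_between V E u p v)"

text \<open>
  The involution on vertices is part of the data. For a symbic tree (see below) it is determined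
  on \<open>verts\<close> by the other components.
\<close>

record ('v, 'n) labelled_tree =
  verts :: "'v set"
  edges :: "'v set set"
  leaf :: "'n label \<Rightarrow> 'v"
  invol :: "'v \<Rightarrow> 'v"

definition valency :: "('v, 'n) labelled_tree \<Rightarrow> 'v \<Rightarrow> nat" where
  "valency T v = card {e \<in> edges T. v \<in> e}"

definition leaves :: "('v, 'n) labelled_tree \<Rightarrow> 'v set" where
  "leaves T = {v \<in> verts T. valency T v = 1}"

definition internal_edges :: "('v, 'n) labelled_tree \<Rightarrow> 'v set set" where
  "internal_edges T = {e \<in> edges T. e \<inter> leaves T = {}}"

text \<open>The vertices of the component of \<open>u\<close> after removal of the edge \<open>e\<close>.\<close>

definition side :: "('v, 'n) labelled_tree \<Rightarrow> 'v set \<Rightarrow> 'v \<Rightarrow> 'v set" where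
  "side T e u = {w. \<exists>p. path_between (verts T) (edges T - {e}) u p w}"

definition split :: "('v, 'n) labelled_tree \<Rightarrow> 'v set \<Rightarrow> 'n label set set" where
  "split T e = (\<lambda>u. {x. leaf T x \<in> side T e u}) ` e"

definition splits :: "('v, 'n) labelled_tree \<Rightarrow> 'n label set set set" where
  "splits T = split T ` internal_edges T"


section \<open>Symbic trees\<close>

definition trunk :: "('v, 'n) labelled_tree \<Rightarrow> 'v set" where
  "trunk T = {v \<in> verts T. invol T v = v}"

text \<open>
  If the involution flips an edge, that edge is subdivided at its midpoint, which is then the
  only trunk vertex and has degree 2; this is the only degree 2 vertex allowed. Its two
  incident edges are exchanged by the involution and (if internal) give the same split.
  With this convention the trunk always contains a vertex, the fixed points of the
  geometric tree form a path iff the fixed vertices do, and no edge of the tree is flipped.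
\<close>

definition symbic_tree :: "('v, 'n) labelled_tree \<Rightarrow> bool" where
  "symbic_tree T \<longleftrightarrow>
     is_tree (verts T) (edges T) \<and>
     bij_betw (leaf T) UNIV (leaves T) \<and>
     (\<forall>v\<in>verts T. invol T v \<in> verts T \<and> invol T (invol T v) = v) \<and>
     (\<forall>u\<in>verts T. \<forall>v\<in>verts T. {invol T u, invol T v} \<in> edges T \<longleftrightarrow> {u, v} \<in> edges T) \<and>
     (\<forall>x. invol T (leaf T x) = leaf T (prime_swap x)) \<and>
     (\<exists>p. is_path (verts T) (edges T) p \<and> set p = trunk T) \<and>
     (\<forall>v\<in>verts T. valency T v = 2 \<longrightarrow> trunk T = {v}) \<and>
     (\<forall>P\<in>splits T. \<forall>A\<in>P. (\<exists>i. Unprimed i \<in> A) \<and> (\<exists>j. Primed j \<in> A))"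

text \<open>
  The two halves of a subdivided edge lie in one orbit, so the orbits of internal edges
  correspond to the orbits of splits.
\<close>

definition regular :: "('v, 'n::finite) labelled_tree \<Rightarrow> bool" where
  "regular T \<longleftrightarrow> card ((\<lambda>e. {e, invol T ` e}) ` internal_edges T) = CARD('n) - 1"

text \<open>
  Branches, as sets of vertices: there is one for each edge \<open>{t, u}\<close> leaving the trunk at \<open>t\<close>.
\<close>

definition branches :: "('v, 'n) labelled_tree \<Rightarrow> 'v set set" where
  "branches T =
     {insert t (side T {t, u} u) | t u. t \<in> trunk T \<and> u \<notin> trunk T \<and> {t, u} \<in> edges T}"

definition cherries :: "('v, 'n) labelled_tree \<Rightarrow> ('n \<times> 'n) set" where
  "cherries T =
     {(i, j). \<exists>w \<in> verts T - leaves T.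
        {w, leaf T (Unprimed i)} \<in> edges T \<and> {w, leaf T (Primed j)} \<in> edges T}"

definition caterpillar_branch :: "('v, 'n) labelled_tree \<Rightarrow> 'v set \<Rightarrow> bool" where
  "caterpillar_branch T B \<longleftrightarrow>
     card {(i, j) \<in> cherries T. leaf T (Unprimed i) \<in> B \<and> leaf T (Primed j) \<in> B} = 1 \<or>
     (\<exists>t\<in>trunk T. \<exists>x. B = {t, leaf T x})"

definition caterpillar_branches :: "('v, 'n) labelled_tree \<Rightarrow> bool" where
  "caterpillar_branches T \<longleftrightarrow> (\<forall>B\<in>branches T. caterpillar_branch T B)"


section \<open>The cone of a symbic tree\<close>

text \<open>Only the lengths of internal edges matter; the values on other edges are unconstrained.\<close>

definition symbic_metric :: "('v, 'n) labelled_tree \<Rightarrow> ('v set \<Rightarrow> real) \<Rightarrow> bool" where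
  "symbic_metric T len \<longleftrightarrow> (\<forall>e\<in>internal_edges T. 0 < len e \<and> len (invol T ` e) = len e)"

definition tree_path :: "('v, 'n) labelled_tree \<Rightarrow> 'v \<Rightarrow> 'v \<Rightarrow> 'v list" where
  "tree_path T u v = (THE p. path_between (verts T) (edges T) u p v)"

definition tree_dist :: "('v, 'n) labelled_tree \<Rightarrow> ('v set \<Rightarrow> real) \<Rightarrow> 'v \<Rightarrow> 'v \<Rightarrow> real" where
  "tree_dist T len u v =
     (let p = tree_path T u v in \<Sum>k<length p - 1. len {p ! k, p ! Suc k})"

definition base_vertex :: "('v, 'n) labelled_tree \<Rightarrow> 'v" where
  "base_vertex T = (SOME v. v \<in> trunk T)"

definition diverge :: "('v, 'n) labelled_tree \<Rightarrow> 'v \<Rightarrow> 'v \<Rightarrow> 'v \<Rightarrow> 'v" where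
  "diverge T r a b = last (longest_common_prefix (tree_path T r a) (tree_path T r b))"

definition tree_matrix :: "('v, 'n) labelled_tree \<Rightarrow> ('v set \<Rightarrow> real) \<Rightarrow> real^'n^'n" where
  "tree_matrix T len =
     (\<chi> i j. tree_dist T len (base_vertex T)
        (diverge T (base_vertex T) (leaf T (Unprimed i)) (leaf T (Primed j))))"

definition symbic_cone :: "('v, 'n) labelled_tree \<Rightarrow> (real^'n^'n) set" where
  "symbic_cone T =
     {tree_matrix T len + (\<chi> i j. X $ i + X $ j) | len (X :: real^'n). symbic_metric T len}"


section \<open>Collections of bases\<close>

definition variety_bases ::
    "('k::field^'n::{finite,linorder}^'n::{finite,linorder}) set \<Rightarrow> ('n \<times> 'n) set set" where
  "variety_bases V = matroid_bases sym_entries (alg_indep V)"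

definition tree_bases ::
    "('v, 'n::{finite,linorder}) labelled_tree \<Rightarrow> ('n \<times> 'n) set set" where
  "tree_bases T = matroid_bases sym_entries (linear_indep (span (symbic_cone T)))"

text \<open>
  Every finite tree is isomorphic to one whose vertices are natural numbers, so all
  combinatorial types of symbic trees occur here.
\<close>

definition regular_symbic_trees :: "(nat, 'n::finite) labelled_tree set" where
  "regular_symbic_trees = {T. symbic_tree T \<and> regular T}"

end

theory Submission
  imports Defs "HOL-Computational_Algebra.Polynomial_Factorial"
begin

text \<open>
  Write a symmetric matrix of rank at most two as \<open>x i * y j + x j * y i\<close> and put \<open>z i = y i / x i\<close>,
  so that its entries are \<open>x i * x j * (z i - (- z j))\<close>. If the entries in \<open>S\<close> are algebraically
  independent on a generic matrix, Chevalley's theorem yields a valuation for which the values of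
  these entries are independent. The points \<open>z i\<close> and \<open>- z j\<close> span an ultrametric tree with
  involution, and independence of \<open>S\<close> in that tree means that a system of linear relations on
  weights supported on \<open>S\<close> has only the zero solution. Nearest-neighbour interchanges preserve this
  property for at least one of the two neighbours and lead to caterpillar branches.

  Conversely, for a symbic tree \<open>T\<close>, the points \<open>z i\<close> can be chosen as polynomials in \<open>t\<close> such that
  the entries vanish at \<open>t = 0\<close> to orders given by \<open>T\<close>. If \<open>S\<close> is independent in \<open>T\<close>, these orders
  can be made to separate the monomials of any given polynomial in the entries in \<open>S\<close>, which
  therefore does not vanish identically. Finally, the span of the cone of a regular tree has
  dimension \<open>2 n - 1\<close>, so maximality of independent sets agrees on both sides.
\<close>

section \<open>Rooted trees\<close>

text \<open>The valuation of a generic point has values in an arbitrary ordered group and yields no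
  real metric, so the forward direction works dually. That a symmetric weight \<omega> annihilates
  the span of the cone means that its row sums vanish (pairing with \<open>L\<close>) and that, for
  each orbit of internal vertices, the weights of the pairs diverging there add up to zero. For
  integral \<omega> supported on \<open>S\<close> these conditions make the product of the powers
  \<open>a (i, j) powi \<omega> i j\<close> a unit of the valuation ring, and a valuation separating
  the monomials on \<open>S\<close> leaves only \<omega> = 0. The conditions have integer
  coefficients, so the real case follows through additive maps from the reals to the rationals.

  Two complications come from the trunk. The colour condition on splits asks that each group of
  leaves along it end in two opposite signs, which costs a further rearrangement. In the converse
  direction the base vertex may lie inside the trunk, where two trunk children share the coefficient
  0; exchanging \<open>x\<close> and \<open>y\<close> on one of the two sides sends that side to
  infinity.\<close>

lemma ex1_eq: "\<exists>!x. Q x \<Longrightarrow> Q a \<Longrightarrow> Q b \<Longrightarrow> a = b"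
  by auto

lemma path_betweenD:
  assumes "path_between V E u p v"
  shows "p \<noteq> []" "distinct p" "set p \<subseteq> V" "successively (\<lambda>u v. {u, v} \<in> E) p"
    "hd p = u" "last p = v" "u \<in> V" "v \<in> V"
  using assms by (auto simp: path_between_def is_path_def)

lemma path_between_rev: "path_between V E u p v \<Longrightarrow> path_between V E v (rev p) u"
  by (auto simp: path_between_def is_path_def hd_rev last_rev insert_commute)

lemma path_between_same: "path_between V E u p u \<longleftrightarrow> p = [u] \<and> u \<in> V"
proof
  assume p: "path_between V E u p u"
  then obtain q where q: "p = u # q"
    using path_betweenD(1,5)[OF p] by (cases p) auto
  with p have "q = []"
    by (auto simp: path_between_def is_path_def split: if_splits)
  with q p show "p = [u] \<and> u \<in> V" by (auto simp: path_betweenD)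
qed (auto simp: path_between_def is_path_def)

lemma path_between_mono:
  "path_between V E u p v \<Longrightarrow> V \<subseteq> V' \<Longrightarrow> E \<subseteq> E' \<Longrightarrow> path_between V' E' u p v"
  unfolding path_between_def is_path_def by (auto intro: successively_mono)

lemma path_between_Cons:
  assumes "path_between V E u p v" "a \<in> V" "a \<notin> set p" "{a, u} \<in> E"
  shows "path_between V E a (a # p) v"
  using assms by (auto simp: path_between_def is_path_def successively_Cons)

lemma path_between_snoc:
  assumes "path_between V E u p v" "a \<in> V" "a \<notin> set p" "{v, a} \<in> E"
  shows "path_between V E u (p @ [a]) a"
  using assms by (auto simp: path_between_def is_path_def successively_append_iff)

lemma path_between_prefix:
  assumes "path_between V E u (p @ q) v" "p \<noteq> []"
  shows "path_between V E u p (last p)"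
  using assms by (auto simp: path_between_def is_path_def successively_append_iff)

lemma path_between_suffix:
  assumes "path_between V E u (p @ q) v" "q \<noteq> []"
  shows "path_between V E (hd q) q v"
  using assms by (auto simp: path_between_def is_path_def successively_append_iff)

text \<open>A path visiting \<open>w\<close> in its interior would enter and leave it through its
  only neighbour \<open>u\<close>, hence repeat \<open>u\<close>.\<close>

lemma path_between_new_leaf:
  assumes E: "\<And>e. e \<in> E \<Longrightarrow> e \<subseteq> V" and "w \<notin> V" "u \<in> V"
    and p: "path_between (insert w V) (insert {w, u} E) a p b" and "a \<noteq> w" "b \<noteq> w"
  shows "path_between V E a p b"
proof -
  have nbr: "x = u" if "{w, x} \<in> insert {w, u} E" "x \<noteq> w" for x
    using that E[of "{w, x}"] \<open>w \<notin> V\<close> by (auto simp: doubleton_eq_iff)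
  have w: "w \<notin> set p"
  proof
    assume "w \<in> set p"
    then obtain xs ys where s: "p = xs @ w # ys" by (auto dest: split_list)
    from p s \<open>a \<noteq> w\<close> \<open>b \<noteq> w\<close> have ne: "xs \<noteq> []" "ys \<noteq> []"
      by (auto simp: path_between_def)
    from p s ne have "{last xs, w} \<in> insert {w, u} E" "{w, hd ys} \<in> insert {w, u} E"
      "distinct p"
      unfolding path_between_def is_path_def
      by (auto simp: successively_append_iff successively_Cons)
    moreover have "last xs \<noteq> w" "hd ys \<noteq> w" "last xs \<noteq> hd ys"
      using \<open>distinct p\<close> s ne by (auto dest: last_in_set hd_in_set)
    ultimately show False using nbr by (metis insert_commute)
  qed
  have "successively (\<lambda>u v. {u, v} \<in> E) p"
  proof (rule successively_mono)
    show "successively (\<lambda>ua v. {ua, v} \<in> insert {w, u} E) p"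
      using p by (auto dest: path_betweenD)
  next
    fix x y assume "x \<in> set p" "y \<in> set p" "{x, y} \<in> insert {w, u} E"
    with w show "{x, y} \<in> E" by (auto simp: doubleton_eq_iff)
  qed
  with w p show ?thesis by (auto simp: path_between_def is_path_def)
qed

lemma path_between_from_new_leaf:
  assumes E: "\<And>e. e \<in> E \<Longrightarrow> e \<subseteq> V" and "w \<notin> V" "u \<in> V"
    and p: "path_between (insert w V) (insert {w, u} E) w p b" and "b \<noteq> w"
  shows "\<exists>q. p = w # q \<and> path_between V E u q b"
proof -
  obtain q where q: "p = w # q" using path_betweenD(1,5)[OF p] by (cases p) auto
  have ne: "q \<noteq> []" using p q \<open>b \<noteq> w\<close> by (auto simp: path_between_def)
  have "{w, hd q} \<in> insert {w, u} E" "w \<notin> set q"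
    using p q ne by (auto simp: path_between_def is_path_def successively_Cons)
  then have hq: "hd q = u" using E[of "{w, hd q}"] \<open>w \<notin> V\<close> ne
    by (auto simp: doubleton_eq_iff)
  have "path_between (insert w V) (insert {w, u} E) u q b"
    using path_between_suffix[of _ _ w "[w]" q b] p q ne hq by auto
  then have "path_between V E u q b"
    using path_between_new_leaf[OF E \<open>w \<notin> V\<close> \<open>u \<in> V\<close>] \<open>b \<noteq> w\<close> \<open>u \<in> V\<close> \<open>w \<notin> V\<close> by blast
  with q show ?thesis by blast
qed

lemma is_treeD:
  assumes "is_tree V E"
  shows "finite V" "V \<noteq> {}" "\<And>e. e \<in> E \<Longrightarrow> e \<subseteq> V" "{u, v} \<in> E \<Longrightarrow> u \<noteq> v"
    "\<And>u v. u \<in> V \<Longrightarrow> v \<in> V \<Longrightarrow> \<exists>!p. path_between V E u p v"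
proof -
  show "finite V" "V \<noteq> {}" "\<And>u v. u \<in> V \<Longrightarrow> v \<in> V \<Longrightarrow> \<exists>!p. path_between V E u p v"
    using assms unfolding is_tree_def by simp_all
  have *: "\<exists>u\<in>V. \<exists>v\<in>V. u \<noteq> v \<and> e = {u, v}" if "e \<in> E" for e
    using assms that unfolding is_tree_def by simp
  from * show "e \<in> E \<Longrightarrow> e \<subseteq> V" for e by blast
  show "u \<noteq> v" if "{u, v} \<in> E" using *[OF that] by (auto simp: doubleton_eq_iff)
qed

lemma is_tree_new_leaf:
  assumes t: "is_tree V E" and w: "w \<notin> V" and u: "u \<in> V"
  shows "is_tree (insert w V) (insert {w, u} E)"
proof -
  let ?V = "insert w V" and ?E = "insert {w, u} E"
  note E = is_treeD(3)[OF t]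
  have fromw: "\<exists>!p. path_between ?V ?E w p b" if b: "b \<in> V" for b
  proof -
    have bw: "b \<noteq> w" using b w by auto
    obtain q where q: "path_between V E u q b" and uq: "\<And>q'. path_between V E u q' b \<Longrightarrow> q' = q"
      using is_treeD(5)[OF t u b] by blast
    have "path_between ?V ?E w (w # q) b"
      using w path_between_mono[OF q, of ?V ?E] path_betweenD(3)[OF q]
      by (intro path_between_Cons) auto
    moreover have "p = w # q" if "path_between ?V ?E w p b" for p
      using path_between_from_new_leaf[OF E w u that bw] uq by blast
    ultimately show ?thesis by blast
  qed
  have uniq: "\<exists>!p. path_between ?V ?E a p b" if ab: "a \<in> ?V" "b \<in> ?V" for a b
  proof (cases "a = w")
    case True
    show ?thesis
    proof (cases "b = w")
      case True
      with \<open>a = w\<close> show ?thesis by (auto simp: path_between_same)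
    next
      case False
      with ab fromw \<open>a = w\<close> show ?thesis by auto
    qed
  next
    case aw: False
    show ?thesis
    proof (cases "b = w")
      case True
      from ab aw have "a \<in> V" by blast
      note ex1 = fromw[OF this]
      obtain p where p: "path_between ?V ?E w p a" using ex1_implies_ex[OF ex1] by (rule exE)
      have "path_between ?V ?E a (rev p) b" unfolding True by (rule path_between_rev[OF p])
      moreover have "q = rev p" if q: "path_between ?V ?E a q b" for q
      proof -
        have "path_between ?V ?E w (rev q) a" using path_between_rev[OF q] unfolding True .
        then have "rev q = p" using p by (rule ex1_eq[OF ex1])
        then show ?thesis by (metis rev_rev_ident)
      qed
      ultimately show ?thesis by (rule ex1I)
    next
      case False
      with ab aw have "a \<in> V" "b \<in> V" by auto
      from is_treeD(5)[OF t this] obtain p where p: "path_between V E a p b"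
        and up: "\<And>p'. path_between V E a p' b \<Longrightarrow> p' = p" by blast
      have "path_between ?V ?E a p b" by (rule path_between_mono[OF p]) auto
      with up path_between_new_leaf[OF E w u _ aw False] show ?thesis by blast
    qed
  qed
  have "\<exists>a\<in>?V. \<exists>b\<in>?V. a \<noteq> b \<and> e = {a, b}" if "e \<in> ?E" for e
  proof (cases "e = {w, u}")
    case True
    moreover have "w \<noteq> u" using w u by auto
    ultimately show ?thesis using u by (intro bexI[of _ w] bexI[of _ u]) auto
  next
    case False
    with that have "e \<in> E" by blast
    with t have "\<exists>a\<in>V. \<exists>b\<in>V. a \<noteq> b \<and> e = {a, b}" unfolding is_tree_def by simp
    then obtain a b where "a \<in> V" "b \<in> V" "a \<noteq> b" "e = {a, b}" by blast
    then show ?thesis by (intro bexI[of _ a] bexI[of _ b]) auto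
  qed
  with uniq is_treeD(1)[OF t] show ?thesis unfolding is_tree_def by simp
qed

text \<open>\<open>P v\<close> is the list of vertices from the root to \<open>v\<close>, carried as
  data next to \<open>par\<close>. By \<open>P_step\<close> its length drops towards the root, which
  supplies the well-foundedness of \<open>par\<close>. Both a given tree and an explicitly
  constructed one can be presented in this form.\<close>

locale rtree =
  fixes V :: "'v set" and r :: 'v and par :: "'v \<Rightarrow> 'v" and P :: "'v \<Rightarrow> 'v list"
  assumes finV: "finite V" and rV: "r \<in> V" and P_root: "P r = [r]"
    and parV: "v \<in> V \<Longrightarrow> v \<noteq> r \<Longrightarrow> par v \<in> V"
    and P_step: "v \<in> V \<Longrightarrow> v \<noteq> r \<Longrightarrow> P v = P (par v) @ [v]"
begin

definition E :: "'v set set" where "E = (\<lambda>v. {v, par v}) ` (V - {r})"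

lemma tree_induct [consumes 1, case_names root step]:
  assumes "v \<in> V" "Q r" "\<And>v. v \<in> V \<Longrightarrow> v \<noteq> r \<Longrightarrow> Q (par v) \<Longrightarrow> Q v"
  shows "Q v"
  using assms(1)
proof (induction "length (P v)" arbitrary: v rule: less_induct)
  case less
  show ?case
  proof (cases "v = r")
    case False
    with less parV P_step have "Q (par v)" by simp
    with False less.prems assms(3) show ?thesis by blast
  qed (use assms(2) in simp)
qed

lemma P_ne [simp]: "v \<in> V \<Longrightarrow> P v \<noteq> []"
  by (cases "v = r") (auto simp: P_root P_step)

lemma last_P [simp]: "v \<in> V \<Longrightarrow> last (P v) = v"
  by (cases "v = r") (auto simp: P_root P_step)

lemma hd_P [simp]: "v \<in> V \<Longrightarrow> hd (P v) = r"
  by (induction v rule: tree_induct) (auto simp: P_root P_step parV)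

lemma v_in_P [simp]: "v \<in> V \<Longrightarrow> v \<in> set (P v)"
  by (metis last_P last_in_set P_ne)

lemma set_P: "v \<in> V \<Longrightarrow> set (P v) \<subseteq> V"
  by (induction v rule: tree_induct) (auto simp: P_root P_step rV)

lemma P_split:
  assumes "v \<in> V" "u \<in> set (P v)"
  shows "\<exists>q. P v = P u @ q"
  using assms
proof (induction v rule: tree_induct)
  case (step v)
  show ?case
  proof (cases "u = v")
    case False
    with step have "u \<in> set (P (par v))" by (simp add: P_step)
    with step obtain q where "P (par v) = P u @ q" by blast
    with step show ?thesis by (simp add: P_step)
  qed simp
qed (simp add: P_root)

lemma length_P_le: "v \<in> V \<Longrightarrow> u \<in> set (P v) \<Longrightarrow> length (P u) \<le> length (P v)"
  using P_split by fastforce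

lemma par_notin: "v \<in> V \<Longrightarrow> v \<noteq> r \<Longrightarrow> v \<notin> set (P (par v))"
  using length_P_le[of "par v" v] by (auto simp: P_step parV)

lemma par_neq: "v \<in> V \<Longrightarrow> v \<noteq> r \<Longrightarrow> par v \<noteq> v"
  using par_notin[of v] parV[of v] by (metis v_in_P)

lemma distinct_P: "v \<in> V \<Longrightarrow> distinct (P v)"
  by (induction v rule: tree_induct) (auto simp: P_root P_step par_notin)

lemma P_eq_imp: "u \<in> V \<Longrightarrow> v \<in> V \<Longrightarrow> P u = P v \<Longrightarrow> u = v"
  by (metis last_P)

lemma anc_antisym: "v \<in> V \<Longrightarrow> u \<in> set (P v) \<Longrightarrow> v \<in> set (P u) \<Longrightarrow> u = v"
proof -
  assume v: "v \<in> V" and u: "u \<in> set (P v)" and v': "v \<in> set (P u)"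
  from v u have uV: "u \<in> V" using set_P by blast
  obtain q where q: "P v = P u @ q" using P_split[OF v u] by blast
  obtain q' where "P u = P v @ q'" using P_split[OF uV v'] by blast
  with q have "P u = P v" by simp
  with P_eq_imp[OF uV v] show "u = v" .
qed

lemma anc_trans: "w \<in> V \<Longrightarrow> v \<in> set (P w) \<Longrightarrow> u \<in> set (P v) \<Longrightarrow> u \<in> set (P w)"
  using P_split[of w v] by auto

lemma r_in_P: "v \<in> V \<Longrightarrow> r \<in> set (P v)"
  by (metis hd_P hd_in_set P_ne)

lemma edgeI: "v \<in> V \<Longrightarrow> v \<noteq> r \<Longrightarrow> {v, par v} \<in> E"
  by (auto simp: E_def)

lemma edgeI': "v \<in> V \<Longrightarrow> v \<noteq> r \<Longrightarrow> {par v, v} \<in> E"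
  using edgeI[of v] by (simp add: insert_commute)

lemma edge_cases:
  assumes "{u, v} \<in> E"
  obtains "u \<in> V" "u \<noteq> r" "v = par u" "v \<in> V" | "v \<in> V" "v \<noteq> r" "u = par v" "u \<in> V"
proof -
  from assms obtain w where w: "w \<in> V" "w \<noteq> r" "{u, v} = {w, par w}" unfolding E_def by blast
  from w(3) consider "u = w" "v = par w" | "v = w" "u = par w" by (auto simp: doubleton_eq_iff)
  then show ?thesis using w parV that by cases auto
qed

lemma edge_inj: "u \<in> V - {r} \<Longrightarrow> v \<in> V - {r} \<Longrightarrow> {u, par u} = {v, par v} \<Longrightarrow> u = v"
proof (rule ccontr)
  assume uv: "u \<in> V - {r}" "v \<in> V - {r}" and e: "{u, par u} = {v, par v}" and "u \<noteq> v"
  from e \<open>u \<noteq> v\<close> have "par u = v" "par v = u" by (auto simp: doubleton_eq_iff)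
  with P_step[of u] P_step[of v] uv have "length (P u) = length (P v) + 1" "length (P v) = length (P u) + 1"
    by auto
  then show False by simp
qed

lemma path_P: "v \<in> V \<Longrightarrow> path_between V E r (P v) v"
proof (induction v rule: tree_induct)
  case root
  then show ?case by (simp add: P_root path_between_same rV)
next
  case (step v)
  then show ?case
    using path_between_snoc[OF step(3), of v] by (simp add: P_step par_notin edgeI')
qed

end

text \<open>Induction on the number of vertices: a vertex of maximal depth is nobody's parent, so it
  can be removed and attached again by \<open>is_tree_new_leaf\<close>.\<close>

lemma rtree_is_tree:
  assumes "rtree V r par P"
  shows "is_tree V (rtree.E V r par)"
  using assms
proof (induction "card V" arbitrary: V rule: less_induct)
  case less
  interpret rtree V r par P by fact
  show ?case
  proof (cases "V = {r}")
    case True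
    then show ?thesis
      unfolding is_tree_def E_def by (auto simp: path_between_same)
  next
    case False
    then have ne: "V - {r} \<noteq> {}" using rV by blast
    let ?L = "(\<lambda>v. length (P v)) ` (V - {r})"
    have "Max ?L \<in> ?L" using ne finV by (intro Max_in) auto
    then obtain w where w: "w \<in> V - {r}" and "Max ?L = length (P w)" by blast
    then have mx: "length (P v) \<le> length (P w)" if "v \<in> V - {r}" for v
      using that finV by (metis Max_ge finite_Diff finite_imageI imageI)
    let ?W = "V - {w}"
    have pw: "par v \<noteq> w" if "v \<in> V - {r}" for v
      using mx[OF that] that P_step[of v] by auto
    have rt: "rtree ?W r par P"
      by (rule rtree.intro) (use w pw finV rV P_root parV P_step in blast)+
    have "card ?W < card V" using w finV by (meson DiffE card_Diff1_less)
    from less.hyps[OF this rt] have "is_tree ?W (rtree.E ?W r par)" .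
    then have "is_tree (insert w ?W) (insert {w, par w} (rtree.E ?W r par))"
      using w pw parV by (intro is_tree_new_leaf) auto
    moreover have "insert w ?W = V" using w by auto
    moreover have "insert {w, par w} (rtree.E ?W r par) = E"
      unfolding E_def rtree.E_def[OF rt] using w by auto
    ultimately show ?thesis by simp
  qed
qed

text \<open>The parent is the last but one vertex on the path from \<open>r\<close>. Every edge of
  \<open>G\<close> is a parent edge, because the path to one of its ends can be prolonged through
  the edge and paths are unique.\<close>

lemma is_tree_rtree:
  assumes t: "is_tree V G" and r: "r \<in> V"
  defines "P \<equiv> \<lambda>v. THE p. path_between V G r p v"
  defines "par \<equiv> \<lambda>v. last (butlast (P v))"
  shows "rtree V r par P" "rtree.E V r par = G"
proof -
  note tD = is_treeD[OF t]
  have PP: "path_between V G r (P v) v" if "v \<in> V" for v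
    unfolding P_def using theI'[OF tD(5)[OF r that]] .
  have PU: "P v = p" if "path_between V G r p v" for v p
    using that PP[of v] tD(5)[OF r, of v] path_betweenD(8)[OF that] by blast
  have Pr: "P r = [r]" using r by (intro PU) (simp add: path_between_same)
  have st: "P v = P (par v) @ [v] \<and> par v \<in> V \<and> {par v, v} \<in> G" if v: "v \<in> V" "v \<noteq> r" for v
  proof -
    have s: "P v = butlast (P v) @ [v]"
      using path_betweenD(1,6)[OF PP[OF v(1)]] append_butlast_last_id[of "P v"] by simp
    have ne: "butlast (P v) \<noteq> []"
    proof
      assume "butlast (P v) = []"
      with s have "P v = [v]" by simp
      with PP[OF v(1)] v(2) show False by (auto dest: path_betweenD)
    qed
    have p1: "path_between V G r (butlast (P v)) (par v)"
      unfolding par_def using path_between_prefix[of V G r "butlast (P v)" "[v]" v] PP[OF v(1)] s ne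
      by simp
    then have "P (par v) = butlast (P v)" by (rule PU)
    moreover have "{par v, v} \<in> G"
    proof -
      have "successively (\<lambda>u v. {u, v} \<in> G) (butlast (P v) @ [v])"
        using path_betweenD(4)[OF PP[OF v(1)]] s by simp
      then show ?thesis using ne by (simp add: successively_append_iff par_def)
    qed
    ultimately show ?thesis using s p1 by (auto dest: path_betweenD)
  qed
  show rt: "rtree V r par P"
    by (rule rtree.intro) (use st Pr tD(1) r in blast)+
  interpret rtree V r par P by fact
  show "rtree.E V r par = G"
  proof
    show "rtree.E V r par \<subseteq> G"
    proof
      fix e assume "e \<in> rtree.E V r par"
      then obtain v where "v \<in> V" "v \<noteq> r" "e = {v, par v}" unfolding E_def by blast
      moreover from this st have "{par v, v} \<in> G" by blast
      ultimately show "e \<in> G" by (metis insert_commute)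
    qed
  next
    show "G \<subseteq> rtree.E V r par"
    proof
      fix e assume e: "e \<in> G"
      with t have "\<exists>u\<in>V. \<exists>v\<in>V. u \<noteq> v \<and> e = {u, v}" unfolding is_tree_def by simp
      then obtain u v where uv: "u \<in> V" "v \<in> V" "u \<noteq> v" "e = {u, v}" by blast
      have *: "e \<in> rtree.E V r par" if "u \<in> V" "v \<in> V" "e = {u, v}" "v \<notin> set (P u)" for u v
      proof -
        have "path_between V G r (P u @ [v]) v"
          using PP[OF that(1)] that e by (intro path_between_snoc) auto
        then have "P v = P u @ [v]" by (rule PU)
        moreover have "v \<noteq> r" using that(4) r_in_P[OF that(1)] by auto
        ultimately have "par v = u" unfolding par_def using that(1) by simp
        with that \<open>v \<noteq> r\<close> show ?thesis by (auto simp: E_def)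
      qed
      \<comment> \<open>Two distinct vertices are not ancestors of each other, so one of the two
        orientations of the edge qualifies.\<close>
      have "v \<notin> set (P u) \<or> u \<notin> set (P v)"
        using anc_antisym[of u v] uv by auto
      then show "e \<in> rtree.E V r par"
        using *[of u v] *[of v u] uv by (auto simp: insert_commute)
    qed
  qed
qed

context rtree
begin

lemma tree: "is_tree V E" using rtree_is_tree rtree_axioms .

lemma path_r_iff: "path_between V E r p v \<longleftrightarrow> v \<in> V \<and> p = P v"
proof
  assume p: "path_between V E r p v"
  then have v: "v \<in> V" by (rule path_betweenD)
  from is_treeD(5)[OF tree rV v] p path_P[OF v] show "v \<in> V \<and> p = P v" using v by blast
qed (use path_P in blast)

section \<open>Subtrees, sides of edges and branching vertices\<close>

definition desc :: "'v \<Rightarrow> 'v set" where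
  "desc v = {w \<in> V. v \<in> set (P w)}"

lemma desc_par: "w \<in> V \<Longrightarrow> w \<noteq> r \<Longrightarrow> w \<noteq> v \<Longrightarrow> par w \<in> desc v \<longleftrightarrow> w \<in> desc v"
  by (auto simp: desc_def P_step parV)

text \<open>Membership in \<open>desc v\<close> changes only along the edge between \<open>v\<close>
  and its parent (\<open>desc_par\<close>), so a walk avoiding that edge stays on one side.\<close>

lemma path_avoid:
  assumes "successively (\<lambda>a b. {a, b} \<in> E - {{v, par v}}) p" "p \<noteq> []" "v \<in> V" "v \<noteq> r"
  shows "hd p \<in> desc v \<longleftrightarrow> last p \<in> desc v"
  using assms(1,2)
proof (induction p)
  case (Cons a p)
  show ?case
  proof (cases "p = []")
    case False
    with Cons have e: "{a, hd p} \<in> E" "{a, hd p} \<noteq> {v, par v}"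
      and IH: "hd p \<in> desc v \<longleftrightarrow> last p \<in> desc v" by (auto simp: successively_Cons)
    from e(1) have "a \<in> desc v \<longleftrightarrow> hd p \<in> desc v"
    proof (cases rule: edge_cases)
      case 1
      with e(2) have "a \<noteq> v" by auto
      with 1 desc_par[of a v] show ?thesis by simp
    next
      case 2
      with e(2) have "hd p \<noteq> v" by (auto simp: insert_commute)
      with 2 desc_par[of "hd p" v] show ?thesis by simp
    qed
    with IH False show ?thesis by simp
  qed simp
qed simp

lemma side_child:
  assumes v: "v \<in> V" "v \<noteq> r"
  shows "{w. \<exists>p. path_between V (E - {{v, par v}}) v p w} = desc v"
proof -
  have "w \<in> desc v" if "path_between V (E - {{v, par v}}) v p w" for w p
  proof -
    have "v \<in> desc v" using v by (simp add: desc_def)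
    then show ?thesis
      using path_avoid[OF path_betweenD(4,1)[OF that] v] path_betweenD(5,6)[OF that] by simp
  qed
  moreover have "\<exists>p. path_between V (E - {{v, par v}}) v p w" if "w \<in> desc v" for w
  proof -
    from that have "w \<in> V" "v \<in> set (P w)" by (auto simp: desc_def)
    then show ?thesis
    proof (induction w rule: tree_induct)
      case root
      then show ?case using v by (simp add: P_root)
    next
      case (step w)
      show ?case
      proof (cases "w = v")
        case True
        then show ?thesis using v path_between_same[of V _ v] by blast
      next
        case False
        with step have vp: "v \<in> set (P (par w))" by (simp add: P_step)
        with step obtain p where p: "path_between V (E - {{v, par v}}) v p (par w)" by blast
        have "{par w, w} \<in> E - {{v, par v}}"
          using edge_inj[of w v] False step v edgeI[of w] by (auto simp: insert_commute)
        show ?thesis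
        proof (cases "w \<in> set p")
          case True
          then obtain xs ys where "p = (xs @ [w]) @ ys" by (auto dest!: split_list)
          with path_between_prefix[of V _ v "xs @ [w]" ys] p show ?thesis by fastforce
        next
          case False
          with p step \<open>{par w, w} \<in> _\<close> show ?thesis by (blast intro: path_between_snoc)
        qed
      qed
    qed
  qed
  ultimately show ?thesis by blast
qed

text \<open>The complement of \<open>desc v\<close> is closed under \<open>par\<close>, hence itself
  an \<open>rtree\<close> with the same data; this gives the connectedness of the upper
  side.\<close>

lemma side_parent:
  assumes v: "v \<in> V" "v \<noteq> r"
  shows "{w. \<exists>p. path_between V (E - {{v, par v}}) (par v) p w} = V - desc v"
proof -
  have pv: "par v \<notin> desc v" using par_notin[OF v] by (auto simp: desc_def)
  have "w \<in> V - desc v" if "path_between V (E - {{v, par v}}) (par v) p w" for w p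
    using path_avoid[OF path_betweenD(4,1)[OF that] v] pv path_betweenD(5,6,8)[OF that] by simp
  moreover have "\<exists>p. path_between V (E - {{v, par v}}) (par v) p w" if w: "w \<in> V - desc v" for w
  proof -
    have rt: "rtree (V - desc v) r par P"
    proof
      show "r \<in> V - desc v" using rV v by (simp add: desc_def P_root)
      show "par w \<in> V - desc v" "P w = P (par w) @ [w]" if "w \<in> V - desc v" "w \<noteq> r" for w
      proof -
        have "w \<noteq> v" using that v by (auto simp: desc_def)
        with that show "par w \<in> V - desc v" "P w = P (par w) @ [w]"
          using parV[of w] P_step[of w] desc_par[of w v] by blast+
      qed
    qed (use finV P_root in simp_all)
    have "par v \<in> V - desc v" using pv parV v by auto
    with is_treeD(5)[OF rtree_is_tree[OF rt]] w
    obtain p where p: "path_between (V - desc v) (rtree.E (V - desc v) r par) (par v) p w" by blast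
    have "v \<in> desc v" using v by (auto simp: desc_def)
    then have "rtree.E (V - desc v) r par \<subseteq> E - {{v, par v}}"
      unfolding rtree.E_def[OF rt] E_def using edge_inj[of _ v] v by auto
    with p show ?thesis by (blast intro: path_between_mono)
  qed
  ultimately show ?thesis by blast
qed

definition children :: "'v \<Rightarrow> 'v set" where
  "children v = {w \<in> V. w \<noteq> r \<and> par w = v}"

lemma children_desc: "w \<in> children v \<Longrightarrow> w \<in> desc v"
  using parV[of w] by (auto simp: children_def desc_def P_step)

lemma card_edges:
  assumes "v \<in> V"
  shows "card {e \<in> E. v \<in> e} = card (children v) + (if v = r then 0 else 1)"
proof -
  have "{e \<in> E. v \<in> e} = (\<lambda>w. {w, par w}) ` (children v \<union> ({v} - {r}))"
    using assms by (auto simp: E_def children_def)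
  moreover have "inj_on (\<lambda>w. {w, par w}) (children v \<union> ({v} - {r}))"
    by (rule inj_on_subset[of _ "V - {r}"]) (use edge_inj assms in \<open>auto simp: inj_on_def children_def\<close>)
  moreover have "v \<notin> children v" using par_neq[of v] by (auto simp: children_def)
  moreover have "finite (children v)" using finV by (simp add: children_def)
  ultimately show ?thesis by (auto simp: card_image)
qed

lemma desc_child:
  assumes "w \<in> desc v" "w \<noteq> v"
  shows "\<exists>u \<in> children v. w \<in> desc u"
proof -
  from assms have "w \<in> V" "v \<in> set (P w)" by (auto simp: desc_def)
  then show ?thesis using assms(2)
  proof (induction w rule: tree_induct)
    case root then show ?case by (simp add: P_root)
  next
    case (step w)
    show ?case
    proof (cases "par w = v")
      case True
      then have "w \<in> children v" "w \<in> desc w" using step by (auto simp: children_def desc_def)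
      then show ?thesis by blast
    next
      case False
      with step obtain u where "u \<in> children v" "par w \<in> desc u" by (auto simp: P_step)
      moreover then have "w \<in> desc u" using step by (auto simp: desc_def P_step)
      ultimately show ?thesis by blast
    qed
  qed
qed

lemma P_below_child:
  assumes "w \<in> children v" "a \<in> desc w"
  shows "\<exists>q. P a = P v @ w # q"
proof -
  from assms obtain q where "P a = P w @ q" using P_split by (auto simp: desc_def)
  with assms show ?thesis by (auto simp: children_def P_step)
qed

text \<open>Both root paths run through \<open>v\<close> and differ at the next entry. This is the
  form needed for \<open>diverge\<close>, which is defined by longest common prefixes.\<close>

lemma lcp_meet:
  assumes "w1 \<in> children v" "w2 \<in> children v" "w1 \<noteq> w2" "a \<in> desc w1" "b \<in> desc w2"
  shows "last (longest_common_prefix (P a) (P b)) = v"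
proof -
  obtain q1 q2 where "P a = P v @ w1 # q1" "P b = P v @ w2 # q2"
    using P_below_child assms by metis
  moreover have "longest_common_prefix (p @ w1 # q1) (p @ w2 # q2) = p" for p
    using assms(3) by (induction p) auto
  moreover have "v \<in> V" using assms(1) parV by (auto simp: children_def)
  ultimately show ?thesis by simp
qed

text \<open>Climb from \<open>a\<close> to the first ancestor that also lies above \<open>b\<close>;
  its children towards \<open>a\<close> and towards \<open>b\<close> differ.\<close>

lemma meet_exists:
  assumes "a \<in> V" "b \<in> V" "a \<notin> desc b" "b \<notin> desc a"
  shows "\<exists>v w1 w2. w1 \<in> children v \<and> w2 \<in> children v \<and> w1 \<noteq> w2 \<and> a \<in> desc w1 \<and> b \<in> desc w2"
  using assms
proof (induction a rule: tree_induct)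
  case root
  then show ?case using r_in_P by (auto simp: desc_def)
next
  case (step a)
  show ?case
  proof (cases "b \<in> desc (par a)")
    case True
    have a: "a \<in> children (par a)" "a \<in> desc a" using step by (auto simp: children_def desc_def)
    have "b \<noteq> par a" using step a(1) children_desc by blast
    with True obtain u where u: "u \<in> children (par a)" "b \<in> desc u" using desc_child by blast
    with step have "u \<noteq> a" by auto
    with a u show ?thesis by blast
  next
    case False
    have "a \<noteq> b" using step by (auto simp: desc_def)
    then have "par a \<notin> desc b"
      using step desc_par[of a b] by (auto simp: desc_def)
    with step False obtain v w1 w2 where *: "w1 \<in> children v" "w2 \<in> children v" "w1 \<noteq> w2"
      "par a \<in> desc w1" "b \<in> desc w2" by blast
    moreover have "a \<in> desc w1" using *(4) step by (auto simp: desc_def P_step)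
    ultimately show ?thesis by blast
  qed
qed

end

section \<open>Symmetric matrices of rank at most two\<close>

lemma rank_le_2_iff:
  fixes A :: "'k::field^'n^'m"
  shows "rank A \<le> 2 \<longleftrightarrow> (\<exists>u p v q. \<forall>i j. A $ i $ j = u i * p j + v i * q j)"
proof
  assume r: "rank A \<le> 2"
  obtain B where B: "B \<subseteq> rows A" "vec.independent B" "rows A \<subseteq> vec.span B" "card B = vec.dim (rows A)"
    using vec.basis_exists by blast
  have c: "card B \<le> 2" using r B(4) by (simp add: row_rank_def_gen)
  have "\<exists>p q. B \<subseteq> {p, q}"
  proof -
    have "finite B" using vec.finiteI_independent B(2) by blast
    consider "card B = 0" | "card B = 1" | "card B = 2" using c by linarith
    then show ?thesis
      by cases (use \<open>finite B\<close> in \<open>auto simp: card_1_singleton_iff card_2_iff\<close>)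
  qed
  then obtain p q where "B \<subseteq> {p, q}" by blast
  with B(3) have s: "rows A \<subseteq> vec.span {p, q}" using vec.span_mono by blast
  have "\<exists>a b. row i A = a *s p + b *s q" for i
  proof -
    have "row i A \<in> vec.span {p, q}" using s by (auto simp: rows_def)
    then obtain a where "row i A - a *s p \<in> vec.span {q}" by (auto simp: vec.span_insert)
    then obtain b where "row i A - a *s p = b *s q" by (auto simp: vec.span_singleton)
    then have "row i A = a *s p + b *s q" by (simp add: algebra_simps)
    then show ?thesis by blast
  qed
  then obtain a b where ab: "\<And>i. row i A = a i *s p + b i *s q" by metis
  have "A $ i $ j = a i * p $ j + b i * q $ j" for i j
    using arg_cong[OF ab[of i], of "\<lambda>x. x $ j"] by (simp add: row_def)
  then show "\<exists>u p v q. \<forall>i j. A $ i $ j = u i * p j + v i * q j" by blast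
next
  assume "\<exists>u p v q. \<forall>i j. A $ i $ j = u i * p j + v i * q j"
  then obtain u p v q where A: "\<And>i j. A $ i $ j = u i * p j + v i * q j" by blast
  let ?p = "\<chi> j. p j" and ?q = "\<chi> j. q j"
  have "row i A = u i *s ?p + v i *s ?q" for i
    by (simp add: row_def vec_eq_iff A)
  moreover have "u i *s ?p + v i *s ?q \<in> vec.span {?p, ?q}" for i
    by (intro vec.span_add vec.span_scale vec.span_base) simp_all
  ultimately have "rows A \<subseteq> vec.span {?p, ?q}" by (auto simp: rows_def)
  then have "vec.dim (rows A) \<le> card {?p, ?q}" by (rule vec.dim_le_card) simp
  also have "\<dots> \<le> 2" by (simp add: card_insert_if)
  finally show "rank A \<le> 2" by (simp add: row_rank_def_gen)
qed

text \<open>A root \<open>s\<close> of the dehomogenised polynomial splits the factor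
  \<open>X - s * Y\<close> off the quadratic form with coefficients \<alpha>, \<beta>, \<gamma>. For
  \<alpha> = 0 the form is divisible by \<open>Y\<close>.\<close>

lemma binary_quadratic_factor:
  fixes \<alpha> \<beta> \<gamma> :: "'k::alg_closed_field"
  shows "\<exists>a b c d. a * c = \<alpha> \<and> a * d + b * c = \<beta> \<and> b * d = \<gamma>"
proof (cases "\<alpha> = 0")
  case True
  then show ?thesis by (intro exI[of _ 0] exI[of _ 1] exI[of _ \<beta>] exI[of _ \<gamma>]) simp
next
  case False
  then have "degree [:\<gamma>, \<beta>, \<alpha>:] > 0" by simp
  then obtain s where "poly [:\<gamma>, \<beta>, \<alpha>:] s = 0" using alg_closed_imp_poly_has_root by blast
  then have "s * (\<beta> + \<alpha> * s) = - \<gamma>" by (simp add: eq_neg_iff_add_eq_0 add.commute mult.commute)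
  then have s: "- (s * (\<beta> + \<alpha> * s)) = \<gamma>" by simp
  show ?thesis
    by (rule exI[of _ 1], rule exI[of _ "- s"], rule exI[of _ \<alpha>], rule exI[of _ "\<beta> + \<alpha> * s"])
       (use s in \<open>simp add: algebra_simps\<close>)
qed

lemma symmetric_rank_1_form:
  fixes w p :: "'i \<Rightarrow> 'k::field_char_0"
  assumes sym: "\<And>i j. w i * p j = w j * p i"
  shows "\<exists>x y. \<forall>i j. w i * p j = x i * y j + x j * y i"
proof (cases "\<exists>k. p k \<noteq> 0")
  case True
  then obtain k where k: "p k \<noteq> 0" by blast
  have w: "w i = w k / p k * p i" for i using sym[of i k] k by (simp add: field_simps)
  have "w i * p j = (w k / p k / 2 * p i) * p j + (w k / p k / 2 * p j) * p i" for i j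
    by (subst w) (simp add: field_simps)
  then show ?thesis by (intro exI[of _ "\<lambda>i. w k / p k / 2 * p i"] exI[of _ p]) simp
next
  case False
  then have "w i * p j = 0 * 0 + 0 * 0" for i j by simp
  then show ?thesis by (intro exI[of _ "\<lambda>_. 0"]) simp
qed

text \<open>If \<open>p\<close> and \<open>q\<close> are independent, symmetry forces
  \<open>u\<close> and \<open>v\<close> into their span. The matrix is then given by a quadratic
  form in \<open>p\<close> and \<open>q\<close>, which splits into two linear factors; symmetrising
  their product costs a division by 2. If \<open>p\<close> and \<open>q\<close> are proportional,
  the matrix has rank at most one.\<close>

lemma symmetric_rank_2_form:
  fixes u v p q :: "'i \<Rightarrow> 'k::{alg_closed_field,field_char_0}"
  assumes sym: "\<And>i j. u i * p j + v i * q j = u j * p i + v j * q i"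
  shows "\<exists>x y. \<forall>i j. u i * p j + v i * q j = x i * y j + x j * y i"
proof (cases "\<exists>j k. p j * q k - p k * q j \<noteq> 0")
  case True
  then obtain j k where d: "p j * q k - p k * q j \<noteq> 0" by blast
  define \<Delta> where "\<Delta> = p j * q k - p k * q j"
  \<comment> \<open>Cramer's rule for the symmetry relation in the columns \<open>j\<close> and
    \<open>k\<close>, whose minor \<Delta> does not vanish.\<close>
  define a1 where "a1 = (u j * q k - u k * q j) / \<Delta>"
  define a2 where "a2 = (v j * q k - v k * q j) / \<Delta>"
  define b1 where "b1 = (u k * p j - u j * p k) / \<Delta>"
  define b2 where "b2 = (v k * p j - v j * p k) / \<Delta>"
  have D: "\<Delta> \<noteq> 0" using d by (simp add: \<Delta>_def)
  have u: "u i = a1 * p i + a2 * q i" for i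
  proof -
    have "\<Delta> * u i = (u j * p i + v j * q i) * q k - (u k * p i + v k * q i) * q j"
      unfolding \<Delta>_def sym[of j i] sym[of k i] by (simp add: algebra_simps)
    also have "\<dots> = (u j * q k - u k * q j) * p i + (v j * q k - v k * q j) * q i"
      by (simp add: algebra_simps)
    finally have "u i = ((u j * q k - u k * q j) * p i + (v j * q k - v k * q j) * q i) / \<Delta>"
      using D by (simp add: nonzero_eq_divide_eq mult.commute)
    then show ?thesis unfolding a1_def a2_def by (simp only: add_divide_distrib times_divide_eq_left)
  qed
  have v: "v i = b1 * p i + b2 * q i" for i
  proof -
    have "\<Delta> * v i = (u k * p i + v k * q i) * p j - (u j * p i + v j * q i) * p k"
      unfolding \<Delta>_def sym[of j i] sym[of k i] by (simp add: algebra_simps)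
    also have "\<dots> = (u k * p j - u j * p k) * p i + (v k * p j - v j * p k) * q i"
      by (simp add: algebra_simps)
    finally have "v i = ((u k * p j - u j * p k) * p i + (v k * p j - v j * p k) * q i) / \<Delta>"
      using D by (simp add: nonzero_eq_divide_eq mult.commute)
    then show ?thesis unfolding b1_def b2_def by (simp only: add_divide_distrib times_divide_eq_left)
  qed
  obtain a b c e where f: "a * c = a1" "a * e + b * c = a2 + b1" "b * e = b2"
    using binary_quadratic_factor[of a1 "a2 + b1" b2] by metis
  define x where "x i = (a * p i + b * q i) / 2" for i
  define y where "y i = c * p i + e * q i" for i
  have "u i * p j + v i * q j = x i * y j + x j * y i" for i j
  proof -
    have "2 * (u i * p j + v i * q j) = (u i * p j + v i * q j) + (u j * p i + v j * q i)"
      using sym[of i j] by simp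
    also have "\<dots> = 2 * a1 * p i * p j + (a2 + b1) * (p i * q j + p j * q i) + 2 * b2 * q i * q j"
      by (simp add: u v algebra_simps)
    also have "\<dots> = 2 * (x i * y j + x j * y i)"
      by (simp add: x_def y_def flip: f) (simp add: field_simps)
    finally show ?thesis by (subst (asm) mult_cancel_left) simp
  qed
  then show ?thesis by blast
next
  case False
  then have d: "p j * q k = p k * q j" for j k by simp
  show ?thesis
  proof (cases "\<exists>k. p k \<noteq> 0")
    case True
    then obtain k where k: "p k \<noteq> 0" by blast
    have q: "q j = q k / p k * p j" for j using d[of j k] k by (simp add: field_simps)
    define w where "w i = u i + v i * (q k / p k)" for i
    have w: "u i * p j + v i * q j = w i * p j" for i j
      by (subst q) (simp add: w_def algebra_simps)
    show ?thesis unfolding w using sym unfolding w by (rule symmetric_rank_1_form)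
  next
    case False
    then have w: "u i * p j + v i * q j = v i * q j" for i j by simp
    show ?thesis unfolding w using sym unfolding w by (rule symmetric_rank_1_form)
  qed
qed

lemma sym_rank_le_2_iff:
  fixes A :: "'k::{alg_closed_field,field_char_0}^'n^'n"
  shows "A \<in> sym_rank_le_2 \<longleftrightarrow> (\<exists>x y. \<forall>i j. A $ i $ j = x i * y j + x j * y i)"
proof
  assume "A \<in> sym_rank_le_2"
  then have t: "transpose A = A" and "rank A \<le> 2" by (auto simp: sym_rank_le_2_def)
  then obtain u p v q where A: "\<And>i j. A $ i $ j = u i * p j + v i * q j"
    by (auto simp: rank_le_2_iff)
  have "A $ i $ j = A $ j $ i" for i j
    using arg_cong[OF t, of "\<lambda>A. A $ j $ i"] by (simp add: transpose_def)
  then have "u i * p j + v i * q j = u j * p i + v j * q i" for i j by (simp add: A)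
  from symmetric_rank_2_form[OF this] show "\<exists>x y. \<forall>i j. A $ i $ j = x i * y j + x j * y i"
    by (simp add: A)
next
  assume "\<exists>x y. \<forall>i j. A $ i $ j = x i * y j + x j * y i"
  then obtain x y where A: "\<And>i j. A $ i $ j = x i * y j + x j * y i" by blast
  have "transpose A = A" by (simp add: transpose_def vec_eq_iff A)
  moreover have "rank A \<le> 2" unfolding rank_le_2_iff
    by (rule exI[of _ x], rule exI[of _ y], rule exI[of _ y], rule exI[of _ x])
       (simp add: A mult.commute)
  ultimately show "A \<in> sym_rank_le_2" by (simp add: sym_rank_le_2_def)
qed

section \<open>Evaluation of multivariate polynomials\<close>

definition monom_eval :: "('x \<Rightarrow> 'a::comm_ring_1) \<Rightarrow> ('x \<Rightarrow>\<^sub>0 nat) \<Rightarrow> 'a" where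
  "monom_eval x m = (\<Prod>v\<in>Poly_Mapping.keys m. x v ^ Poly_Mapping.lookup m v)"

text \<open>Evaluation in an extension ring, with \<phi> embedding the coefficients. For \<phi> =
  \<open>Poly_Mapping.single 0\<close> the values are again polynomials and evaluation is
  substitution.\<close>

definition eval_over :: "('k \<Rightarrow> 'a) \<Rightarrow> ('x \<Rightarrow> 'a) \<Rightarrow> (('x \<Rightarrow>\<^sub>0 nat) \<Rightarrow>\<^sub>0 'k::field) \<Rightarrow> 'a::comm_ring_1" where
  "eval_over \<phi> x p = (\<Sum>m\<in>Poly_Mapping.keys p. \<phi> (Poly_Mapping.lookup p m) * monom_eval x m)"

lemma mpoly_eval_eq: "mpoly_eval p x = eval_over (\<lambda>c. c) x p"
  by (simp add: mpoly_eval_def eval_over_def monom_eval_def)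

lemma monom_eval_superset:
  "finite A \<Longrightarrow> Poly_Mapping.keys m \<subseteq> A \<Longrightarrow> monom_eval x m = (\<Prod>v\<in>A. x v ^ Poly_Mapping.lookup m v)"
  unfolding monom_eval_def by (rule prod.mono_neutral_left) (auto simp: in_keys_iff)

lemma monom_eval_0 [simp]: "monom_eval x 0 = 1"
  by (simp add: monom_eval_def)

lemma monom_eval_single [simp]: "monom_eval x (Poly_Mapping.single v (Suc 0)) = x v"
  by (simp add: monom_eval_def)

lemma monom_eval_add: "monom_eval x (m + m') = monom_eval x m * monom_eval x m'"
proof -
  let ?A = "Poly_Mapping.keys m \<union> Poly_Mapping.keys m'"
  have "monom_eval x (m + m') = (\<Prod>v\<in>?A. x v ^ Poly_Mapping.lookup (m + m') v)"
    using keys_add[of m m'] by (intro monom_eval_superset) auto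
  also have "\<dots> = (\<Prod>v\<in>?A. x v ^ Poly_Mapping.lookup m v) * (\<Prod>v\<in>?A. x v ^ Poly_Mapping.lookup m' v)"
    by (simp add: lookup_add power_add prod.distrib)
  also have "\<dots> = monom_eval x m * monom_eval x m'"
    by (simp add: monom_eval_superset[of ?A])
  finally show ?thesis .
qed

lemma monom_eval_cong:
  "(\<And>v. v \<in> Poly_Mapping.keys m \<Longrightarrow> x v = y v) \<Longrightarrow> monom_eval x m = monom_eval y m"
  by (simp add: monom_eval_def)

lemma mpoly_eval_superset:
  "finite A \<Longrightarrow> Poly_Mapping.keys p \<subseteq> A \<Longrightarrow>
    mpoly_eval p x = (\<Sum>m\<in>A. Poly_Mapping.lookup p m * monom_eval x m)"
  unfolding mpoly_eval_eq eval_over_def by (rule sum.mono_neutral_left) (auto simp: in_keys_iff)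

lemma mpoly_eval_restrict:
  assumes "p \<in> mpolys_on S"
  shows "mpoly_eval p (restrict x S) = mpoly_eval p x"
  unfolding mpoly_eval_eq eval_over_def
proof (rule sum.cong)
  fix m assume "m \<in> Poly_Mapping.keys p"
  then have "Poly_Mapping.keys m \<subseteq> S" using assms by (auto simp: mpolys_on_def)
  then show "Poly_Mapping.lookup p m * monom_eval (restrict x S) m = Poly_Mapping.lookup p m * monom_eval x m"
    by (intro arg_cong2[of _ _ _ _ "(*)"] monom_eval_cong) auto
qed simp

lemma mpoly_eval_add: "mpoly_eval (p + q) x = mpoly_eval p x + mpoly_eval q x"
proof -
  let ?A = "Poly_Mapping.keys p \<union> Poly_Mapping.keys q"
  have "mpoly_eval (p + q) x = (\<Sum>m\<in>?A. Poly_Mapping.lookup (p + q) m * monom_eval x m)"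
    using keys_add[of p q] by (intro mpoly_eval_superset) auto
  also have "\<dots> = (\<Sum>m\<in>?A. Poly_Mapping.lookup p m * monom_eval x m) + (\<Sum>m\<in>?A. Poly_Mapping.lookup q m * monom_eval x m)"
    by (simp add: lookup_add distrib_right sum.distrib)
  finally show ?thesis by (simp add: mpoly_eval_superset[of ?A])
qed

lemma mpoly_eval_diff: "mpoly_eval (p - q) x = mpoly_eval p x - mpoly_eval q x"
  using mpoly_eval_add[of "p - q" q x] by simp

lemma mpoly_eval_0 [simp]: "mpoly_eval 0 x = 0"
  by (simp add: mpoly_eval_eq eval_over_def)

lemma mpoly_eval_single: "mpoly_eval (Poly_Mapping.single m c) x = c * monom_eval x m"
  by (cases "c = 0") (auto simp: mpoly_eval_eq eval_over_def)

lemma mpoly_eval_sum: "mpoly_eval (sum f A) x = (\<Sum>a\<in>A. mpoly_eval (f a) x)"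
  by (induction A rule: infinite_finite_induct) (auto simp: mpoly_eval_add)

lemma poly_mapping_sum_single:
  "p = (\<Sum>m\<in>Poly_Mapping.keys p. Poly_Mapping.single m (Poly_Mapping.lookup p m))"
proof (rule poly_mapping_eqI)
  fix k
  have "(\<Sum>m\<in>Poly_Mapping.keys p. Poly_Mapping.lookup (Poly_Mapping.single m (Poly_Mapping.lookup p m)) k)
      = (\<Sum>m\<in>Poly_Mapping.keys p. if m = k then Poly_Mapping.lookup p k else 0)"
    by (rule sum.cong) (auto simp: lookup_single)
  also have "\<dots> = Poly_Mapping.lookup p k" by (simp add: in_keys_iff)
  finally show "Poly_Mapping.lookup p k =
    Poly_Mapping.lookup (\<Sum>m\<in>Poly_Mapping.keys p. Poly_Mapping.single m (Poly_Mapping.lookup p m)) k"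
    by (simp add: lookup_sum)
qed

lemma mpoly_eval_mult: "mpoly_eval (p * q) x = mpoly_eval p x * mpoly_eval q x"
proof -
  let ?s = "\<lambda>p m. Poly_Mapping.single m (Poly_Mapping.lookup p m)"
  have "p * q = (\<Sum>m\<in>Poly_Mapping.keys p. ?s p m) * (\<Sum>m'\<in>Poly_Mapping.keys q. ?s q m')"
    by (simp flip: poly_mapping_sum_single)
  also have "\<dots> = (\<Sum>m\<in>Poly_Mapping.keys p. \<Sum>m'\<in>Poly_Mapping.keys q. ?s p m * ?s q m')"
    by (simp add: sum_product)
  finally have "mpoly_eval (p * q) x =
    (\<Sum>m\<in>Poly_Mapping.keys p. \<Sum>m'\<in>Poly_Mapping.keys q. mpoly_eval (?s p m) x * mpoly_eval (?s q m') x)"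
    by (simp add: mpoly_eval_sum mult_single mpoly_eval_single monom_eval_add mult_ac)
  also have "\<dots> = mpoly_eval p x * mpoly_eval q x"
    by (simp add: mpoly_eval_single) (simp add: mpoly_eval_eq eval_over_def sum_product)
  finally show ?thesis .
qed

lemma mpoly_eval_1 [simp]: "mpoly_eval 1 x = 1"
  using mpoly_eval_single[of 0 1 x] by simp

lemma mpoly_eval_power: "mpoly_eval (p ^ k) x = mpoly_eval p x ^ k"
  by (induction k) (auto simp: mpoly_eval_mult)

lemma mpoly_eval_prod: "mpoly_eval (prod f A) x = (\<Prod>a\<in>A. mpoly_eval (f a) x)"
  by (induction A rule: infinite_finite_induct) (auto simp: mpoly_eval_mult)

lemma mpoly_eval_eval_over:
  "mpoly_eval (eval_over (Poly_Mapping.single 0) g p) x = mpoly_eval p (\<lambda>v. mpoly_eval (g v) x)"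
  by (simp add: eval_over_def mpoly_eval_eq[of p] mpoly_eval_sum mpoly_eval_mult mpoly_eval_single
      monom_eval_def mpoly_eval_prod mpoly_eval_power)

text \<open>The vector of the powers \<open>M ^ idx j\<close> lies on the moment curve. A hyperplane
  meets this curve in the roots of a nonzero polynomial, so finitely many hyperplanes exclude only
  finitely many integers \<open>M\<close>.\<close>

lemma moment_curve_avoids:
  fixes \<Delta> :: "('j \<Rightarrow> real) set" and idx :: "'j \<Rightarrow> nat"
  assumes "finite \<Delta>" "finite J" "inj_on idx J" "\<And>\<delta>. \<delta> \<in> \<Delta> \<Longrightarrow> \<exists>j\<in>J. \<delta> j \<noteq> 0"
  shows "\<exists>M::nat. M \<ge> 1 \<and> (\<forall>\<delta>\<in>\<Delta>. (\<Sum>j\<in>J. \<delta> j * real (M ^ idx j)) \<noteq> 0)"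
proof -
  define P where "P \<delta> = (\<Sum>j\<in>J. Polynomial.monom (\<delta> j) (idx j))" for \<delta> :: "'j \<Rightarrow> real"
  have nz: "P \<delta> \<noteq> 0" if d: "\<delta> \<in> \<Delta>" for \<delta>
  proof -
    obtain j where j: "j \<in> J" "\<delta> j \<noteq> 0" using assms(4) d by blast
    have "poly.coeff (P \<delta>) (idx j) = (\<Sum>i\<in>J. if i = j then \<delta> i else 0)"
      unfolding P_def coeff_sum
      by (rule sum.cong) (use j assms(3) in \<open>auto simp: inj_on_def\<close>)
    then have "poly.coeff (P \<delta>) (idx j) \<noteq> 0" using j assms(2) by simp
    then show ?thesis by auto
  qed
  have "finite (\<Union>\<delta>\<in>\<Delta>. {t. poly (P \<delta>) t = 0})"
    using assms(1) nz by (auto intro: poly_roots_finite)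
  then have fin: "finite (real -` (\<Union>\<delta>\<in>\<Delta>. {t. poly (P \<delta>) t = 0}))"
    by (rule finite_vimageI) (simp add: inj_on_def)
  have "infinite {1::nat..}" by (simp add: infinite_Ici)
  then obtain M :: nat where "M \<in> {1..}" "M \<notin> real -` (\<Union>\<delta>\<in>\<Delta>. {t. poly (P \<delta>) t = 0})"
    using fin by (meson finite_subset subsetI)
  then show ?thesis by (intro exI[of _ M]) (auto simp: P_def poly_sum poly_monom)
qed

text \<open>Since the exponents \<open>\<Sum>s. w s * m s\<close> are pairwise distinct, the monomial of least weight survives.\<close>

lemma mpoly_eval_curve_nonzero:
  fixes p :: "('e \<Rightarrow>\<^sub>0 nat) \<Rightarrow>\<^sub>0 'k::field_char_0" and U :: "'e \<Rightarrow> 'k poly"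
  assumes "p \<noteq> 0" and p: "p \<in> mpolys_on S" and "finite S"
    and w: "inj_on (\<lambda>m. \<Sum>s\<in>S. w s * Poly_Mapping.lookup m s) (Poly_Mapping.keys p)"
    and U: "\<And>s. s \<in> S \<Longrightarrow> poly (U s) 0 \<noteq> 0"
  shows "\<exists>t. mpoly_eval p (\<lambda>s. t ^ w s * poly (U s) t) \<noteq> 0"
proof -
  define W where "W m = (\<Sum>s\<in>S. w s * Poly_Mapping.lookup m s)" for m :: "'e \<Rightarrow>\<^sub>0 nat"
  define G where "G m = Polynomial.smult (Poly_Mapping.lookup p m) (\<Prod>s\<in>S. U s ^ Poly_Mapping.lookup m s)" for m
  define Q where "Q = (\<Sum>m\<in>Poly_Mapping.keys p. Polynomial.monom 1 (W m) * G m)"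
  have Q: "poly Q t = mpoly_eval p (\<lambda>s. t ^ w s * poly (U s) t)" for t
    unfolding Q_def mpoly_eval_eq eval_over_def poly_sum
  proof (rule sum.cong)
    fix m assume "m \<in> Poly_Mapping.keys p"
    then have "Poly_Mapping.keys m \<subseteq> S" using p by (auto simp: mpolys_on_def)
    then show "poly (Polynomial.monom 1 (W m) * G m) t =
        Poly_Mapping.lookup p m * monom_eval (\<lambda>s. t ^ w s * poly (U s) t) m"
      by (simp add: monom_eval_superset[OF \<open>finite S\<close>] G_def W_def poly_monom poly_prod
          power_mult_distrib prod.distrib power_sum power_mult)
  qed simp
  let ?W = "W ` Poly_Mapping.keys p"
  have "?W \<noteq> {}" "finite ?W" using \<open>p \<noteq> 0\<close> by (auto simp: keys_eq_empty)
  then have "Min ?W \<in> ?W" by simp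
  then obtain m0 where m0: "m0 \<in> Poly_Mapping.keys p" "Min ?W = W m0" by blast
  have mn: "W m0 \<le> W m" if "m \<in> Poly_Mapping.keys p" for m
    using that by (simp flip: m0(2))
  have "poly.coeff Q (W m0) = (\<Sum>m\<in>Poly_Mapping.keys p. if m = m0 then poly.coeff (G m) 0 else 0)"
    unfolding Q_def coeff_sum
  proof (rule sum.cong)
    fix m assume m: "m \<in> Poly_Mapping.keys p"
    have "W m = W m0 \<longleftrightarrow> m = m0" using w m m0(1) unfolding W_def inj_on_def by blast
    then show "poly.coeff (Polynomial.monom 1 (W m) * G m) (W m0) = (if m = m0 then poly.coeff (G m) 0 else 0)"
      using mn[OF m] by (auto simp: coeff_monom_mult)
  qed simp
  also have "\<dots> = poly (G m0) 0" using m0(1) by (simp add: poly_0_coeff_0)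
  also have "\<dots> \<noteq> 0" using m0(1) U \<open>finite S\<close> by (simp add: G_def poly_prod in_keys_iff)
  finally have "Q \<noteq> 0" by auto
  then have "finite {t. poly Q t = 0}" by (rule poly_roots_finite)
  then have "{t. poly Q t = 0} \<noteq> UNIV" using infinite_UNIV_char_0 by metis
  then show ?thesis using Q by auto
qed

text \<open>Integer weights on the variables give distinct degrees to the monomials of
  \<open>p\<close> iff the linear form they define vanishes at none of these finitely many vectors.
  This is the input for \<open>moment_curve_avoids\<close>.\<close>

definition exponent_differences :: "(('e \<Rightarrow>\<^sub>0 nat) \<Rightarrow>\<^sub>0 'k::zero) \<Rightarrow> ('e \<Rightarrow> real) set" where
  "exponent_differences p = (\<lambda>(m, m') s. real (Poly_Mapping.lookup m s) - real (Poly_Mapping.lookup m' s)) `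
    {(m, m'). m \<in> Poly_Mapping.keys p \<and> m' \<in> Poly_Mapping.keys p \<and> m \<noteq> m'}"

lemma finite_exponent_differences: "finite (exponent_differences p)"
  unfolding exponent_differences_def
  by (rule finite_imageI, rule finite_subset[of _ "Poly_Mapping.keys p \<times> Poly_Mapping.keys p"]) auto

lemma exponent_differences_nonzero:
  assumes "p \<in> mpolys_on S" "\<delta> \<in> exponent_differences p"
  shows "\<exists>s\<in>S. \<delta> s \<noteq> 0"
proof -
  from assms(2) obtain m m' where m: "m \<in> Poly_Mapping.keys p" "m' \<in> Poly_Mapping.keys p" "m \<noteq> m'"
    and d: "\<delta> = (\<lambda>s. real (Poly_Mapping.lookup m s) - real (Poly_Mapping.lookup m' s))"
    unfolding exponent_differences_def by auto
  from m(3) obtain s where s: "Poly_Mapping.lookup m s \<noteq> Poly_Mapping.lookup m' s"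
    by (meson poly_mapping_eqI)
  then have "s \<in> Poly_Mapping.keys m \<or> s \<in> Poly_Mapping.keys m'" by (auto simp: in_keys_iff)
  with m assms(1) have "s \<in> S" by (auto simp: mpolys_on_def)
  with s d show ?thesis by auto
qed

lemma inj_on_weights:
  fixes w :: "'e \<Rightarrow> nat"
  assumes "\<forall>\<delta>\<in>exponent_differences p. (\<Sum>s\<in>S. \<delta> s * real (w s)) \<noteq> 0"
  shows "inj_on (\<lambda>m. \<Sum>s\<in>S. w s * Poly_Mapping.lookup m s) (Poly_Mapping.keys p)"
proof (rule inj_onI, rule ccontr)
  fix m m' assume m: "m \<in> Poly_Mapping.keys p" "m' \<in> Poly_Mapping.keys p" "m \<noteq> m'"
    and e: "(\<Sum>s\<in>S. w s * Poly_Mapping.lookup m s) = (\<Sum>s\<in>S. w s * Poly_Mapping.lookup m' s)"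
  have "(\<lambda>s. real (Poly_Mapping.lookup m s) - real (Poly_Mapping.lookup m' s)) \<in> exponent_differences p"
    unfolding exponent_differences_def using m by (auto intro!: image_eqI[of _ _ "(m, m')"])
  from bspec[OF assms this]
  have "(\<Sum>s\<in>S. (real (Poly_Mapping.lookup m s) - real (Poly_Mapping.lookup m' s)) * real (w s)) \<noteq> 0" .
  moreover have "(\<Sum>s\<in>S. (real (Poly_Mapping.lookup m s) - real (Poly_Mapping.lookup m' s)) * real (w s)) =
    real (\<Sum>s\<in>S. w s * Poly_Mapping.lookup m s) - real (\<Sum>s\<in>S. w s * Poly_Mapping.lookup m' s)"
    by (simp add: sum_subtractf algebra_simps)
  ultimately show False using e by simp
qed

lemma mpoly_nonvanishing:
  fixes p :: "('e \<Rightarrow>\<^sub>0 nat) \<Rightarrow>\<^sub>0 'k::field_char_0"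
  assumes "p \<noteq> 0" and p: "p \<in> mpolys_on S" and "finite S"
  shows "\<exists>x. mpoly_eval p x \<noteq> 0"
proof -
  obtain idx :: "'e \<Rightarrow> nat" where "inj_on idx S"
    using finite_imp_inj_to_nat_seg \<open>finite S\<close> by blast
  then obtain M :: nat where "\<forall>\<delta>\<in>exponent_differences p. (\<Sum>s\<in>S. \<delta> s * real (M ^ idx s)) \<noteq> 0"
    using moment_curve_avoids[OF finite_exponent_differences \<open>finite S\<close> _ exponent_differences_nonzero[OF p]]
    by blast
  then have "inj_on (\<lambda>m. \<Sum>s\<in>S. M ^ idx s * Poly_Mapping.lookup m s) (Poly_Mapping.keys p)"
    by (rule inj_on_weights)
  from mpoly_eval_curve_nonzero[OF assms this, of "\<lambda>_. 1"] show ?thesis by auto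
qed

text \<open>Density of the projection says that a polynomial vanishing on it vanishes on all of
  \<open>K^S\<close>; in characteristic 0 such a polynomial is zero by
  \<open>mpoly_nonvanishing\<close>.\<close>

lemma alg_indep_iff:
  fixes V :: "('k::field_char_0^'n::finite^'n) set"
  shows "alg_indep V S \<longleftrightarrow>
    (\<forall>p\<in>mpolys_on S. (\<forall>A\<in>V. mpoly_eval p (\<lambda>(i, j). A $ i $ j) = 0) \<longrightarrow> p = 0)"
    (is "_ \<longleftrightarrow> ?R")
proof -
  have fS: "finite S" by (rule finite)
  have van: "(\<forall>a\<in>entries_proj S ` V. mpoly_eval p a = 0) \<longleftrightarrow> (\<forall>A\<in>V. mpoly_eval p (\<lambda>(i, j). A $ i $ j) = 0)"
    if "p \<in> mpolys_on S" for p :: "('n \<times> 'n \<Rightarrow>\<^sub>0 nat) \<Rightarrow>\<^sub>0 'k"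
    by (simp add: entries_proj_def mpoly_eval_restrict[OF that])
  show ?thesis
  proof
    assume a: "alg_indep V S"
    show ?R
    proof (intro ballI impI, rule ccontr)
      fix p :: "('n \<times> 'n \<Rightarrow>\<^sub>0 nat) \<Rightarrow>\<^sub>0 'k"
      assume p: "p \<in> mpolys_on S" "p \<noteq> 0" and v: "\<forall>A\<in>V. mpoly_eval p (\<lambda>(i, j). A $ i $ j) = 0"
      obtain x where x: "mpoly_eval p x \<noteq> 0" using mpoly_nonvanishing[OF p(2,1) fS] by blast
      have "restrict x S \<in> zariski_closure S (entries_proj S ` V)"
        using a unfolding alg_indep_def by simp
      then have "mpoly_eval p (restrict x S) = 0"
        using p(1) v van[OF p(1)] by (auto simp: zariski_closure_def)
      with x p(1) show False by (simp add: mpoly_eval_restrict)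
    qed
  next
    assume ?R
    then show "alg_indep V S"
      unfolding alg_indep_def zariski_closure_def using van by auto
  qed
qed

section \<open>A generic point\<close>

type_synonym 'k rat_fun = "((nat \<Rightarrow>\<^sub>0 nat) \<Rightarrow>\<^sub>0 'k) fract"

lemma to_fract_prod: "to_fract (prod f A) = (\<Prod>a\<in>A. to_fract (f a))"
  by (induction A rule: infinite_finite_induct) auto

lemma to_fract_power: "to_fract (x ^ k) = to_fract x ^ k"
  by (induction k) auto

definition const_fun :: "'k::field \<Rightarrow> 'k rat_fun" where
  "const_fun c = to_fract (Poly_Mapping.single 0 c)"

lemma const_fun_hom [simp]:
  "const_fun 0 = 0" "const_fun 1 = 1" "const_fun (a + b) = const_fun a + const_fun b"
  "const_fun (a * b) = const_fun a * const_fun b" "const_fun (- a) = - const_fun a"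
  by (simp_all add: const_fun_def single_add single_uminus mult_single flip: to_fract_add to_fract_mult to_fract_uminus)

text \<open>The coordinates are distinct variables of a rational function field. A polynomial
  vanishing at the generic matrix vanishes at all its specialisations, hence on the whole variety by
  \<open>sym_rank_le_2_iff\<close>. The inequalities hold because each holds at some
  specialisation.\<close>

lemma generic_point:
  fixes S :: "('n::finite \<times> 'n) set"
  assumes "alg_indep (sym_rank_le_2 :: ('k::{alg_closed_field,field_char_0}^'n^'n) set) S"
  shows "\<exists>(x :: 'n \<Rightarrow> 'k rat_fun) y.
    (\<forall>p\<in>mpolys_on S. p \<noteq> 0 \<longrightarrow> eval_over const_fun (\<lambda>(i, j). x i * y j + x j * y i) p \<noteq> 0) \<and>
    (\<forall>i j. x i \<noteq> 0 \<and> y i \<noteq> 0 \<and> x i * y j + x j * y i \<noteq> 0 \<and> (i \<noteq> j \<longrightarrow> x i * y j - x j * y i \<noteq> 0))"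
proof -
  define var :: "nat \<Rightarrow> (nat \<Rightarrow>\<^sub>0 nat) \<Rightarrow>\<^sub>0 'k" where "var v = Poly_Mapping.single (Poly_Mapping.single v 1) 1" for v
  \<comment> \<open>Even variables serve as \<open>x\<close>, odd ones as \<open>y\<close>;
    \<open>pt\<close> assigns values accordingly.\<close>
  define X where "X i = var (2 * to_nat i)" for i :: 'n
  define Y where "Y i = var (2 * to_nat i + 1)" for i :: 'n
  define pt where "pt x y v = (if even v then x (from_nat (v div 2)) else y (from_nat (v div 2)))" for x y :: "'n \<Rightarrow> 'k" and v
  have evX [simp]: "mpoly_eval (X i) (pt x y) = x i" for i x y
    by (simp add: X_def var_def mpoly_eval_single pt_def)
  have evY [simp]: "mpoly_eval (Y i) (pt x y) = y i" for i x y
    by (simp add: Y_def var_def mpoly_eval_single pt_def)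
  define x y where "x i = to_fract (X i)" and "y i = to_fract (Y i)" for i
  have nz: "to_fract q \<noteq> 0" if "mpoly_eval q (pt a b) \<noteq> 0" for q a b
    using that by auto
  have "x i \<noteq> 0" "y i \<noteq> 0" for i
    unfolding x_def y_def using nz[of "X i" "\<lambda>_. 1" "\<lambda>_. 1"] nz[of "Y i" "\<lambda>_. 1" "\<lambda>_. 1"] by simp_all
  moreover have "x i * y j + x j * y i \<noteq> 0" for i j
    using nz[of "X i * Y j + X j * Y i" "\<lambda>_. 1" "\<lambda>_. 1"]
    by (simp add: mpoly_eval_add mpoly_eval_mult x_def y_def)
  moreover have "x i * y j - x j * y i \<noteq> 0" if "i \<noteq> j" for i j
  proof -
    \<comment> \<open>At this specialisation the minor has the value 1.\<close>
    have "mpoly_eval (X i * Y j - X j * Y i) (pt (\<lambda>k. if k = i then 1 else 0) (\<lambda>k. if k = j then 1 else 0)) \<noteq> 0"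
      using that by (simp add: mpoly_eval_diff mpoly_eval_mult)
    from nz[OF this] show ?thesis by (simp add: x_def y_def)
  qed
  moreover have "eval_over const_fun (\<lambda>(i, j). x i * y j + x j * y i) p \<noteq> 0" if p: "p \<in> mpolys_on S" "p \<noteq> 0" for p
  proof
    assume z: "eval_over const_fun (\<lambda>(i, j). x i * y j + x j * y i) p = 0"
    define g where "g = (\<lambda>(i, j). X i * Y j + X j * Y i)"
    have "(\<lambda>(i, j). x i * y j + x j * y i) = (\<lambda>s. to_fract (g s))"
      by (auto simp: g_def x_def y_def)
    with z have "to_fract (eval_over (Poly_Mapping.single 0) g p) = 0"
      by (simp add: eval_over_def monom_eval_def const_fun_def to_fract_sum to_fract_prod to_fract_power)
    then have 0: "eval_over (Poly_Mapping.single 0) g p = 0" by simp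
    have "mpoly_eval p (\<lambda>(i, j). A $ i $ j) = 0" if "A \<in> sym_rank_le_2" for A :: "'k^'n^'n"
    proof -
      from that obtain a b where A: "\<And>i j. A $ i $ j = a i * b j + a j * b i"
        unfolding sym_rank_le_2_iff by blast
      have "(\<lambda>v. mpoly_eval (g v) (pt a b)) = (\<lambda>(i, j). A $ i $ j)"
        by (auto simp: g_def A mpoly_eval_add mpoly_eval_mult)
      with mpoly_eval_eval_over[of g p "pt a b"] 0 show ?thesis by simp
    qed
    with assms p show False unfolding alg_indep_iff by blast
  qed
  ultimately show ?thesis by blast
qed

section \<open>Extension of valuations\<close>

definition is_subring :: "'f::field set \<Rightarrow> bool" where
  "is_subring A \<longleftrightarrow> 1 \<in> A \<and> (\<forall>a\<in>A. \<forall>b\<in>A. a + b \<in> A \<and> a * b \<in> A \<and> a - b \<in> A)"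

lemma is_subringD:
  assumes "is_subring A"
  shows "1 \<in> A" "0 \<in> A" "a \<in> A \<Longrightarrow> b \<in> A \<Longrightarrow> a + b \<in> A" "a \<in> A \<Longrightarrow> b \<in> A \<Longrightarrow> a * b \<in> A"
    "a \<in> A \<Longrightarrow> b \<in> A \<Longrightarrow> a - b \<in> A" "a \<in> A \<Longrightarrow> - a \<in> A"
proof -
  show 1: "1 \<in> A" and d: "\<And>a b. a \<in> A \<Longrightarrow> b \<in> A \<Longrightarrow> a - b \<in> A"
    and "a \<in> A \<Longrightarrow> b \<in> A \<Longrightarrow> a + b \<in> A" "a \<in> A \<Longrightarrow> b \<in> A \<Longrightarrow> a * b \<in> A"
    using assms by (auto simp: is_subring_def)
  show 0: "0 \<in> A" using d[OF 1 1] by simp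
  show "a \<in> A \<Longrightarrow> - a \<in> A" using d[OF 0, of a] by simp
qed

lemma is_subring_power: "is_subring A \<Longrightarrow> a \<in> A \<Longrightarrow> a ^ k \<in> A"
  by (induction k) (auto intro: is_subringD)

lemma is_subring_sum: "is_subring A \<Longrightarrow> (\<And>i. i \<in> K \<Longrightarrow> f i \<in> A) \<Longrightarrow> sum f K \<in> A"
  by (induction K rule: infinite_finite_induct) (auto intro: is_subringD)

text \<open>The ideal generated by \<open>I\<close> in the subring \<open>A\<close>. The inductive
  form shows that one element involves only finitely many coefficients from \<open>A\<close>, which
  is what unions of chains require.\<close>

inductive_set igen :: "'f::field set \<Rightarrow> 'f set \<Rightarrow> 'f set" for I A where
  zero: "0 \<in> igen I A"
| add: "g \<in> I \<Longrightarrow> a \<in> A \<Longrightarrow> x \<in> igen I A \<Longrightarrow> g * a + x \<in> igen I A"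

lemma igen_mono: "x \<in> igen I A \<Longrightarrow> A \<subseteq> B \<Longrightarrow> x \<in> igen I B"
  by (induction rule: igen.induct) (auto intro: igen.intros)

lemma igen_add: "x \<in> igen I A \<Longrightarrow> y \<in> igen I A \<Longrightarrow> x + y \<in> igen I A"
  by (induction rule: igen.induct) (auto intro: igen.intros simp: add.assoc)

lemma igen_mult: "x \<in> igen I A \<Longrightarrow> is_subring A \<Longrightarrow> b \<in> A \<Longrightarrow> x * b \<in> igen I A"
  by (induction rule: igen.induct)
     (auto intro!: igen.intros intro: is_subringD simp: distrib_right mult.assoc)

lemma igen_mult': "x \<in> igen I A \<Longrightarrow> is_subring A \<Longrightarrow> b \<in> A \<Longrightarrow> b * x \<in> igen I A"
  by (metis igen_mult mult.commute)

lemma igen_sum: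
  "(\<And>i. i \<in> K \<Longrightarrow> f i \<in> igen I A) \<Longrightarrow> sum f K \<in> igen I A"
  by (induction K rule: infinite_finite_induct) (auto intro: igen_add igen.zero)

lemma igen_base: "is_subring A \<Longrightarrow> g \<in> I \<Longrightarrow> g \<in> igen I A"
  using igen.add[OF _ is_subringD(1) igen.zero, of g I A] by simp

lemma igen_subset: "x \<in> igen I A \<Longrightarrow> is_subring A \<Longrightarrow> I \<subseteq> A \<Longrightarrow> x \<in> A"
  by (induction rule: igen.induct) (auto intro: is_subringD)

lemma igen_chain:
  assumes "C \<noteq> {}" "\<And>A B. A \<in> C \<Longrightarrow> B \<in> C \<Longrightarrow> A \<subseteq> B \<or> B \<subseteq> A" "x \<in> igen I (\<Union>C)"
  shows "\<exists>A\<in>C. x \<in> igen I A"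
  using assms(3)
proof (induction rule: igen.induct)
  case zero
  then show ?case using assms(1) igen.zero by blast
next
  case (add g a x)
  then obtain A B where AB: "A \<in> C" "x \<in> igen I A" "B \<in> C" "a \<in> B" by auto
  show ?case
  proof (cases "A \<subseteq> B")
    case True
    with AB have "g * a + x \<in> igen I B" by (intro igen.add add.hyps(1)) (auto intro: igen_mono)
    with AB show ?thesis by auto
  next
    case False
    with AB assms(2) have "a \<in> A" by auto
    with AB have "g * a + x \<in> igen I A" by (intro igen.add add.hyps(1))
    with AB show ?thesis by auto
  qed
qed

definition adjoin :: "'f::field set \<Rightarrow> 'f \<Rightarrow> 'f set" where
  "adjoin A x = {poly p x | p. \<forall>i. poly.coeff p i \<in> A}"

lemma adjoin_subring:
  assumes "is_subring A"
  shows "is_subring (adjoin A x)"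
  unfolding is_subring_def
proof (intro conjI ballI)
  show "1 \<in> adjoin A x" unfolding adjoin_def
    by (rule CollectI, rule exI[of _ 1]) (auto simp: is_subringD[OF assms])
  fix a b assume "a \<in> adjoin A x" "b \<in> adjoin A x"
  then obtain p q where pq: "a = poly p x" "b = poly q x" "\<forall>i. poly.coeff p i \<in> A" "\<forall>i. poly.coeff q i \<in> A"
    unfolding adjoin_def by blast
  show "a + b \<in> adjoin A x" unfolding adjoin_def
    by (rule CollectI, rule exI[of _ "p + q"]) (auto simp: pq is_subringD[OF assms])
  show "a * b \<in> adjoin A x" unfolding adjoin_def
    by (rule CollectI, rule exI[of _ "p * q"])
       (auto simp: pq is_subringD[OF assms] coeff_mult intro!: is_subring_sum[OF assms])
  show "a - b \<in> adjoin A x" unfolding adjoin_def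
    by (rule CollectI, rule exI[of _ "p - q"]) (auto simp: pq is_subringD[OF assms])
qed

lemma adjoin_superset: "is_subring A \<Longrightarrow> A \<subseteq> adjoin A x"
proof
  fix a assume A: "is_subring A" and "a \<in> A"
  then show "a \<in> adjoin A x" unfolding adjoin_def
    by (intro CollectI exI[of _ "[:a:]"]) (auto simp: coeff_pCons is_subringD[OF A] split: nat.split)
qed

lemma adjoin_self: "is_subring A \<Longrightarrow> x \<in> adjoin A x"
proof -
  assume A: "is_subring A"
  then show "x \<in> adjoin A x" unfolding adjoin_def
    by (intro CollectI exI[of _ "[:0, 1:]"]) (auto simp: coeff_pCons is_subringD[OF A] split: nat.split)
qed

lemma igen_adjoin:
  "y \<in> igen I (adjoin A x) \<Longrightarrow> \<exists>p. y = poly p x \<and> (\<forall>i. poly.coeff p i \<in> igen I A)"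
proof (induction rule: igen.induct)
  case zero
  show ?case by (rule exI[of _ 0]) (auto intro: igen.zero)
next
  case (add g a y)
  then obtain p q where "y = poly p x" "\<forall>i. poly.coeff p i \<in> igen I A"
    "a = poly q x" "\<forall>i. poly.coeff q i \<in> A" unfolding adjoin_def by blast
  with add show ?case
    by (intro exI[of _ "Polynomial.smult g q + p"]) (auto intro: igen.add)
qed

text \<open>Chevalley's extension theorem: a subring that is maximal among those in which \<open>I\<close> does not
  generate the unit ideal is a valuation ring.\<close>

lemma maximal_is_valuation_ring:
  assumes A: "is_subring A" and I: "I \<subseteq> A" and proper: "1 \<notin> igen I A"
    and maxi: "\<And>B. is_subring B \<Longrightarrow> A \<subseteq> B \<Longrightarrow> 1 \<notin> igen I B \<Longrightarrow> B = A"
    and x: "x \<noteq> 0"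
  shows "x \<in> A \<or> inverse x \<in> A"
proof (rule ccontr)
  assume "\<not> ?thesis"
  then have notin: "x \<notin> A" "inverse x \<notin> A" by auto
  let ?J = "igen I A"
  \<comment> \<open>By maximality the ring obtained by adjoining \<open>y\<close> is too large:
    \<open>I\<close> generates the unit ideal in it, and this is a polynomial relation for
    \<open>y\<close> with coefficients in \<open>?J\<close>.\<close>
  have rel: "\<exists>p. poly p y = 1 \<and> (\<forall>i. poly.coeff p i \<in> ?J)" if "y \<notin> A" for y
  proof -
    have "adjoin A y \<noteq> A" using adjoin_self[OF A, of y] that by auto
    with maxi[OF adjoin_subring[OF A] adjoin_superset[OF A]] have "1 \<in> igen I (adjoin A y)" by blast
    from igen_adjoin[OF this] show ?thesis by metis
  qed
  note JA = igen_subset[OF _ A I]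
  \<comment> \<open>Elements congruent to 1 modulo \<open>?J\<close> are units of \<open>A\<close>.
    Otherwise \<open>rel\<close> for the inverse of \<open>u = 1 - c\<close>, multiplied by a power
    of \<open>u\<close>, puts that power into \<open>?J\<close>, although it is congruent to
    1.\<close>
  have inv_unit: "inverse (1 - c) \<in> A" if c: "c \<in> ?J" for c
  proof (rule ccontr)
    assume n: "inverse (1 - c) \<notin> A"
    define u where "u = 1 - c"
    have u0: "u \<noteq> 0" using c proper by (auto simp: u_def)
    have uA: "u \<in> A" using JA[OF c] is_subringD[OF A] by (auto simp: u_def)
    obtain p where p: "poly p (inverse u) = 1" "\<forall>i. poly.coeff p i \<in> ?J"
      using rel n unfolding u_def by blast
    let ?n = "degree p"
    have "u ^ ?n = u ^ ?n * poly p (inverse u)" using p by simp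
    also have "\<dots> = (\<Sum>i\<le>?n. poly.coeff p i * u ^ (?n - i))"
      unfolding poly_altdef sum_distrib_left
      by (rule sum.cong) (use u0 in \<open>auto simp: field_simps power_diff\<close>)
    also have "\<dots> \<in> ?J"
      using p(2) by (intro igen_sum igen_mult[OF _ A] is_subring_power[OF A] uA) auto
    finally have un: "u ^ ?n \<in> ?J" .
    have "1 - u ^ k \<in> ?J" for k
    proof (induction k)
      case (Suc k)
      have "1 - u ^ Suc k = (1 - u ^ k) + u ^ k * c" by (simp add: u_def algebra_simps)
      then show ?case by (simp only:) (intro igen_add Suc igen_mult'[OF c A] is_subring_power[OF A uA])
    qed (auto intro: igen.zero)
    from igen_add[OF this[of "degree p"] un] proper show False by simp
  qed
  \<comment> \<open>Given a relation \<open>p\<close> of least degree for \<open>y\<close> and a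
    relation \<open>q\<close> of no larger degree for its inverse, \<open>q\<close> expresses
    \<open>y ^ degree p\<close> by lower powers. Substituting this into \<open>p\<close> gives a
    relation of smaller degree.\<close>
  have key: "False" if y: "y \<noteq> 0" and p: "poly p y = 1" "\<forall>i. poly.coeff p i \<in> ?J"
    and mn: "\<And>p'. poly p' y = 1 \<Longrightarrow> \<forall>i. poly.coeff p' i \<in> ?J \<Longrightarrow> degree p \<le> degree p'"
    and q: "poly q (inverse y) = 1" "\<forall>i. poly.coeff q i \<in> ?J" and le: "degree q \<le> degree p" for y p q
  proof -
    let ?n = "degree p" and ?m = "degree q"
    \<comment> \<open>Dividing by the unit \<open>1 - poly.coeff q 0\<close> removes the constant
      term of \<open>q\<close> and keeps the other coefficients in \<open>?J\<close>.\<close>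
    define v where "v = inverse (1 - poly.coeff q 0)"
    have vA: "v \<in> A" unfolding v_def by (rule inv_unit) (use q in simp)
    have q0: "1 - poly.coeff q 0 \<noteq> 0" using q(2) proper by (metis eq_iff_diff_eq_0)
    have n0: "?n > 0"
    proof (rule ccontr)
      assume "\<not> ?n > 0"
      then obtain c where "p = [:c:]" by (auto elim: degree_eq_zeroE)
      then have "poly.coeff p 0 = 1" using p(1) by simp
      with p(2) proper show False by metis
    qed
    have "1 = (\<Sum>i\<le>?m. poly.coeff q i * inverse y ^ i)" using q(1) by (simp add: poly_altdef)
    also have "{..?m} = insert 0 {1..?m}" by auto
    finally have "1 - poly.coeff q 0 = (\<Sum>i\<in>{1..?m}. poly.coeff q i * inverse y ^ i)"
      by (simp add: algebra_simps)
    then have "v * (1 - poly.coeff q 0) * y ^ ?n = v * (\<Sum>i\<in>{1..?m}. poly.coeff q i * inverse y ^ i) * y ^ ?n"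
      by simp
    also have "\<dots> = (\<Sum>i\<in>{1..?m}. v * poly.coeff q i * y ^ (?n - i))"
      unfolding sum_distrib_left sum_distrib_right
      by (rule sum.cong) (use y le in \<open>auto simp: field_simps power_diff\<close>)
    finally have yn: "y ^ ?n = (\<Sum>i\<in>{1..?m}. v * poly.coeff q i * y ^ (?n - i))"
      using q0 by (simp add: v_def)
    define p' where "p' = (\<Sum>k<?n. Polynomial.monom (poly.coeff p k) k) +
      (\<Sum>i\<in>{1..?m}. Polynomial.monom (poly.coeff p ?n * (v * poly.coeff q i)) (?n - i))"
    have "1 = (\<Sum>i\<le>?n. poly.coeff p i * y ^ i)" using p(1) by (simp add: poly_altdef)
    also have "\<dots> = (\<Sum>k<?n. poly.coeff p k * y ^ k) + poly.coeff p ?n * y ^ ?n"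
      by (simp add: lessThan_Suc_atMost[symmetric])
    also have "\<dots> = poly p' y"
      unfolding p'_def yn by (simp add: poly_sum poly_monom sum_distrib_left mult_ac)
    finally have "poly p' y = 1" by simp
    moreover have "\<forall>i. poly.coeff p' i \<in> ?J"
    proof
      fix i
      have "poly.coeff (Polynomial.monom c k) i \<in> ?J" if "c \<in> ?J" for c k
        using that by (auto intro: igen.zero)
      then show "poly.coeff p' i \<in> ?J"
        unfolding p'_def coeff_add coeff_sum using p(2) q(2) vA
        by (intro igen_add igen_sum) (auto intro!: igen_mult'[OF _ A] intro: JA igen.zero)
    qed
    ultimately have "?n \<le> degree p'" by (rule mn)
    moreover have "degree p' \<le> ?n - 1"
      unfolding p'_def
      by (intro degree_add_le degree_sum_le) (auto intro: order_trans[OF degree_monom_le])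
    ultimately show False using n0 by simp
  qed
  have least: "\<exists>p. (poly p y = 1 \<and> (\<forall>i. poly.coeff p i \<in> ?J)) \<and>
      (\<forall>p'. poly p' y = 1 \<and> (\<forall>i. poly.coeff p' i \<in> ?J) \<longrightarrow> degree p \<le> degree p')" if "y \<notin> A" for y
    using rel[OF that] ex_has_least_nat[of "\<lambda>p. poly p y = 1 \<and> (\<forall>i. poly.coeff p i \<in> ?J)" _ degree] by blast
  obtain p where p: "poly p x = 1" "\<forall>i. poly.coeff p i \<in> ?J"
    "\<And>p'. poly p' x = 1 \<Longrightarrow> \<forall>i. poly.coeff p' i \<in> ?J \<Longrightarrow> degree p \<le> degree p'"
    using least[OF notin(1)] by blast
  obtain q where q: "poly q (inverse x) = 1" "\<forall>i. poly.coeff q i \<in> ?J"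
    "\<And>p'. poly p' (inverse x) = 1 \<Longrightarrow> \<forall>i. poly.coeff p' i \<in> ?J \<Longrightarrow> degree q \<le> degree p'"
    using least[OF notin(2)] by blast
  \<comment> \<open>Of the two least relations the one of larger degree is the one to be shortened;
    \<open>x\<close> and its inverse play symmetric roles.\<close>
  show False
  proof (cases "degree q \<le> degree p")
    case True
    from key[OF x p(1,2) p(3) q(1,2) True] show False .
  next
    case False
    have ix: "inverse x \<noteq> 0" using x by simp
    have le: "degree p \<le> degree q" using False by simp
    have "poly p (inverse (inverse x)) = 1" using p(1) by simp
    from key[OF ix q(1,2) q(3) this p(2) le] show False .
  qed
qed

text \<open>Zorn's lemma applies because 1 lies in the ideal over the union of a chain only if it
  does so over one member (\<open>igen_chain\<close>).\<close>

lemma valuation_ring_exists: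
  assumes A0: "is_subring A0" and I: "I \<subseteq> A0" and proper: "1 \<notin> igen I A0"
  shows "\<exists>A. is_subring A \<and> A0 \<subseteq> A \<and> 1 \<notin> igen I A \<and> (\<forall>x. x \<noteq> 0 \<longrightarrow> x \<in> A \<or> inverse x \<in> A)"
proof -
  let ?\<A> = "{A. is_subring A \<and> A0 \<subseteq> A \<and> 1 \<notin> igen I A}"
  have "\<exists>M\<in>?\<A>. \<forall>X\<in>?\<A>. M \<subseteq> X \<longrightarrow> X = M"
  proof (rule subset_Zorn_nonempty)
    show "?\<A> \<noteq> {}" using assms by blast
    fix C assume C: "C \<noteq> {}" "subset.chain ?\<A> C"
    have lin: "A \<subseteq> B \<or> B \<subseteq> A" if "A \<in> C" "B \<in> C" for A B
    proof -
      have "\<forall>A\<in>C. \<forall>B\<in>C. A \<subset> B \<or> A = B \<or> B \<subset> A \<or> B = A" using C(2) by (simp add: subset.chain_def)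
      with that show ?thesis by blast
    qed
    have CA: "A \<in> ?\<A>" if "A \<in> C" for A using C(2) that by (auto simp: subset.chain_def)
    have "is_subring (\<Union>C)" unfolding is_subring_def
    proof (intro conjI ballI)
      show "1 \<in> \<Union>C" using C(1) CA by (auto intro: is_subringD)
      fix a b assume "a \<in> \<Union>C" "b \<in> \<Union>C"
      then obtain A where A: "A \<in> C" "a \<in> A" "b \<in> A" using lin by blast
      with CA[OF A(1)] show "a + b \<in> \<Union>C" "a * b \<in> \<Union>C" "a - b \<in> \<Union>C"
        by (auto intro: is_subringD)
    qed
    moreover have "A0 \<subseteq> \<Union>C" using C(1) CA by blast
    moreover have "1 \<notin> igen I (\<Union>C)" using igen_chain[OF C(1) lin] CA by blast
    ultimately show "\<Union>C \<in> ?\<A>" by blast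
  qed
  then obtain A where A: "is_subring A" "A0 \<subseteq> A" "1 \<notin> igen I A"
    and mx: "\<And>B. is_subring B \<Longrightarrow> A \<subseteq> B \<Longrightarrow> 1 \<notin> igen I B \<Longrightarrow> B = A"
    by (smt (verit) mem_Collect_eq subset_trans)
  have "I \<subseteq> A" using I A(2) by blast
  from maximal_is_valuation_ring[OF A(1) this A(3) mx]
  have "\<forall>x. x \<noteq> 0 \<longrightarrow> x \<in> A \<or> inverse x \<in> A" by simp
  with A show ?thesis by (intro exI[of _ A] conjI)
qed

definition laurent :: "'e set \<Rightarrow> ('e \<Rightarrow> 'f::field) \<Rightarrow> ('e \<Rightarrow> int) \<Rightarrow> 'f" where
  "laurent S a c = (\<Prod>s\<in>S. a s powi c s)"

text \<open>For \<open>Q\<close> closed under addition this is a semigroup ring. The predicate is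
  left arbitrary so that the same construction yields both the ring of nonnegative exponents and its
  ideal of positive ones.\<close>

inductive_set laurent_span :: "('k \<Rightarrow> 'f::field) \<Rightarrow> 'e set \<Rightarrow> ('e \<Rightarrow> 'f) \<Rightarrow> (('e \<Rightarrow> int) \<Rightarrow> bool) \<Rightarrow> 'f set"
  for \<phi> S a Q where
  zero: "0 \<in> laurent_span \<phi> S a Q"
| add: "Q c \<Longrightarrow> x \<in> laurent_span \<phi> S a Q \<Longrightarrow> \<phi> k * laurent S a c + x \<in> laurent_span \<phi> S a Q"

locale independent_family =
  fixes \<phi> :: "'k::field \<Rightarrow> 'f::field" and S :: "'e set" and a :: "'e \<Rightarrow> 'f"
  assumes hom: "\<phi> 0 = 0" "\<phi> 1 = 1" "\<phi> (k + l) = \<phi> k + \<phi> l" "\<phi> (k * l) = \<phi> k * \<phi> l" "\<phi> (- k) = - \<phi> k"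
    and finS: "finite S" and nz: "s \<in> S \<Longrightarrow> a s \<noteq> 0"
    and indep: "p \<in> mpolys_on S \<Longrightarrow> p \<noteq> 0 \<Longrightarrow> eval_over \<phi> a p \<noteq> 0"
begin

lemma eval_over_add: "eval_over \<phi> a (p + q) = eval_over \<phi> a p + eval_over \<phi> a q"
proof -
  have sup: "eval_over \<phi> a p = (\<Sum>m\<in>A. \<phi> (Poly_Mapping.lookup p m) * monom_eval a m)"
    if "finite A" "Poly_Mapping.keys p \<subseteq> A" for A p
    unfolding eval_over_def using that
    by (intro sum.mono_neutral_left) (auto simp: in_keys_iff hom)
  let ?A = "Poly_Mapping.keys p \<union> Poly_Mapping.keys q"
  have "eval_over \<phi> a (p + q) = (\<Sum>m\<in>?A. \<phi> (Poly_Mapping.lookup (p + q) m) * monom_eval a m)"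
    using keys_add[of p q] by (intro sup) auto
  also have "\<dots> = (\<Sum>m\<in>?A. \<phi> (Poly_Mapping.lookup p m) * monom_eval a m) + (\<Sum>m\<in>?A. \<phi> (Poly_Mapping.lookup q m) * monom_eval a m)"
    by (simp add: lookup_add hom distrib_right sum.distrib)
  finally show ?thesis by (simp add: sup[of ?A])
qed

lemma eval_over_single: "eval_over \<phi> a (Poly_Mapping.single m c) = \<phi> c * monom_eval a m"
  by (cases "c = 0") (auto simp: eval_over_def hom)

lemma laurent_add: "laurent S a (\<lambda>s. c s + d s) = laurent S a c * laurent S a d"
  by (simp add: laurent_def power_int_add nz flip: prod.distrib)

lemma laurent_uminus: "laurent S a (\<lambda>s. - c s) = inverse (laurent S a c)"
  by (simp add: laurent_def power_int_minus prod_inversef[symmetric] o_def)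

lemma laurent_nz: "laurent S a c \<noteq> 0"
  using finS by (simp add: laurent_def nz)

definition expo :: "('e \<Rightarrow> nat) \<Rightarrow> 'e \<Rightarrow>\<^sub>0 nat" where
  "expo N = (\<Sum>s\<in>S. Poly_Mapping.single s (N s))"

lemma lookup_expo: "Poly_Mapping.lookup (expo N) s = (if s \<in> S then N s else 0)"
  using finS by (simp add: expo_def lookup_sum lookup_single when_def)

lemma keys_expo: "Poly_Mapping.keys (expo N) \<subseteq> S"
  by (auto simp: in_keys_iff lookup_expo split: if_splits)

lemma monom_eval_expo: "monom_eval a (expo N) = laurent S a (\<lambda>s. int (N s))"
  by (simp add: monom_eval_superset[OF finS keys_expo] laurent_def lookup_expo)

text \<open>Multiplying by a large monomial \<open>expo N\<close> makes all exponents nonnegative. A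
  term of exponent \<open>c\<close> lands on a monomial other than \<open>expo N\<close>, since
  \<open>c\<close> does not vanish on \<open>S\<close>. The claim is for all \<open>N\<close> above
  a bound, so that the bound can be raised for each further term.\<close>

lemma laurent_span_clear_denominators:
  assumes "x \<in> laurent_span \<phi> S a Q" and Q: "\<And>c. Q c \<Longrightarrow> \<exists>s\<in>S. c s \<noteq> 0"
  shows "\<exists>N0. \<forall>N. (\<forall>s\<in>S. N0 s \<le> N s) \<longrightarrow>
    (\<exists>p\<in>mpolys_on S. Poly_Mapping.lookup p (expo N) = 0 \<and> x * laurent S a (\<lambda>s. int (N s)) = eval_over \<phi> a p)"
  using assms(1)
proof (induction rule: laurent_span.induct)
  case zero
  have "0 \<in> mpolys_on S" "eval_over \<phi> a 0 = 0" by (auto simp: mpolys_on_def eval_over_def)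
  then show ?case by (metis lookup_zero mult_zero_left)
next
  case (add c x k)
  then obtain N0 where N0: "\<And>N. \<forall>s\<in>S. N0 s \<le> N s \<Longrightarrow>
    \<exists>p\<in>mpolys_on S. Poly_Mapping.lookup p (expo N) = 0 \<and> x * laurent S a (\<lambda>s. int (N s)) = eval_over \<phi> a p" by blast
  show ?case
  proof (rule exI[of _ "\<lambda>s. N0 s + nat \<bar>c s\<bar>"], intro allI impI)
    fix N assume N: "\<forall>s\<in>S. N0 s + nat \<bar>c s\<bar> \<le> N s"
    then obtain p where p: "p \<in> mpolys_on S" "Poly_Mapping.lookup p (expo N) = 0"
      "x * laurent S a (\<lambda>s. int (N s)) = eval_over \<phi> a p" using N0[of N] by (meson add_leD1)
    define M where "M s = nat (c s + int (N s))" for s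
    have M: "int (M s) = c s + int (N s)" if "s \<in> S" for s
      using bspec[OF N that] by (simp add: M_def)
    obtain s where s: "s \<in> S" "c s \<noteq> 0" using Q[OF add.hyps(1)] by blast
    have ne: "expo M \<noteq> expo N"
    proof
      assume "expo M = expo N"
      then have "M s = N s" using s(1) lookup_expo[of M s] lookup_expo[of N s] by simp
      with M[OF s(1)] s(2) show False by simp
    qed
    let ?q = "Poly_Mapping.single (expo M) k + p"
    have "?q \<in> mpolys_on S"
      unfolding mpolys_on_def
    proof (rule CollectI, rule ballI)
      fix m assume "m \<in> Poly_Mapping.keys ?q"
      then have "m \<in> Poly_Mapping.keys (Poly_Mapping.single (expo M) k) \<or> m \<in> Poly_Mapping.keys p"
        using keys_add[of "Poly_Mapping.single (expo M) k" p] by blast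
      then show "Poly_Mapping.keys m \<subseteq> S"
        using p(1) keys_expo[of M] by (auto simp: mpolys_on_def split: if_splits)
    qed
    moreover have "Poly_Mapping.lookup ?q (expo N) = 0"
      using ne p(2) by (simp add: lookup_add lookup_single)
    moreover have "laurent S a (\<lambda>s. int (M s)) = laurent S a (\<lambda>s. c s + int (N s))"
      unfolding laurent_def by (rule prod.cong) (auto simp: M)
    then have "(\<phi> k * laurent S a c + x) * laurent S a (\<lambda>s. int (N s)) = eval_over \<phi> a ?q"
      by (simp add: eval_over_add eval_over_single monom_eval_expo laurent_add p(3) distrib_right)
    ultimately show "\<exists>p\<in>mpolys_on S. Poly_Mapping.lookup p (expo N) = 0 \<and>
      (\<phi> k * laurent S a c + x) * laurent S a (\<lambda>s. int (N s)) = eval_over \<phi> a p" by blast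
  qed
qed

text \<open>Otherwise clearing denominators would equate the monomial \<open>expo N\<close> with a
  polynomial in which it does not occur, against independence.\<close>

lemma one_notin_laurent_span:
  assumes Q: "\<And>c. Q c \<Longrightarrow> \<exists>s\<in>S. c s \<noteq> 0"
  shows "1 \<notin> laurent_span \<phi> S a Q"
proof
  assume "1 \<in> laurent_span \<phi> S a Q"
  from laurent_span_clear_denominators[OF this Q] obtain N where
    "\<forall>N'. (\<forall>s\<in>S. N s \<le> N' s) \<longrightarrow> (\<exists>p\<in>mpolys_on S. Poly_Mapping.lookup p (expo N') = 0 \<and>
      1 * laurent S a (\<lambda>s. int (N' s)) = eval_over \<phi> a p)" by blast
  from spec[OF this, of N] obtain p where
    p: "p \<in> mpolys_on S" "Poly_Mapping.lookup p (expo N) = 0" "1 * laurent S a (\<lambda>s. int (N s)) = eval_over \<phi> a p"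
    by blast
  let ?q = "Poly_Mapping.single (expo N) (- 1) + p"
  have "?q \<in> mpolys_on S"
    unfolding mpolys_on_def
  proof (rule CollectI, rule ballI)
    fix m assume "m \<in> Poly_Mapping.keys ?q"
    then have "m \<in> Poly_Mapping.keys (Poly_Mapping.single (expo N) (- 1 :: 'k)) \<or> m \<in> Poly_Mapping.keys p"
      using keys_add[of "Poly_Mapping.single (expo N) (- 1 :: 'k)" p] by blast
    then show "Poly_Mapping.keys m \<subseteq> S"
      using p(1) keys_expo[of N] by (auto simp: mpolys_on_def split: if_splits)
  qed
  moreover have "Poly_Mapping.lookup ?q (expo N) = - 1" using p(2) by (simp add: lookup_add)
  then have "?q \<noteq> 0" by auto
  moreover have "eval_over \<phi> a ?q = 0"
    using p(3) by (simp add: eval_over_add eval_over_single monom_eval_expo hom)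
  ultimately show False using indep by blast
qed

lemma laurent_span_add:
  "x \<in> laurent_span \<phi> S a Q \<Longrightarrow> y \<in> laurent_span \<phi> S a Q \<Longrightarrow> x + y \<in> laurent_span \<phi> S a Q"
  by (induction rule: laurent_span.induct) (auto intro: laurent_span.intros simp: add.assoc)

lemma laurent_span_mult_monom:
  assumes "x \<in> laurent_span \<phi> S a Q" "Q1 d" "\<And>c d. Q c \<Longrightarrow> Q1 d \<Longrightarrow> Q' (\<lambda>s. d s + c s)"
  shows "\<phi> l * laurent S a d * x \<in> laurent_span \<phi> S a Q'"
  using assms(1)
proof (induction rule: laurent_span.induct)
  case (add c x k)
  have "\<phi> l * laurent S a d * (\<phi> k * laurent S a c + x) =
    \<phi> (l * k) * laurent S a (\<lambda>s. d s + c s) + \<phi> l * laurent S a d * x"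
    by (simp add: laurent_add hom algebra_simps)
  with add assms show ?case by (auto intro!: laurent_span.add)
qed (auto intro: laurent_span.zero)

lemma laurent_span_mult:
  assumes "x \<in> laurent_span \<phi> S a Q1" "y \<in> laurent_span \<phi> S a Q" "\<And>c d. Q c \<Longrightarrow> Q1 d \<Longrightarrow> Q' (\<lambda>s. d s + c s)"
  shows "x * y \<in> laurent_span \<phi> S a Q'"
  using assms(1)
proof (induction rule: laurent_span.induct)
  case (add d x l)
  have "\<phi> l * laurent S a d * y \<in> laurent_span \<phi> S a Q'"
    using assms(2) add.hyps(1) assms(3) by (rule laurent_span_mult_monom)
  with add show ?case by (simp add: distrib_right laurent_span_add)
qed (auto intro: laurent_span.zero)

lemma laurent_span_monom: "Q c \<Longrightarrow> \<phi> k * laurent S a c \<in> laurent_span \<phi> S a Q"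
  using laurent_span.add[OF _ laurent_span.zero, of Q c \<phi> k] by simp

text \<open>Exponent vectors are ordered lexicographically. In the ring spanned by the monomials of
  nonnegative exponent, those of positive exponent generate a proper ideal, and a valuation ring
  extending this situation contains no inverse of a positive monomial. So only the trivial Laurent
  monomial can be a unit.\<close>

lemma separating_valuation:
  "\<exists>A. is_subring A \<and> range \<phi> \<subseteq> A \<and> (\<forall>x. x \<noteq> 0 \<longrightarrow> x \<in> A \<or> inverse x \<in> A) \<and>
    (\<forall>c. laurent S a c \<in> A \<and> inverse (laurent S a c) \<in> A \<longrightarrow> (\<forall>s\<in>S. c s = 0))"
proof -
  obtain idx :: "'e \<Rightarrow> nat" where idx: "inj_on idx S"
    using finite_imp_inj_to_nat_seg finS by blast
  \<comment> \<open>Exponent vectors become integer polynomials, which are totally ordered by the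
    sign of the leading coefficient, compatibly with addition.\<close>
  define \<nu> where "\<nu> c = (\<Sum>s\<in>S. Polynomial.monom (c s) (idx s))" for c :: "'e \<Rightarrow> int"
  have \<nu>_add: "\<nu> (\<lambda>s. c s + d s) = \<nu> c + \<nu> d" for c d
    by (simp add: \<nu>_def sum.distrib flip: add_monom)
  have \<nu>_uminus: "\<nu> (\<lambda>s. - c s) = - \<nu> c" for c
    by (simp add: \<nu>_def sum_negf flip: minus_monom)
  have \<nu>0: "\<nu> (\<lambda>_. 0) = 0" by (simp add: \<nu>_def)
  have \<nu>_nz: "c s = 0" if "\<nu> c = 0" "s \<in> S" for c s
  proof -
    have "poly.coeff (\<nu> c) (idx s) = (\<Sum>t\<in>S. if t = s then c t else 0)"
      unfolding \<nu>_def coeff_sum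
      by (rule sum.cong) (use idx that(2) in \<open>auto simp: inj_on_def\<close>)
    also have "\<dots> = c s" using finS that(2) by simp
    finally show ?thesis using that(1) by simp
  qed
  define A0 where "A0 = laurent_span \<phi> S a (\<lambda>c. \<nu> c \<ge> 0)"
  define B where "B = laurent_span \<phi> S a (\<lambda>c. \<nu> c > 0)"
  define I where "I = laurent S a ` {c. \<nu> c > 0}"
  have mon: "\<phi> k * laurent S a c \<in> A0" if "\<nu> c \<ge> 0" for k c
    unfolding A0_def using that by (rule laurent_span_monom)
  have const: "\<phi> k \<in> A0" for k
    using mon[of "\<lambda>_. 0" k] \<nu>0 by (simp add: laurent_def)
  have A0mult: "x * y \<in> A0" if "x \<in> A0" "y \<in> A0" for x y
    using that unfolding A0_def by (rule laurent_span_mult) (simp add: \<nu>_add)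
  have A0: "is_subring A0"
    unfolding is_subring_def
  proof (intro conjI ballI)
    show "1 \<in> A0" using const[of 1] by (simp add: hom)
    fix x y assume xy: "x \<in> A0" "y \<in> A0"
    then show "x + y \<in> A0" "x * y \<in> A0" using laurent_span_add A0mult unfolding A0_def by blast+
    have "- y = \<phi> (- 1) * y" by (simp add: hom)
    then have "- y \<in> A0" using A0mult[OF const xy(2)] by simp
    then show "x - y \<in> A0" using xy(1) laurent_span_add unfolding A0_def by (metis diff_conv_add_uminus)
  qed
  have I: "I \<subseteq> A0"
    using mon[of _ 1] by (auto simp: I_def hom)
  \<comment> \<open>The ideal generated by the positive monomials stays inside their span
    \<open>B\<close>, and \<open>B\<close> does not contain 1.\<close>
  have "x \<in> B" if "x \<in> igen I A0" for x
    using that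
  proof (induction rule: igen.induct)
    case zero
    show ?case unfolding B_def by (rule laurent_span.zero)
  next
    case (add g b x)
    from add(1) obtain d where d: "g = laurent S a d" "\<nu> d > 0" by (auto simp: I_def)
    have "\<phi> 1 * laurent S a d * b \<in> B"
      unfolding B_def
      by (rule laurent_span_mult_monom[where ?Q1.0 = "\<lambda>c. \<nu> c > 0" and Q = "\<lambda>c. \<nu> c \<ge> 0"])
         (use add d in \<open>auto simp: A0_def \<nu>_add\<close>)
    with add d show ?case unfolding B_def by (auto simp: hom intro: laurent_span_add)
  qed
  moreover have "1 \<notin> B"
    unfolding B_def
  proof (rule one_notin_laurent_span, rule ccontr)
    fix c assume "\<nu> c > 0" "\<not> (\<exists>s\<in>S. c s \<noteq> 0)"
    then have "\<nu> c = 0" by (simp add: \<nu>_def)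
    with \<open>\<nu> c > 0\<close> show False by simp
  qed
  ultimately have "1 \<notin> igen I A0" by blast
  from valuation_ring_exists[OF A0 I this] obtain A where
    A: "is_subring A" "A0 \<subseteq> A" "1 \<notin> igen I A" "\<And>x. x \<noteq> 0 \<Longrightarrow> x \<in> A \<or> inverse x \<in> A" by blast
  have pos: "inverse (laurent S a c) \<notin> A" if "\<nu> c > 0" for c
  proof
    assume i: "inverse (laurent S a c) \<in> A"
    have "laurent S a c \<in> I" using that by (auto simp: I_def)
    from igen_mult[OF igen_base[OF A(1) this] A(1) i] A(3) laurent_nz show False by simp
  qed
  have "\<nu> c = 0" if "laurent S a c \<in> A" "inverse (laurent S a c) \<in> A" for c
  proof -
    have "\<not> \<nu> c > 0" "\<not> \<nu> c < 0"
      using pos[of c] pos[of "\<lambda>s. - c s"] that by (auto simp: laurent_uminus \<nu>_uminus)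
    then show ?thesis using linorder_cases by blast
  qed
  then have "\<forall>c. laurent S a c \<in> A \<and> inverse (laurent S a c) \<in> A \<longrightarrow> (\<forall>s\<in>S. c s = 0)"
    using \<nu>_nz by simp
  moreover have "range \<phi> \<subseteq> A" using const A(2) by blast
  moreover have "\<forall>x. x \<noteq> 0 \<longrightarrow> x \<in> A \<or> inverse x \<in> A" using A(4) by simp
  ultimately show ?thesis using A(1) by (intro exI[of _ A] conjI)
qed

end

section \<open>Relations along trees with signed leaves\<close>

text \<open>A leaf \<open>(i, True)\<close> stands for \<open>z i\<close> and \<open>(i, False)\<close> for \<open>- z i\<close>, so that the
  difference of two leaves of opposite sign is \<open>z i + z j\<close> up to sign.\<close>

datatype 'a btree = Tip 'a | Node "'a btree" "'a btree"

primrec tips :: "'a btree \<Rightarrow> 'a list" where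
  "tips (Tip x) = [x]"
| "tips (Node l r) = tips l @ tips r"

lemma tips_ne [simp]: "tips t \<noteq> []"
  by (induction t) auto

definition pair_sum :: "('b \<Rightarrow> 'b \<Rightarrow> bool) \<Rightarrow> ('n \<Rightarrow> 'n \<Rightarrow> 'a::comm_ring_1) \<Rightarrow> ('n \<times> 'b) list \<Rightarrow> ('n \<times> 'b) list \<Rightarrow> 'a" where
  "pair_sum R \<omega> xs ys = (\<Sum>a\<leftarrow>xs. \<Sum>b\<leftarrow>ys. if R (snd a) (snd b) then \<omega> (fst a) (fst b) else 0)"

abbreviation "cross \<equiv> pair_sum (\<noteq>)"
abbreviation "same \<equiv> pair_sum (=)"
abbreviation "full \<equiv> pair_sum (\<lambda>_ _. True)"

text \<open>The pairs counted at a node are those diverging there. Pairs of equal sign are skipped,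
  since their difference \<open>z i - z j\<close> does not occur in an entry of the matrix.\<close>

primrec tree_rel :: "('n \<Rightarrow> 'n \<Rightarrow> 'a::comm_ring_1) \<Rightarrow> ('n \<times> bool) btree \<Rightarrow> bool" where
  "tree_rel \<omega> (Tip x) \<longleftrightarrow> True"
| "tree_rel \<omega> (Node l r) \<longleftrightarrow> cross \<omega> (tips l) (tips r) = 0 \<and> tree_rel \<omega> l \<and> tree_rel \<omega> r"

text \<open>These are the relations of the caterpillar that splits off the leaves one after another
  in the order of the list.\<close>

primrec list_rel :: "('n \<Rightarrow> 'n \<Rightarrow> 'a::comm_ring_1) \<Rightarrow> ('n \<times> bool) list \<Rightarrow> bool" where
  "list_rel \<omega> [] \<longleftrightarrow> True"
| "list_rel \<omega> (x # xs) \<longleftrightarrow> cross \<omega> [x] xs = 0 \<and> list_rel \<omega> xs"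

text \<open>Each list holds the leaves of one branch at a trunk vertex, in order along the trunk;
  the mirror branch is implicit. At that vertex a leaf diverges from the mirror images of the leaves
  of equal sign in its group and from all later groups. All sums count ordered pairs, hence the
  mixed term appears twice.\<close>

primrec trunk_rel :: "('n \<Rightarrow> 'n \<Rightarrow> 'a::comm_ring_1) \<Rightarrow> ('n \<times> bool) list list \<Rightarrow> bool" where
  "trunk_rel \<omega> [] \<longleftrightarrow> True"
| "trunk_rel \<omega> (xs # xss) \<longleftrightarrow>
     same \<omega> xs xs + full \<omega> xs (concat xss) + full \<omega> xs (concat xss) = 0 \<and> trunk_rel \<omega> xss"

text \<open>Vanishing row sums express orthogonality to \<open>L\<close>; multiplicatively, they
  make the factors \<open>x i * x j\<close> of the entries cancel.\<close>

definition row_rel :: "('n::{finite,linorder} \<times> 'n) set \<Rightarrow> ('n \<Rightarrow> 'n \<Rightarrow> 'a::comm_ring_1) \<Rightarrow> bool" where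
  "row_rel S \<omega> \<longleftrightarrow> (\<forall>i j. \<omega> i j = \<omega> j i) \<and> (\<forall>i j. i \<le> j \<longrightarrow> (i, j) \<notin> S \<longrightarrow> \<omega> i j = 0) \<and>
     (\<forall>i. (\<Sum>j\<in>UNIV. \<omega> i j) = 0)"

lemma pair_sum_simps [simp]:
  "pair_sum R \<omega> [] ys = 0" "pair_sum R \<omega> xs [] = 0"
  "pair_sum R \<omega> (xs @ xs') ys = pair_sum R \<omega> xs ys + pair_sum R \<omega> xs' ys"
  "pair_sum R \<omega> xs (ys @ ys') = pair_sum R \<omega> xs ys + pair_sum R \<omega> xs ys'"
  by (auto simp: pair_sum_def sum_list_addf)

lemma pair_sum_Cons:
  "pair_sum R \<omega> (x # xs) ys = pair_sum R \<omega> [x] ys + pair_sum R \<omega> xs ys"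
  "pair_sum R \<omega> xs (y # ys) = pair_sum R \<omega> xs [y] + pair_sum R \<omega> xs ys"
  by (auto simp: pair_sum_def sum_list_addf)

lemma pair_sum_swap:
  assumes "\<And>i j. \<omega> i j = \<omega> j i" "\<And>a b. R a b = R b a"
  shows "pair_sum R \<omega> xs ys = pair_sum R \<omega> ys xs"
proof (induction xs)
  case (Cons x xs)
  have "pair_sum R \<omega> [x] ys = pair_sum R \<omega> ys [x]"
    by (induction ys) (simp_all add: pair_sum_def assms(1)[of "fst x"] assms(2)[of "snd x"])
  with Cons show ?case by (metis pair_sum_Cons)
qed simp

lemma pair_sum_mset:
  assumes "mset xs = mset xs'" "mset ys = mset ys'"
  shows "pair_sum R \<omega> xs ys = pair_sum R \<omega> xs' ys'"
proof -
  have *: "sum_list (map f xs) = sum_list (map f xs')" if "mset xs = mset xs'" for f :: "'z \<Rightarrow> 'd::comm_ring_1" and xs xs'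
    using that by (metis mset_map sum_mset_sum_list)
  show ?thesis unfolding pair_sum_def *[OF assms(1)] *[OF assms(2)] ..
qed

lemma pair_sum_hom:
  assumes "h 0 = 0" "\<And>x y. h (x + y) = h x + h y"
  shows "pair_sum R (\<lambda>i j. h (\<omega> i j)) xs ys = h (pair_sum R \<omega> xs ys)"
proof -
  have *: "h (sum_list (map f xs)) = (\<Sum>x\<leftarrow>xs. h (f x))" for f :: "'z \<Rightarrow> _" and xs
    by (induction xs) (simp_all add: assms)
  show ?thesis unfolding pair_sum_def * by (simp add: assms if_distrib cong: if_cong)
qed

lemma pair_sum_linear:
  "pair_sum R (\<lambda>i j. c * \<omega> i j + d * \<omega>' i j) xs ys = c * pair_sum R \<omega> xs ys + d * pair_sum R \<omega>' xs ys"
proof -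
  have "pair_sum R (\<lambda>i j. c * \<omega> i j + d * \<omega>' i j) xs ys =
    pair_sum R (\<lambda>i j. c * \<omega> i j) xs ys + pair_sum R (\<lambda>i j. d * \<omega>' i j) xs ys"
    by (simp add: pair_sum_def flip: sum_list_addf) (auto intro!: arg_cong[of _ _ sum_list] map_cong)
  then show ?thesis
    by (simp add: pair_sum_hom[of "\<lambda>x. c * x"] pair_sum_hom[of "\<lambda>x. d * x"] distrib_left)
qed

text \<open>The relations have integer coefficients and so pass along any additive map of the
  weights. This lemma and its analogues move weights between the integers, the rationals and the
  reals.\<close>

lemma tree_rel_hom:
  assumes "h 0 = 0" "\<And>x y. h (x + y) = h x + h y"
  shows "tree_rel \<omega> t \<Longrightarrow> tree_rel (\<lambda>i j. h (\<omega> i j)) t"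
  by (induction t) (auto simp: pair_sum_hom[of h, OF assms] assms(1))

lemma tree_rel_hom_inj:
  assumes "h 0 = 0" "\<And>x y. h (x + y) = h x + h y" "\<And>x. h x = 0 \<Longrightarrow> x = 0"
  shows "tree_rel (\<lambda>i j. h (\<omega> i j)) t \<Longrightarrow> tree_rel \<omega> t"
  by (induction t) (auto simp: pair_sum_hom[of h, OF assms(1,2)] assms(3))

lemma trunk_rel_hom:
  assumes "h 0 = 0" "\<And>x y. h (x + y) = h x + h y"
  shows "trunk_rel \<omega> xss \<Longrightarrow> trunk_rel (\<lambda>i j. h (\<omega> i j)) xss"
  by (induction xss) (auto simp: pair_sum_hom[of h, OF assms] assms(1) simp flip: assms(2))

lemma trunk_rel_hom_inj:
  assumes "h 0 = 0" "\<And>x y. h (x + y) = h x + h y" "\<And>x. h x = 0 \<Longrightarrow> x = 0"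
  shows "trunk_rel (\<lambda>i j. h (\<omega> i j)) xss \<Longrightarrow> trunk_rel \<omega> xss"
  by (induction xss) (auto simp: pair_sum_hom[of h, OF assms(1,2)] assms(3) simp flip: assms(2))

lemma row_rel_hom:
  assumes "h 0 = 0" "\<And>x y. h (x + y) = h x + h y"
  shows "row_rel S \<omega> \<Longrightarrow> row_rel S (\<lambda>i j. h (\<omega> i j))"
proof -
  have s: "(\<Sum>a\<in>A. h (f a)) = h (sum f A)" for f :: "'z \<Rightarrow> _" and A
    by (induction A rule: infinite_finite_induct) (simp_all add: assms)
  assume r: "row_rel S \<omega>"
  have "h (\<omega> i j) = h (\<omega> j i)" for i j using r by (simp add: row_rel_def)
  moreover have "h (\<omega> i j) = 0" if "i \<le> j" "(i, j) \<notin> S" for i j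
    using r that assms(1) by (simp add: row_rel_def)
  moreover have "(\<Sum>j\<in>UNIV. h (\<omega> i j)) = 0" for i
  proof -
    have "(\<Sum>j\<in>UNIV. \<omega> i j) = 0" using r unfolding row_rel_def by blast
    then show ?thesis unfolding s using assms(1) by simp
  qed
  ultimately show "row_rel S (\<lambda>i j. h (\<omega> i j))" by (simp add: row_rel_def)
qed

lemma row_rel_hom_inj:
  assumes "h 0 = 0" "\<And>x y. h (x + y) = h x + h y" "\<And>x y. h x = h y \<Longrightarrow> x = y"
  shows "row_rel S (\<lambda>i j. h (\<omega> i j)) \<Longrightarrow> row_rel S \<omega>"
proof -
  have s: "h (sum f A) = (\<Sum>a\<in>A. h (f a))" for f :: "'z \<Rightarrow> _" and A
    by (induction A rule: infinite_finite_induct) (simp_all add: assms(1,2))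
  assume r: "row_rel S (\<lambda>i j. h (\<omega> i j))"
  have "\<omega> i j = \<omega> j i" for i j using r assms(3) by (simp add: row_rel_def)
  moreover have "\<omega> i j = 0" if "i \<le> j" "(i, j) \<notin> S" for i j
    using r that assms(1) by (intro assms(3)) (simp add: row_rel_def)
  moreover have "(\<Sum>j\<in>UNIV. \<omega> i j) = 0" for i
  proof -
    have "(\<Sum>j\<in>UNIV. h (\<omega> i j)) = 0" using r unfolding row_rel_def by blast
    then show ?thesis using assms(1) by (intro assms(3)) (simp add: s)
  qed
  ultimately show "row_rel S \<omega>" by (simp add: row_rel_def)
qed

lemma tree_rel_linear:
  "tree_rel \<omega> t \<Longrightarrow> tree_rel \<omega>' t \<Longrightarrow> tree_rel (\<lambda>i j. c * \<omega> i j + d * \<omega>' i j) t"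
  by (induction t) (auto simp: pair_sum_linear)

lemma list_rel_linear:
  "list_rel \<omega> xs \<Longrightarrow> list_rel \<omega>' xs \<Longrightarrow> list_rel (\<lambda>i j. c * \<omega> i j + d * \<omega>' i j) xs"
  by (induction xs) (auto simp: pair_sum_linear)

lemma trunk_rel_linear:
  assumes "trunk_rel \<omega> xss" "trunk_rel \<omega>' xss"
  shows "trunk_rel (\<lambda>i j. c * \<omega> i j + d * \<omega>' i j) xss"
  using assms
proof (induction xss)
  case (Cons xs xss)
  let ?w = "\<lambda>i j. c * \<omega> i j + d * \<omega>' i j"
  have "same ?w xs xs + full ?w xs (concat xss) + full ?w xs (concat xss) = c * (same \<omega> xs xs + full \<omega> xs (concat xss) + full \<omega> xs (concat xss)) +
    d * (same \<omega>' xs xs + full \<omega>' xs (concat xss) + full \<omega>' xs (concat xss))"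
    by (simp add: pair_sum_linear algebra_simps)
  also have "\<dots> = 0" using Cons.prems by (simp only: trunk_rel.simps mult_zero_right add_0)
  finally show ?case using Cons by simp
qed simp

lemma row_rel_linear:
  "row_rel S \<omega> \<Longrightarrow> row_rel S \<omega>' \<Longrightarrow> row_rel S (\<lambda>i j. c * \<omega> i j + d * \<omega>' i j)"
  by (simp add: row_rel_def sum.distrib flip: sum_distrib_left)

section \<open>Reduction to caterpillars\<close>

definition linear_closed :: "('n \<Rightarrow> 'n \<Rightarrow> real) set \<Rightarrow> bool" where
  "linear_closed R \<longleftrightarrow> (\<forall>\<omega>\<in>R. \<forall>\<omega>'\<in>R. \<forall>c d. (\<lambda>i j. c * \<omega> i j + d * \<omega>' i j) \<in> R)"

text \<open>The relations of the three trees \<open>(ab)r\<close>, \<open>a(br)\<close>, \<open>b(ar)\<close> lie in a common space on which the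
  functionals defining them add up to zero. So if the first tree has no nonzero relation, one of the
  other two has none either.\<close>

lemma nearest_neighbour_interchange:
  assumes R: "linear_closed R" and sym: "\<And>\<omega> i j. \<omega> \<in> R \<Longrightarrow> \<omega> i j = \<omega> j i"
    and t: "\<And>\<omega>. \<omega> \<in> R \<Longrightarrow> tree_rel \<omega> (Node (Node a b) r) \<Longrightarrow> \<omega> = (\<lambda>_ _. 0)"
  shows "(\<forall>\<omega>\<in>R. tree_rel \<omega> (Node a (Node b r)) \<longrightarrow> \<omega> = (\<lambda>_ _. 0)) \<or>
    (\<forall>\<omega>\<in>R. tree_rel \<omega> (Node b (Node a r)) \<longrightarrow> \<omega> = (\<lambda>_ _. 0))"
proof (rule ccontr)
  assume "\<not> ?thesis"
  then obtain \<omega>1 \<omega>2 where w1: "\<omega>1 \<in> R" "tree_rel \<omega>1 (Node a (Node b r))" "\<omega>1 \<noteq> (\<lambda>_ _. 0)"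
    and w2: "\<omega>2 \<in> R" "tree_rel \<omega>2 (Node b (Node a r))" "\<omega>2 \<noteq> (\<lambda>_ _. 0)" by blast
  let ?A = "tips a" and ?B = "tips b" and ?C = "tips r"
  have ba: "cross \<omega>2 ?B ?A = cross \<omega>2 ?A ?B"
    using sym[OF w2(1)] by (intro pair_sum_swap) auto
  define p1 p2 where "p1 = cross \<omega>1 ?A ?B" and "p2 = cross \<omega>2 ?A ?B"
  have e1: "cross \<omega>1 ?B ?C = 0" "cross \<omega>1 ?A ?C = - p1"
    using w1(2) by (auto simp: p1_def algebra_simps eq_neg_iff_add_eq_0)
  have e2: "cross \<omega>2 ?A ?C = 0" "cross \<omega>2 ?B ?C = - p2"
    using w2(2) ba by (auto simp: p2_def algebra_simps eq_neg_iff_add_eq_0)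
  have p1: "p1 \<noteq> 0" using t[OF w1(1)] w1(2,3) e1 by (auto simp: p1_def)
  have p2: "p2 \<noteq> 0" using t[OF w2(1)] w2(2,3) e2 by (auto simp: p2_def)
  \<comment> \<open>The coefficients are chosen so that the values of \<open>cross\<close> on
    \<open>?A\<close>, \<open>?B\<close> cancel in \<omega>. The relation of the node above then
    holds too, while \<open>cross\<close> on \<open>?B\<close>, \<open>?C\<close> takes the value
    \<open>p1 * p2\<close>.\<close>
  define q where "q = - p1"
  define \<omega> where "\<omega> = (\<lambda>i j. p2 * \<omega>1 i j + q * \<omega>2 i j)"
  have wR: "\<omega> \<in> R" using R w1(1) w2(1) unfolding linear_closed_def \<omega>_def by blast
  have "tree_rel \<omega> (Node (Node a b) r)"
    using w1(2) w2(2) e1 e2 unfolding \<omega>_def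
    by (simp add: pair_sum_linear tree_rel_linear p1_def[symmetric] p2_def[symmetric]) (simp add: q_def ba p2_def)
  from t[OF wR this] have "cross \<omega> ?B ?C = 0" by (simp add: pair_sum_def)
  then have "p1 * p2 = 0" unfolding \<omega>_def pair_sum_linear e1 e2 by (simp add: q_def)
  with p1 p2 show False by simp
qed

text \<open>Interchanges are repeated until the left child of the root is a tip; the tip is split
  off and its relation absorbed into \<open>R\<close>. An interchange keeps the leaves and shrinks
  the left child, whence the lexicographic measure. An arbitrary linear space \<open>R\<close> is
  carried along so that relations from elsewhere can take part.\<close>

lemma caterpillar_tree:
  assumes "linear_closed R" "\<And>\<omega> i j. \<omega> \<in> R \<Longrightarrow> \<omega> i j = \<omega> j i"
    and "\<And>\<omega>. \<omega> \<in> R \<Longrightarrow> tree_rel \<omega> t \<Longrightarrow> \<omega> = (\<lambda>_ _. 0)"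
  shows "\<exists>xs. mset xs = mset (tips t) \<and> (\<forall>\<omega>\<in>R. list_rel \<omega> xs \<longrightarrow> \<omega> = (\<lambda>_ _. 0))"
  using assms
proof (induction t arbitrary: R rule: wf_induct_rule[OF wf_measures[of "[\<lambda>t. length (tips t), \<lambda>t. case t of Tip _ \<Rightarrow> 0 | Node l _ \<Rightarrow> length (tips l)]"]])
  case (1 t)
  note IH = 1(1) and prems = 1(2-)
  show ?case
  proof (cases t)
    case (Tip x)
    then show ?thesis using prems(3) by (intro exI[of _ "[x]"]) auto
  next
    case (Node l r)
    show ?thesis
    proof (cases l)
      case (Tip x)
      define R' where "R' = {\<omega> \<in> R. cross \<omega> [x] (tips r) = 0}"
      have "linear_closed R'" using prems(1) by (auto simp: linear_closed_def R'_def pair_sum_linear)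
      moreover have "\<omega> = (\<lambda>_ _. 0)" if "\<omega> \<in> R'" "tree_rel \<omega> r" for \<omega>
        using prems(3) that Node Tip by (auto simp: R'_def)
      moreover have "(r, t) \<in> measures [\<lambda>t. length (tips t), \<lambda>t. case t of Tip _ \<Rightarrow> 0 | Node l _ \<Rightarrow> length (tips l)]"
        using Node Tip by simp
      ultimately obtain xs where xs: "mset xs = mset (tips r)" "\<forall>\<omega>\<in>R'. list_rel \<omega> xs \<longrightarrow> \<omega> = (\<lambda>_ _. 0)"
        using IH[of r R'] prems(2) unfolding R'_def by blast
      show ?thesis
      proof (intro exI[of _ "x # xs"] conjI ballI impI)
        show "mset (x # xs) = mset (tips t)" using xs(1) \<open>t = Node l r\<close> Tip by simp
        fix \<omega> assume w: "\<omega> \<in> R" "list_rel \<omega> (x # xs)"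
        have "cross \<omega> [x] xs = cross \<omega> [x] (tips r)" by (rule pair_sum_mset) (simp_all add: xs(1))
        with w have "\<omega> \<in> R'" by (simp add: R'_def)
        with xs(2) w(2) show "\<omega> = (\<lambda>_ _. 0)" by simp
      qed
    next
      case (Node a b)
      have t: "t = Node (Node a b) r" using \<open>t = Node l r\<close> Node by simp
      have small: "(Node a (Node b r), t) \<in> measures [\<lambda>t. length (tips t), \<lambda>t. case t of Tip _ \<Rightarrow> 0 | Node l _ \<Rightarrow> length (tips l)]"
        "(Node b (Node a r), t) \<in> measures [\<lambda>t. length (tips t), \<lambda>t. case t of Tip _ \<Rightarrow> 0 | Node l _ \<Rightarrow> length (tips l)]"
        unfolding t by auto
      have ms: "mset (tips (Node a (Node b r))) = mset (tips t)" "mset (tips (Node b (Node a r))) = mset (tips t)"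
        unfolding t by auto
      have "(\<forall>\<omega>\<in>R. tree_rel \<omega> (Node a (Node b r)) \<longrightarrow> \<omega> = (\<lambda>_ _. 0)) \<or>
        (\<forall>\<omega>\<in>R. tree_rel \<omega> (Node b (Node a r)) \<longrightarrow> \<omega> = (\<lambda>_ _. 0))"
        using prems(1) prems(2) prems(3)[unfolded t] by (rule nearest_neighbour_interchange)
      then show ?thesis
      proof
        assume "\<forall>\<omega>\<in>R. tree_rel \<omega> (Node a (Node b r)) \<longrightarrow> \<omega> = (\<lambda>_ _. 0)"
        then have "\<exists>xs. mset xs = mset (tips (Node a (Node b r))) \<and> (\<forall>\<omega>\<in>R. list_rel \<omega> xs \<longrightarrow> \<omega> = (\<lambda>_ _. 0))"
          using prems(2) by (intro IH[OF small(1) prems(1)]) simp_all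
        then show ?thesis unfolding ms .
      next
        assume "\<forall>\<omega>\<in>R. tree_rel \<omega> (Node b (Node a r)) \<longrightarrow> \<omega> = (\<lambda>_ _. 0)"
        then have "\<exists>xs. mset xs = mset (tips (Node b (Node a r))) \<and> (\<forall>\<omega>\<in>R. list_rel \<omega> xs \<longrightarrow> \<omega> = (\<lambda>_ _. 0))"
          using prems(2) by (intro IH[OF small(2) prems(1)]) simp_all
        then show ?thesis unfolding ms .
      qed
    qed
  qed
qed

text \<open>While one tree is rearranged, the relations of the trees still to come
  (\<open>R1\<close>) or of the list already found (\<open>R2\<close>) count as part of the ambient
  space.\<close>

lemma caterpillar_forest:
  assumes "linear_closed R" "\<And>\<omega> i j. \<omega> \<in> R \<Longrightarrow> \<omega> i j = \<omega> j i"
    and "\<And>\<omega>. \<omega> \<in> R \<Longrightarrow> \<forall>t\<in>set ts. tree_rel \<omega> t \<Longrightarrow> \<omega> = (\<lambda>_ _. 0)"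
  shows "\<exists>xss. map mset xss = map (mset \<circ> tips) ts \<and>
    (\<forall>\<omega>\<in>R. (\<forall>xs\<in>set xss. list_rel \<omega> xs) \<longrightarrow> \<omega> = (\<lambda>_ _. 0))"
  using assms
proof (induction ts arbitrary: R)
  case Nil
  then show ?case by (intro exI[of _ "[]"]) auto
next
  case (Cons t ts)
  define R1 where "R1 = {\<omega> \<in> R. \<forall>t\<in>set ts. tree_rel \<omega> t}"
  have "linear_closed R1" using Cons.prems(1) by (auto simp: linear_closed_def R1_def tree_rel_linear)
  then obtain xs where xs: "mset xs = mset (tips t)" "\<forall>\<omega>\<in>R1. list_rel \<omega> xs \<longrightarrow> \<omega> = (\<lambda>_ _. 0)"
    using caterpillar_tree[of R1 t] Cons.prems(2,3) unfolding R1_def by auto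
  define R2 where "R2 = {\<omega> \<in> R. list_rel \<omega> xs}"
  have "linear_closed R2" using Cons.prems(1) by (auto simp: linear_closed_def R2_def list_rel_linear)
  then have "\<exists>xss. map mset xss = map (mset \<circ> tips) ts \<and>
    (\<forall>\<omega>\<in>R2. (\<forall>xs\<in>set xss. list_rel \<omega> xs) \<longrightarrow> \<omega> = (\<lambda>_ _. 0))"
    using Cons.prems(2) xs(2) by (intro Cons.IH) (auto simp: R1_def R2_def)
  then obtain xss where "map mset xss = map (mset \<circ> tips) ts"
    "\<forall>\<omega>\<in>R2. (\<forall>xs\<in>set xss. list_rel \<omega> xs) \<longrightarrow> \<omega> = (\<lambda>_ _. 0)" by blast
  then show ?case using xs(1) by (intro exI[of _ "xs # xss"]) (auto simp: R2_def)
qed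

section \<open>Making every group end in two leaves of opposite sign\<close>

lemma trunk_rel_mset:
  assumes "map mset xss = map mset yss"
  shows "trunk_rel \<omega> xss \<longleftrightarrow> trunk_rel \<omega> yss"
  using assms
proof (induction xss arbitrary: yss)
  case (Cons xs xss)
  then obtain ys yss' where y: "yss = ys # yss'" "mset xs = mset ys" "map mset xss = map mset yss'"
    by (cases yss) auto
  have "mset (concat xss) = mset (concat yss')"
    using y(3) by (simp add: mset_concat)
  with Cons.IH[OF y(3)] y(2) show ?case
    unfolding y(1) by (simp add: pair_sum_mset[of xs ys xs ys] pair_sum_mset[of xs ys "concat xss" "concat yss'"])
qed simp

text \<open>The last two leaves form the cherry at the end of the caterpillar. Opposite signs give
  them different colours within one branch, as the split condition demands of every internal
  edge.\<close>

definition valid_group :: "('n \<times> bool) list \<Rightarrow> bool" where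
  "valid_group xs \<longleftrightarrow> xs \<noteq> [] \<and> (length xs \<ge> 2 \<longrightarrow> snd (last (butlast xs)) \<noteq> snd (last xs))"

lemma same_sign_cross: "\<forall>x\<in>set xs. snd x = s \<Longrightarrow> \<forall>y\<in>set ys. snd y = s \<Longrightarrow> cross \<omega> xs ys = 0"
proof -
  assume a: "\<forall>x\<in>set xs. snd x = s" "\<forall>y\<in>set ys. snd y = s"
  have "cross \<omega> xs ys = (\<Sum>a\<leftarrow>xs. \<Sum>b\<leftarrow>ys. 0)"
    unfolding pair_sum_def using a by (intro arg_cong[of _ _ sum_list] map_cong) auto
  then show ?thesis by (simp add: sum_list_triv)
qed

lemma same_sign_list_rel: "\<forall>x\<in>set xs. snd x = s \<Longrightarrow> list_rel \<omega> xs"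
proof (induction xs)
  case (Cons x xs)
  then have "cross \<omega> [x] xs = 0" by (intro same_sign_cross[of _ s]) auto
  with Cons show ?case by simp
qed simp

lemma last_sign_change:
  "(\<exists>s. \<forall>x\<in>set xs. snd x = (s::bool)) \<or>
   (\<exists>pre y ys. xs = pre @ y # ys \<and> ys \<noteq> [] \<and> (\<forall>x\<in>set ys. snd x \<noteq> snd y))"
proof (induction xs)
  case (Cons x xs)
  then show ?case
  proof
    assume "\<exists>s. \<forall>x\<in>set xs. snd x = s"
    then obtain s where s: "\<forall>x\<in>set xs. snd x = s" by blast
    show ?thesis
    proof (cases "xs = [] \<or> snd x = s")
      case True
      with s show ?thesis by (intro disjI1 exI[of _ "snd x"]) auto
    next
      case False
      with s show ?thesis by (intro disjI2 exI[of _ "[]"] exI[of _ x] exI[of _ xs]) auto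
    qed
  next
    assume "\<exists>pre y ys. xs = pre @ y # ys \<and> ys \<noteq> [] \<and> (\<forall>x\<in>set ys. snd x \<noteq> snd y)"
    then obtain pre y ys where "xs = pre @ y # ys" "ys \<noteq> []" "\<forall>x\<in>set ys. snd x \<noteq> snd y" by blast
    then have "x # xs = (x # pre) @ y # ys" "ys \<noteq> []" "\<forall>x\<in>set ys. snd x \<noteq> snd y" by auto
    then show ?thesis by blast
  qed
qed simp

text \<open>With \<open>y\<close> at the end, each element of \<open>ys\<close> has a relation
  involving only itself and \<open>y\<close>; their sum is the single relation of \<open>y\<close>
  placed before \<open>ys\<close>.\<close>

lemma list_rel_move_last:
  assumes sym: "\<And>i j. \<omega> i j = \<omega> j i" and ys: "\<forall>x\<in>set ys. snd x \<noteq> snd y"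
    and r: "list_rel \<omega> (pre @ ys @ [y])"
  shows "list_rel \<omega> (pre @ y # ys)"
  using r
proof (induction pre)
  case Nil
  have const: "\<forall>x\<in>set ys. snd x = (\<not> snd y)" using ys by auto
  have "cross \<omega> ys [y] = 0" using Nil[simplified] const
  proof (induction ys)
    case (Cons m ys)
    then have "cross \<omega> [m] ys = 0" by (intro same_sign_cross[of _ "\<not> snd y"]) auto
    with Cons show ?case by (simp add: pair_sum_Cons(1)[of _ _ m ys])
  qed simp
  moreover have "cross \<omega> [y] ys = cross \<omega> ys [y]" by (rule pair_sum_swap) (auto simp: sym)
  ultimately show ?case using same_sign_list_rel[OF const] by simp
next
  case (Cons x pre)
  have "cross \<omega> [x] (pre @ y # ys) = cross \<omega> [x] (pre @ ys @ [y])" by (rule pair_sum_mset) auto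
  with Cons show ?case by simp
qed

text \<open>A group of one sign carries no relation inside its branch, so its leaves may hang on the
  trunk one by one. The relations of the new trunk vertices add up to that of the old one.\<close>

lemma trunk_rel_split_group:
  assumes sym: "\<And>i j. \<omega> i j = \<omega> j i" and xs: "\<forall>x\<in>set xs. snd x = s"
    and r: "trunk_rel \<omega> (map (\<lambda>x. [x]) xs @ yss)"
  shows "trunk_rel \<omega> (xs # yss)"
  using xs r
proof (induction xs)
  case (Cons x xs)
  let ?Y = "concat yss"
  have c: "concat (map (\<lambda>x. [x]) xs @ yss) = xs @ ?Y" by (induction xs) auto
  have 1: "same \<omega> [x] [x] + (full \<omega> [x] xs + full \<omega> [x] ?Y) + (full \<omega> [x] xs + full \<omega> [x] ?Y) = 0"
    using Cons.prems(2) c by simp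
  have 2: "same \<omega> xs xs + full \<omega> xs ?Y + full \<omega> xs ?Y = 0" "trunk_rel \<omega> yss"
    using Cons by auto
  have "same \<omega> [x] xs = full \<omega> [x] xs"
    unfolding pair_sum_def using Cons.prems(1) by (auto intro!: arg_cong[of _ _ sum_list] map_cong)
  moreover have "same \<omega> xs [x] = same \<omega> [x] xs" by (rule pair_sum_swap) (auto simp: sym)
  ultimately have "same \<omega> (x # xs) (x # xs) = same \<omega> [x] [x] + full \<omega> [x] xs + full \<omega> [x] xs + same \<omega> xs xs"
    by (simp add: pair_sum_Cons(1)[of _ _ x xs] pair_sum_Cons(2)[of _ _ _ x xs] algebra_simps)
  moreover have "full \<omega> (x # xs) ?Y = full \<omega> [x] ?Y + full \<omega> xs ?Y" by (rule pair_sum_Cons)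
  ultimately have "same \<omega> (x # xs) (x # xs) + full \<omega> (x # xs) ?Y + full \<omega> (x # xs) ?Y =
     (same \<omega> [x] [x] + (full \<omega> [x] xs + full \<omega> [x] ?Y) + (full \<omega> [x] xs + full \<omega> [x] ?Y)) +
     (same \<omega> xs xs + full \<omega> xs ?Y + full \<omega> xs ?Y)" by (simp add: algebra_simps)
  with 1 2 show ?case by simp
qed simp

text \<open>A group of one sign is dissolved into singletons; in any other group the last element
  whose sign differs from the end is moved to the end. The new relations imply the old ones, so
  having only the zero solution is preserved.\<close>

lemma refine_to_valid_groups:
  assumes "\<forall>xs\<in>set xss. xs \<noteq> []"
  shows "\<exists>yss. mset (concat yss) = mset (concat xss) \<and> (\<forall>ys\<in>set yss. valid_group ys) \<and>
    (\<forall>\<omega> :: 'n \<Rightarrow> 'n \<Rightarrow> real. (\<forall>i j. \<omega> i j = \<omega> j i) \<longrightarrow> trunk_rel \<omega> yss \<longrightarrow> (\<forall>ys\<in>set yss. list_rel \<omega> ys) \<longrightarrow>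
      trunk_rel \<omega> xss \<and> (\<forall>xs\<in>set xss. list_rel \<omega> xs))"
  using assms
proof (induction xss)
  case Nil
  then show ?case by (intro exI[of _ "[]"]) auto
next
  case (Cons xs xss)
  then obtain yss where y: "mset (concat yss) = mset (concat xss)" "\<forall>ys\<in>set yss. valid_group ys"
    "\<And>\<omega> :: 'n \<Rightarrow> 'n \<Rightarrow> real. (\<forall>i j. \<omega> i j = \<omega> j i) \<Longrightarrow> trunk_rel \<omega> yss \<Longrightarrow> (\<forall>ys\<in>set yss. list_rel \<omega> ys) \<Longrightarrow>
      trunk_rel \<omega> xss \<and> (\<forall>xs\<in>set xss. list_rel \<omega> xs)" by auto
  consider s where "\<forall>x\<in>set xs. snd x = s"
    | pre z zs where "xs = pre @ z # zs" "zs \<noteq> []" "\<forall>x\<in>set zs. snd x \<noteq> snd z"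
    using last_sign_change[of xs] by metis
  then show ?case
  proof cases
    case (1 s)
    let ?Y = "map (\<lambda>x. [x]) xs @ yss"
    have c: "concat ?Y = xs @ concat yss" by (induction xs) auto
    have "trunk_rel \<omega> (xs # xss) \<and> (\<forall>xs\<in>set (xs # xss). list_rel \<omega> xs)"
      if w: "\<forall>i j. \<omega> i j = \<omega> j i" "trunk_rel \<omega> ?Y" "\<forall>ys\<in>set ?Y. list_rel \<omega> ys" for \<omega> :: "'n \<Rightarrow> 'n \<Rightarrow> real"
    proof -
      have r: "trunk_rel \<omega> (xs # yss)" using trunk_rel_split_group[OF _ 1 w(2)] w(1) by blast
      then have "trunk_rel \<omega> xss \<and> (\<forall>xs\<in>set xss. list_rel \<omega> xs)" using y(3)[OF w(1)] w(3) by simp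
      moreover have "full \<omega> xs (concat yss) = full \<omega> xs (concat xss)" by (rule pair_sum_mset) (simp_all add: y(1))
      ultimately show ?thesis using r same_sign_list_rel[OF 1] by simp
    qed
    moreover have "\<forall>ys\<in>set ?Y. valid_group ys" using y(2) by (auto simp: valid_group_def)
    moreover have "mset (concat ?Y) = mset (concat (xs # xss))" unfolding c by (simp add: y(1))
    ultimately show ?thesis by (intro exI[of _ ?Y]) blast
  next
    case (2 pre z zs)
    let ?x = "pre @ zs @ [z]"
    have m: "mset ?x = mset xs" using 2 by simp
    have "trunk_rel \<omega> (xs # xss) \<and> (\<forall>xs\<in>set (xs # xss). list_rel \<omega> xs)"
      if w: "\<forall>i j. \<omega> i j = \<omega> j i" "trunk_rel \<omega> (?x # yss)" "\<forall>ys\<in>set (?x # yss). list_rel \<omega> ys" for \<omega> :: "'n \<Rightarrow> 'n \<Rightarrow> real"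
    proof -
      have "trunk_rel \<omega> xss \<and> (\<forall>xs\<in>set xss. list_rel \<omega> xs)" using y(3)[OF w(1)] w(2,3) by simp
      moreover have "full \<omega> ?x (concat yss) = full \<omega> xs (concat xss)" by (rule pair_sum_mset) (simp_all only: y(1) m)
      moreover have "same \<omega> ?x ?x = same \<omega> xs xs" by (rule pair_sum_mset) (simp_all only: m)
      moreover have "list_rel \<omega> xs" unfolding 2(1) using w by (intro list_rel_move_last 2(3)) auto
      ultimately show ?thesis using w(2) by (simp del: pair_sum_simps)
    qed
    moreover have "valid_group ?x"
      using 2(2,3) by (auto simp: valid_group_def butlast_append last_append dest: last_in_set)
    moreover have "mset (concat (?x # yss)) = mset (concat (xs # xss))" using m by (simp add: y(1))
    moreover from \<open>valid_group ?x\<close> y(2) have "\<forall>ys\<in>set (?x # yss). valid_group ys" by simp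
    ultimately show ?thesis by (intro exI[of _ "?x # yss"]) blast
  qed
qed

section \<open>The forest of a valuation\<close>

locale valuation_ring =
  fixes A :: "'f::field set"
  assumes ring: "is_subring A" and total: "x \<noteq> 0 \<Longrightarrow> x \<in> A \<or> inverse x \<in> A"
begin

text \<open>In multiplicative notation this is |a| \<le> |b| for the valuation of \<open>A\<close>;
  \<open>eqv\<close> means equal absolute value and \<open>unit\<close> absolute value 1.\<close>

definition le :: "'f \<Rightarrow> 'f \<Rightarrow> bool" where
  "le a b \<longleftrightarrow> (\<exists>c\<in>A. a = c * b)"

definition eqv :: "'f \<Rightarrow> 'f \<Rightarrow> bool" where
  "eqv a b \<longleftrightarrow> le a b \<and> le b a"

definition unit :: "'f \<Rightarrow> bool" where
  "unit u \<longleftrightarrow> u \<noteq> 0 \<and> u \<in> A \<and> inverse u \<in> A"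

lemma le_refl: "le a a" using is_subringD(1)[OF ring] by (auto simp: le_def intro!: bexI[of _ 1])

lemma le_0 [simp]: "le 0 a" using is_subringD(2)[OF ring] by (auto simp: le_def intro!: bexI[of _ 0])

lemma le_0_iff: "le a 0 \<longleftrightarrow> a = 0"
  using le_0 by (auto simp: le_def)

lemma le_total: "le a b \<or> le b a"
proof (cases "a = 0 \<or> b = 0")
  case False
  then have "a / b \<in> A \<or> inverse (a / b) \<in> A" by (intro total) auto
  moreover have "a = (a / b) * b" "b = inverse (a / b) * a" using False by auto
  ultimately show ?thesis unfolding le_def by metis
qed auto

lemma le_trans: "le a b \<Longrightarrow> le b c \<Longrightarrow> le a c"
  unfolding le_def by (metis is_subringD(4)[OF ring] mult.assoc)

lemma le_add: "le a c \<Longrightarrow> le b c \<Longrightarrow> le (a + b) c"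
  unfolding le_def by (metis is_subringD(3)[OF ring] distrib_right)

lemma le_uminus: "le a c \<Longrightarrow> le (- a) c"
  unfolding le_def by (metis is_subringD(6)[OF ring] mult_minus_left)

lemma le_diff: "le a c \<Longrightarrow> le b c \<Longrightarrow> le (a - b) c"
  using le_add[of a c "- b"] le_uminus by simp

lemma eqv_sym: "eqv a b \<Longrightarrow> eqv b a" by (simp add: eqv_def)

lemma eqv_trans: "eqv a b \<Longrightarrow> eqv b c \<Longrightarrow> eqv a c"
  unfolding eqv_def using le_trans by blast

lemma eqv_uminus: "eqv (- a) a"
  unfolding eqv_def using le_uminus[of a a] le_uminus[of "- a" "- a"] le_refl by simp

lemma lt_add: "\<not> le g a \<Longrightarrow> \<not> le g b \<Longrightarrow> \<not> le g (a + b)"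
  using le_total[of a b] le_add le_refl le_trans by metis

text \<open>The isosceles triangle property of an ultrametric.\<close>

lemma eqv_add_small: "\<not> le g a \<Longrightarrow> eqv b g \<Longrightarrow> eqv (b + a) g"
proof -
  assume a: "\<not> le g a" and b: "eqv b g"
  have "le a g" using a le_total by blast
  then have "le (b + a) g" using b le_add by (auto simp: eqv_def)
  moreover have "le g (b + a)"
  proof (rule ccontr)
    assume n: "\<not> le g (b + a)"
    have "\<not> le g (- a)" using a le_uminus[of "- a"] le_trans le_uminus[of a a] le_refl by (metis minus_minus)
    from lt_add[OF n this] b show False by (simp add: eqv_def)
  qed
  ultimately show ?thesis by (simp add: eqv_def)
qed

lemma eqv_unit: "eqv a b \<Longrightarrow> b \<noteq> 0 \<Longrightarrow> unit (a / b)"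
proof -
  assume e: "eqv a b" and b: "b \<noteq> 0"
  have a: "a \<noteq> 0" using e b le_0_iff by (auto simp: eqv_def)
  obtain c where "c \<in> A" "a = c * b" using e unfolding eqv_def le_def by blast
  obtain d where "d \<in> A" "b = d * a" using e unfolding eqv_def le_def by blast
  have "a / b = c" "b / a = d" using a b \<open>a = c * b\<close> \<open>b = d * a\<close> by (metis nonzero_mult_div_cancel_right)+
  then have "inverse (a / b) = d" by (metis inverse_divide)
  with \<open>c \<in> A\<close> \<open>d \<in> A\<close> a b \<open>a / b = c\<close> show ?thesis by (auto simp: unit_def)
qed

lemma unit_eqv: "unit u \<Longrightarrow> eqv (u * b) b"
proof -
  assume u: "unit u"
  then have "b = inverse u * (u * b)" by (simp add: unit_def)
  then show ?thesis using u unfolding eqv_def le_def unit_def by blast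
qed

lemma unit_1 [simp]: "unit 1" using is_subringD(1)[OF ring] by (simp add: unit_def)

lemma unit_mult: "unit u \<Longrightarrow> unit v \<Longrightarrow> unit (u * v)"
  using is_subringD(4)[OF ring] by (simp add: unit_def)

lemma unit_inverse: "unit u \<Longrightarrow> unit (inverse u)"
  by (simp add: unit_def)

lemma unit_powi: "unit u \<Longrightarrow> unit (u powi k)"
proof -
  assume u: "unit u"
  have n: "unit (v ^ n)" if "unit v" for v n
    by (induction n) (auto intro: unit_mult that)
  show ?thesis
    using n[OF u] n[OF unit_inverse[OF u]] by (simp add: power_int_def power_inverse)
qed

lemma ex_maximal: "finite X \<Longrightarrow> X \<noteq> {} \<Longrightarrow> \<exists>m\<in>X. \<forall>x\<in>X. le (f x) (f m)"
proof (induction X rule: finite_ne_induct)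
  case (insert x X)
  then obtain m where m: "m \<in> X" "\<forall>x\<in>X. le (f x) (f m)" by blast
  show ?case
  proof (cases "le (f x) (f m)")
    case True
    with m show ?thesis by auto
  next
    case False
    then have "le (f m) (f x)" using le_total by blast
    with m(2) show ?thesis using le_trans le_refl by (intro bexI[of _ x]) blast+
  qed
qed (simp add: le_refl)

text \<open>The distances across a node share one absolute value \<gamma>. It need not drop from a
  node to the next, so binary trees also serve for many equidistant points.\<close>

fun tree_good :: "('b \<Rightarrow> 'f) \<Rightarrow> 'b btree \<Rightarrow> bool" where
  "tree_good u (Tip x) \<longleftrightarrow> True"
| "tree_good u (Node l r) \<longleftrightarrow> tree_good u l \<and> tree_good u r \<and>
     (\<exists>\<gamma>. \<gamma> \<noteq> 0 \<and> (\<forall>a\<in>set (tips l). \<forall>b\<in>set (tips r). eqv (u a - u b) \<gamma>))"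

text \<open>Take a largest distance \<gamma>, attained at \<open>a\<close>, and cut off the open
  ball of radius \<gamma> around \<open>a\<close>. Points outside have distance exactly \<gamma>
  from \<open>a\<close>, hence from the whole ball.\<close>

lemma ex_good_tree:
  assumes "finite L" "L \<noteq> {}" "inj_on u L"
  shows "\<exists>t. set (tips t) = L \<and> distinct (tips t) \<and> tree_good u t"
  using assms
proof (induction "card L" arbitrary: L rule: less_induct)
  case less
  show ?case
  proof (cases "\<exists>x. L = {x}")
    case True
    then obtain x where "L = {x}" by blast
    then show ?thesis by (intro exI[of _ "Tip x"]) auto
  next
    case False
    have "\<exists>m\<in>L \<times> L. \<forall>x\<in>L \<times> L. le (u (fst x) - u (snd x)) (u (fst m) - u (snd m))"
      using less.prems by (intro ex_maximal) auto
    then obtain m where m: "m \<in> L \<times> L" "\<forall>x\<in>L \<times> L. le (u (fst x) - u (snd x)) (u (fst m) - u (snd m))"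
      by blast
    obtain a b where ab: "m = (a, b)" by (cases m)
    define \<gamma> where "\<gamma> = u a - u b"
    have aL: "a \<in> L" "b \<in> L" using m(1) ab by auto
    have mx: "le (u x - u y) \<gamma>" if "x \<in> L" "y \<in> L" for x y
      using bspec[OF m(2), of "(x, y)"] that by (simp add: ab \<gamma>_def)
    have \<gamma>: "\<gamma> \<noteq> 0"
    proof
      assume "\<gamma> = 0"
      obtain x where "x \<in> L" "x \<noteq> a" using False aL(1) by blast
      with mx[of x a] aL(1) \<open>\<gamma> = 0\<close> have "u x = u a" by (simp add: le_0_iff)
      with less.prems(3) \<open>x \<in> L\<close> \<open>x \<noteq> a\<close> aL(1) show False by (auto dest: inj_onD)
    qed
    define L1 where "L1 = {x \<in> L. \<not> le \<gamma> (u x - u a)}"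
    have a1: "a \<in> L1" using aL \<gamma> by (simp add: L1_def le_0_iff)
    have "le \<gamma> (u b - u a)" using le_uminus[OF le_refl, of "u b - u a"] by (simp add: \<gamma>_def)
    then have b2: "b \<in> L - L1" using aL by (simp add: L1_def)
    have sub: "L1 \<subseteq> L" by (auto simp: L1_def)
    have c1: "card L1 < card L"
      by (rule psubset_card_mono) (use less.prems(1) sub b2 in auto)
    have c2: "card (L - L1) < card L"
      by (rule psubset_card_mono) (use less.prems(1) sub a1 in auto)
    obtain l where l: "set (tips l) = L1" "distinct (tips l)" "tree_good u l"
    proof -
      have "finite L1" "L1 \<noteq> {}" "inj_on u L1"
        using less.prems sub a1 by (auto intro: finite_subset inj_on_subset)
      from less.hyps[OF c1 this] that show ?thesis by blast
    qed
    obtain r where r: "set (tips r) = L - L1" "distinct (tips r)" "tree_good u r"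
    proof -
      have "finite (L - L1)" "L - L1 \<noteq> {}" "inj_on u (L - L1)"
        using less.prems b2 by (auto intro: inj_on_subset)
      from less.hyps[OF c2 this] that show ?thesis by blast
    qed
    have "eqv (u x - u y) \<gamma>" if x: "x \<in> L1" and y: "y \<in> L - L1" for x y
    proof -
      have "eqv (u y - u a) \<gamma>" using y mx[of y a] aL by (auto simp: L1_def eqv_def)
      then have "eqv (- (u y - u a)) \<gamma>" by (rule eqv_trans[OF eqv_uminus])
      moreover have "\<not> le \<gamma> (u x - u a)" using x by (simp add: L1_def)
      ultimately have "eqv (- (u y - u a) + (u x - u a)) \<gamma>" by (intro eqv_add_small)
      then show ?thesis by (simp add: algebra_simps)
    qed
    with l r \<gamma> sub show ?thesis by (intro exI[of _ "Node l r"]) auto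
  qed
qed

definition signed :: "('n \<Rightarrow> 'f) \<Rightarrow> 'n \<times> bool \<Rightarrow> 'f" where
  "signed z x = (if snd x then z (fst x) else - z (fst x))"

definition leaves_of :: "'b btree list \<Rightarrow> 'b list" where
  "leaves_of ts = concat (map tips ts)"

lemma leaves_of_simps [simp]: "leaves_of [] = []" "leaves_of (t # ts) = tips t @ leaves_of ts"
  by (auto simp: leaves_of_def)

text \<open>The constant \<gamma> belongs to the trunk vertex of the group and governs exactly the
  pairs that \<open>trunk_rel\<close> counts there.\<close>

fun forest_good :: "('n \<Rightarrow> 'f) \<Rightarrow> ('n \<times> bool) btree list \<Rightarrow> bool" where
  "forest_good z [] \<longleftrightarrow> True"
| "forest_good z (t # ts) \<longleftrightarrow> tree_good (signed z) t \<and> forest_good z ts \<and>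
     (\<exists>\<gamma>. \<gamma> \<noteq> 0 \<and> (\<forall>a\<in>set (tips t). \<forall>b\<in>set (tips t). snd a = snd b \<longrightarrow> eqv (z (fst a) + z (fst b)) \<gamma>) \<and>
        (\<forall>a\<in>set (tips t). \<forall>b\<in>set (leaves_of ts). eqv (z (fst a) + z (fst b)) \<gamma>))"

text \<open>Let \<open>z i0\<close> have maximal absolute value. Its group consists of the indices
  for which \<open>z j\<close> or \<open>- z j\<close> lies in the open ball around
  \<open>z i0\<close> of radius |z i0|, with signs bringing them all into this ball; the other
  indices are treated recursively.\<close>

lemma ex_good_forest:
  assumes two: "unit 2" and z: "\<And>i. z i \<noteq> 0" "\<And>i j. i \<noteq> j \<Longrightarrow> z i + z j \<noteq> 0" "\<And>i j. i \<noteq> j \<Longrightarrow> z i \<noteq> z j"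
    and "finite L"
  shows "\<exists>ts. fst ` set (leaves_of ts) = L \<and> distinct (map fst (leaves_of ts)) \<and> forest_good z ts"
  using \<open>finite L\<close>
proof (induction "card L" arbitrary: L rule: less_induct)
  case less
  show ?case
  proof (cases "L = {}")
    case True
    then show ?thesis by (intro exI[of _ "[]"]) auto
  next
    case False
    then obtain i0 where i0: "i0 \<in> L" "\<And>j. j \<in> L \<Longrightarrow> le (z j) (z i0)"
      using ex_maximal[of L z] less.prems by blast
    define \<gamma> where "\<gamma> = z i0"
    define \<sigma> where "\<sigma> j \<longleftrightarrow> \<not> le \<gamma> (z j - \<gamma>)" for j
    define G where "G = {j \<in> L. \<sigma> j \<or> \<not> le \<gamma> (z j + \<gamma>)}"
    have "\<sigma> i0" using z(1) by (simp add: \<sigma>_def \<gamma>_def le_0_iff)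
    then have i0G: "i0 \<in> G" using i0 by (simp add: G_def)
    have GL: "G \<subseteq> L" by (auto simp: G_def)
    define L' where "L' = (\<lambda>j. (j, \<sigma> j)) ` G"
    have fG: "finite G" using GL less.prems by (rule finite_subset)
    have "inj_on (signed z) L'"
    proof (rule inj_onI)
      fix p q assume "p \<in> L'" "q \<in> L'" and e: "signed z p = signed z q"
      then obtain i j where ij: "p = (i, \<sigma> i)" "q = (j, \<sigma> j)" by (auto simp: L'_def)
      have "z i + z j = 0 \<or> z i = z j"
        using e by (auto simp: ij signed_def eq_neg_iff_add_eq_0 neg_eq_iff_add_eq_0 add.commute split: if_splits)
      then have "i = j" using z(2)[of i j] z(3)[of i j] by blast
      then show "p = q" by (simp add: ij)
    qed
    then obtain t where t: "set (tips t) = L'" "distinct (tips t)" "tree_good (signed z) t"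
      using ex_good_tree[of L' "signed z"] fG i0G by (auto simp: L'_def)
    have "card (L - G) < card L"
      by (rule psubset_card_mono) (use less.prems GL i0G in auto)
    then obtain ts where ts: "fst ` set (leaves_of ts) = L - G" "distinct (map fst (leaves_of ts))" "forest_good z ts"
      using less.hyps[of "L - G"] less.prems by auto
    \<comment> \<open>Within the group, \<open>z i + z j\<close> for equal signs is \<gamma> +
      \<gamma> or its negative up to a smaller term; as 2 is a unit, it keeps the absolute value of
      \<gamma>.\<close>
    have g2: "eqv (2 * \<gamma>) \<gamma>" using unit_eqv[OF two] .
    have g2': "eqv (- (2 * \<gamma>)) \<gamma>" using eqv_trans[OF eqv_uminus g2] .
    have same: "eqv (z i + z j) \<gamma>" if ij: "i \<in> G" "j \<in> G" "\<sigma> i = \<sigma> j" for i j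
    proof (cases "\<sigma> i")
      case True
      then have "\<not> le \<gamma> ((z i - \<gamma>) + (z j - \<gamma>))" using ij(3) by (intro lt_add) (auto simp: \<sigma>_def)
      from eqv_add_small[OF this g2] show ?thesis by (simp add: algebra_simps)
    next
      case False
      then have "\<not> le \<gamma> ((z i + \<gamma>) + (z j + \<gamma>))" using ij by (intro lt_add[of \<gamma> "z i + \<gamma>" "z j + \<gamma>"]) (auto simp: G_def)
      from eqv_add_small[OF this g2'] show ?thesis by (simp add: algebra_simps)
    qed
    \<comment> \<open>The remaining \<open>z j\<close> are close to neither \<gamma> nor its
      negative, so both \<open>z j - \<gamma>\<close> and \<open>z j + \<gamma>\<close> have the
      absolute value of \<gamma>.\<close>
    have lower: "eqv (z i + z j) \<gamma>" if ij: "i \<in> G" "j \<in> L - G" for i j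
    proof -
      have j: "le \<gamma> (z j - \<gamma>)" "le \<gamma> (z j + \<gamma>)" "le (z j) \<gamma>"
        using ij(2) i0(2)[of j] by (auto simp: G_def \<sigma>_def \<gamma>_def)
      then have e: "eqv (z j - \<gamma>) \<gamma>" "eqv (z j + \<gamma>) \<gamma>"
        using le_add[OF j(3) le_refl] le_diff[OF j(3) le_refl] by (auto simp: eqv_def)
      show ?thesis
      proof (cases "\<sigma> i")
        case True
        then have "\<not> le \<gamma> (z i - \<gamma>)" by (simp add: \<sigma>_def)
        from eqv_add_small[OF this e(2)] show ?thesis by (simp add: algebra_simps)
      next
        case False
        then have "\<not> le \<gamma> (z i + \<gamma>)" using ij(1) by (simp add: G_def)
        from eqv_add_small[OF this e(1)] show ?thesis by (simp add: algebra_simps)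
      qed
    qed
    have fstL': "fst ` L' = G" by (auto simp: L'_def image_image)
    have "distinct (map fst (tips t))"
      using t(1,2) by (auto simp: distinct_map inj_on_def L'_def)
    then have "distinct (map fst (leaves_of (t # ts)))" "fst ` set (leaves_of (t # ts)) = L"
      using ts(1,2) t(1) fstL' GL by (auto simp: image_Un)
    moreover have "forest_good z (t # ts)"
    proof -
      have "eqv (z (fst a) + z (fst b)) \<gamma>" if "a \<in> L'" "b \<in> L'" "snd a = snd b" for a b
        using that same by (auto simp: L'_def)
      moreover have "eqv (z (fst a) + z (fst b)) \<gamma>" if "a \<in> L'" "b \<in> set (leaves_of ts)" for a b
        using that lower ts(1) fstL' by (metis imageI)
      moreover have "\<gamma> \<noteq> 0" using z(1) by (simp add: \<gamma>_def)
      ultimately show ?thesis using t ts(3) by auto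
    qed
    ultimately show ?thesis by (intro exI[of _ "t # ts"]) blast
  qed
qed

section \<open>Products of powers of \<open>z i + z j\<close> along a forest\<close>

definition pair_prod :: "('b \<Rightarrow> 'b \<Rightarrow> bool) \<Rightarrow> ('n \<Rightarrow> 'f) \<Rightarrow> ('n \<Rightarrow> 'n \<Rightarrow> int) \<Rightarrow> ('n \<times> 'b) list \<Rightarrow> ('n \<times> 'b) list \<Rightarrow> 'f" where
  "pair_prod R z \<omega> xs ys =
     (\<Prod>a\<leftarrow>xs. \<Prod>b\<leftarrow>ys. if R (snd a) (snd b) then (z (fst a) + z (fst b)) powi \<omega> (fst a) (fst b) else 1)"

lemma prod_list_mult: "(\<Prod>a\<leftarrow>xs. f a * g a) = (\<Prod>a\<leftarrow>xs. f a) * (\<Prod>a\<leftarrow>xs. (g a :: 'z::comm_monoid_mult))"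
  by (induction xs) (auto simp: mult_ac)

lemma pair_prod_simps:
  "pair_prod R z \<omega> (xs @ xs') ys = pair_prod R z \<omega> xs ys * pair_prod R z \<omega> xs' ys"
  "pair_prod R z \<omega> xs (ys @ ys') = pair_prod R z \<omega> xs ys * pair_prod R z \<omega> xs ys'"
  by (auto simp: pair_prod_def prod_list_mult)

lemma pair_prod_swap:
  assumes "\<And>i j. \<omega> i j = \<omega> j i" "\<And>a b. R a b = R b a"
  shows "pair_prod R z \<omega> xs ys = pair_prod R z \<omega> ys xs"
proof (induction xs)
  case Nil
  show ?case by (induction ys) (auto simp: pair_prod_def)
next
  case (Cons x xs)
  have "pair_prod R z \<omega> [x] ys = pair_prod R z \<omega> ys [x]"
  proof -
    have "(if R (snd x) (snd b) then (z (fst x) + z (fst b)) powi \<omega> (fst x) (fst b) else 1) =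
      (if R (snd b) (snd x) then (z (fst b) + z (fst x)) powi \<omega> (fst b) (fst x) else 1)" for b
      by (simp only: assms(1)[of "fst x" "fst b"] assms(2)[of "snd x" "snd b"] add.commute[of "z (fst x)" "z (fst b)"])
    then show ?thesis by (simp only: pair_prod_def list.map prod_list.Cons prod_list.Nil mult_1_right)
  qed
  with Cons show ?case using pair_prod_simps[of R z \<omega> "[x]" xs ys] pair_prod_simps(2)[of R z \<omega> ys "[x]" xs] by simp
qed

lemma pair_prod_split:
  "pair_prod (\<lambda>_ _. True) z \<omega> xs ys = pair_prod (\<noteq>) z \<omega> xs ys * pair_prod (=) z \<omega> xs ys"
  unfolding pair_prod_def
  by (simp flip: prod_list_mult) (auto intro!: arg_cong[of _ _ prod_list] map_cong)

lemma pair_prod_value: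
  assumes "\<gamma> \<noteq> 0" "\<And>a b. a \<in> set xs \<Longrightarrow> b \<in> set ys \<Longrightarrow> R (snd a) (snd b) \<Longrightarrow> eqv (z (fst a) + z (fst b)) \<gamma>"
  shows "\<exists>u. unit u \<and> pair_prod R z \<omega> xs ys = u * \<gamma> powi (pair_sum R \<omega> xs ys)"
proof -
  have lst: "\<exists>u. unit u \<and> (\<Prod>a\<leftarrow>xs. f a) = u * \<gamma> powi (\<Sum>a\<leftarrow>xs. k a)"
    if "\<And>a. a \<in> set xs \<Longrightarrow> \<exists>u. unit u \<and> f a = u * \<gamma> powi (k a)" for xs :: "'z list" and f k
    using that
  proof (induction xs)
    case Nil
    then show ?case using unit_1 by force
  next
    case (Cons a xs)
    then obtain u v where "unit u" "f a = u * \<gamma> powi (k a)" "unit v" "(\<Prod>a\<leftarrow>xs. f a) = v * \<gamma> powi (\<Sum>a\<leftarrow>xs. k a)"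
      by (metis list.set_intros)
    then show ?case using assms(1)
      by (intro exI[of _ "u * v"]) (auto simp: unit_mult power_int_add)
  qed
  show ?thesis
    unfolding pair_prod_def pair_sum_def
  proof (intro lst)
    fix a b assume "a \<in> set xs" "b \<in> set ys"
    show "\<exists>u. unit u \<and> (if R (snd a) (snd b) then (z (fst a) + z (fst b)) powi \<omega> (fst a) (fst b) else 1) =
      u * \<gamma> powi (if R (snd a) (snd b) then \<omega> (fst a) (fst b) else 0)"
    proof (cases "R (snd a) (snd b)")
      case True
      let ?q = "(z (fst a) + z (fst b)) / \<gamma>"
      have "unit ?q" using assms True \<open>a \<in> set xs\<close> \<open>b \<in> set ys\<close> by (intro eqv_unit)
      then have "unit (?q powi \<omega> (fst a) (fst b))" by (rule unit_powi)
      moreover have "(z (fst a) + z (fst b)) powi \<omega> (fst a) (fst b) =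
        ?q powi \<omega> (fst a) (fst b) * \<gamma> powi \<omega> (fst a) (fst b)"
        using assms(1) by (simp flip: power_int_mult_distrib)
      ultimately show ?thesis using True by auto
    qed (auto intro: exI[of _ 1])
  qed
qed

lemma pair_prod_tree:
  assumes "tree_good (signed z) t" "\<And>i j. \<omega> i j = \<omega> j i" "tree_rel \<omega> t"
  shows "unit (pair_prod (\<noteq>) z \<omega> (tips t) (tips t))"
  using assms(1,3)
proof (induction t)
  case (Tip x)
  then show ?case by (simp add: pair_prod_def)
next
  case (Node l r)
  then obtain \<gamma> where g: "\<gamma> \<noteq> 0" "\<And>a b. a \<in> set (tips l) \<Longrightarrow> b \<in> set (tips r) \<Longrightarrow> eqv (signed z a - signed z b) \<gamma>"
    by auto
  \<comment> \<open>For opposite signs the difference of the signed values is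
    \<open>z i + z j\<close> up to sign.\<close>
  have "eqv (z (fst a) + z (fst b)) \<gamma>" if "a \<in> set (tips l)" "b \<in> set (tips r)" "snd a \<noteq> snd b" for a b
  proof (cases "snd a")
    case True
    then show ?thesis using g(2)[OF that(1,2)] that(3) by (simp add: signed_def)
  next
    case False
    then have "eqv (- (z (fst a) + z (fst b))) \<gamma>" using g(2)[OF that(1,2)] that(3) by (simp add: signed_def)
    then show ?thesis using eqv_trans[OF eqv_sym[OF eqv_uminus]] by blast
  qed
  then obtain u where u: "unit u" "pair_prod (\<noteq>) z \<omega> (tips l) (tips r) = u"
    using pair_prod_value[of \<gamma> "tips l" "tips r" "(\<noteq>)" z \<omega>] g(1) Node.prems(2) by auto
  moreover have "pair_prod (\<noteq>) z \<omega> (tips r) (tips l) = pair_prod (\<noteq>) z \<omega> (tips l) (tips r)"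
    by (rule pair_prod_swap) (use assms(2) in auto)
  ultimately show ?case using Node by (simp add: pair_prod_simps unit_mult)
qed

text \<open>Pairs of opposite sign inside a group contribute a unit by
  \<open>pair_prod_tree\<close>. The other pairs at its trunk vertex contribute a unit times a power
  of \<gamma> whose exponent \<open>trunk_rel\<close> makes zero.\<close>

lemma pair_prod_forest:
  assumes "forest_good z ts" and sym: "\<And>i j. \<omega> i j = \<omega> j i"
    and "\<forall>t\<in>set ts. tree_rel \<omega> t" "trunk_rel \<omega> (map tips ts)"
  shows "unit (pair_prod (\<lambda>_ _. True) z \<omega> (leaves_of ts) (leaves_of ts))"
  using assms(1,3,4)
proof (induction ts)
  case Nil
  then show ?case by (simp add: pair_prod_def)
next
  case (Cons t ts)
  let ?F = "pair_prod (\<lambda>_ _. True) z \<omega>" and ?l = "leaves_of ts"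
  obtain \<gamma> where g: "\<gamma> \<noteq> 0"
    "\<And>a b. a \<in> set (tips t) \<Longrightarrow> b \<in> set (tips t) \<Longrightarrow> snd a = snd b \<Longrightarrow> eqv (z (fst a) + z (fst b)) \<gamma>"
    "\<And>a b. a \<in> set (tips t) \<Longrightarrow> b \<in> set ?l \<Longrightarrow> eqv (z (fst a) + z (fst b)) \<gamma>"
  proof -
    from Cons.prems(1) have "\<exists>\<gamma>. \<gamma> \<noteq> 0 \<and> (\<forall>a\<in>set (tips t). \<forall>b\<in>set (tips t). snd a = snd b \<longrightarrow> eqv (z (fst a) + z (fst b)) \<gamma>) \<and>
        (\<forall>a\<in>set (tips t). \<forall>b\<in>set (leaves_of ts). eqv (z (fst a) + z (fst b)) \<gamma>)" by simp
    with that show ?thesis by blast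
  qed
  obtain u where u: "unit u" "pair_prod (=) z \<omega> (tips t) (tips t) = u * \<gamma> powi (same \<omega> (tips t) (tips t))"
    using pair_prod_value[of \<gamma> "tips t" "tips t" "(=)" z \<omega>] g by blast
  obtain v where v: "unit v" "?F (tips t) ?l = v * \<gamma> powi (full \<omega> (tips t) ?l)"
    using pair_prod_value[of \<gamma> "tips t" ?l "\<lambda>_ _. True" z \<omega>] g by blast
  have sw: "?F ?l (tips t) = ?F (tips t) ?l"
    by (rule pair_prod_swap) (use sym in auto)
  have "same \<omega> (tips t) (tips t) + full \<omega> (tips t) ?l + full \<omega> (tips t) ?l = 0"
    using Cons.prems(3) by (simp add: leaves_of_def)
  then have "\<gamma> powi (same \<omega> (tips t) (tips t)) * \<gamma> powi (full \<omega> (tips t) ?l) * \<gamma> powi (full \<omega> (tips t) ?l) = 1"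
    using g(1) by (simp flip: power_int_add)
  then have eq: "pair_prod (=) z \<omega> (tips t) (tips t) * ?F (tips t) ?l * ?F (tips t) ?l = u * v * v"
    unfolding u(2) v(2) by (simp add: mult_ac)
  have 1: "unit (pair_prod (=) z \<omega> (tips t) (tips t) * ?F (tips t) ?l * ?F (tips t) ?l)"
    unfolding eq by (intro unit_mult u(1) v(1))
  have 2: "unit (pair_prod (\<noteq>) z \<omega> (tips t) (tips t))"
    by (rule pair_prod_tree) (use Cons.prems sym in auto)
  have 3: "unit (?F ?l ?l)" using Cons by simp
  have "?F (leaves_of (t # ts)) (leaves_of (t # ts)) =
    pair_prod (\<noteq>) z \<omega> (tips t) (tips t) *
    (pair_prod (=) z \<omega> (tips t) (tips t) * ?F (tips t) ?l * ?F (tips t) ?l) * ?F ?l ?l"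
    by (simp add: pair_prod_simps sw pair_prod_split[of z \<omega> "tips t" "tips t"] mult_ac)
  with unit_mult[OF unit_mult[OF 2 1] 3] show ?case by simp
qed

end

lemma prod_symmetric:
  fixes g :: "'n::{finite,linorder} \<Rightarrow> 'n \<Rightarrow> 'a::comm_monoid_mult"
  assumes "\<And>i j. g i j = g j i"
  shows "(\<Prod>i\<in>UNIV. \<Prod>j\<in>UNIV. g i j) = (\<Prod>(i, j)\<in>sym_entries. if i = j then g i i else g i j * g i j)"
proof -
  let ?D = "{(i, j). i = (j::'n)}" and ?U = "{(i, j). i < (j::'n)}" and ?L = "{(i, j). j < (i::'n)}"
  have "(\<Prod>i\<in>UNIV. \<Prod>j\<in>UNIV. g i j) = prod (\<lambda>(i, j). g i j) UNIV"
    by (simp add: prod.cartesian_product)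
  also have "UNIV = ?D \<union> ?U \<union> ?L" by auto
  also have "prod (\<lambda>(i, j). g i j) (?D \<union> ?U \<union> ?L) = prod (\<lambda>(i, j). g i j) ?D * prod (\<lambda>(i, j). g i j) ?U * prod (\<lambda>(i, j). g i j) ?L"
    by (subst prod.union_disjoint, simp, simp, force)+ simp
  also have "prod (\<lambda>(i, j). g i j) ?L = prod (\<lambda>(i, j). g i j) ?U"
    by (rule prod.reindex_bij_witness[of _ prod.swap prod.swap]) (auto simp: assms)
  also have "prod (\<lambda>(i, j). g i j) ?D * prod (\<lambda>(i, j). g i j) ?U * prod (\<lambda>(i, j). g i j) ?U =
    prod (\<lambda>(i, j). if i = j then g i i else g i j * g i j) ?D * prod (\<lambda>(i, j). if i = j then g i i else g i j * g i j) ?U"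
    by (simp add: mult.assoc flip: prod.distrib) (intro arg_cong2[of _ _ _ _ "(*)"] prod.cong, auto)
  also have "\<dots> = prod (\<lambda>(i, j). if i = j then g i i else g i j * g i j) (?D \<union> ?U)"
    by (rule prod.union_disjoint[symmetric]) auto
  also have "?D \<union> ?U = sym_entries" by (auto simp: sym_entries_def)
  finally show ?thesis .
qed

text \<open>For a weight satisfying the relations, the product of all
  \<open>a (i, j) powi \<omega> i j\<close> is a unit: the factors \<open>x i * x j\<close> cancel
  by the row sums, and the factors \<open>z i + z j\<close> combine to a unit along the forest. But
  it is a Laurent monomial in the entries from \<open>S\<close>, so the separating valuation forces
  its exponents to vanish.\<close>

lemma integral_forest:
  fixes S :: "('n::{finite,linorder} \<times> 'n) set"
  assumes ind: "alg_indep (sym_rank_le_2 :: ('k::{alg_closed_field,field_char_0}^'n::{finite,linorder}^'n::{finite,linorder}) set) S"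
    and S: "S \<subseteq> sym_entries"
  shows "\<exists>ts :: ('n \<times> bool) btree list.
    set (map fst (concat (map tips ts))) = UNIV \<and> distinct (map fst (concat (map tips ts))) \<and>
    (\<forall>\<omega> :: 'n \<Rightarrow> 'n \<Rightarrow> int. row_rel S \<omega> \<longrightarrow> (\<forall>t\<in>set ts. tree_rel \<omega> t) \<longrightarrow> trunk_rel \<omega> (map tips ts) \<longrightarrow> \<omega> = (\<lambda>_ _. 0))"
proof -
  from generic_point[OF ind] obtain x y :: "'n \<Rightarrow> 'k rat_fun" where
    gen: "(\<forall>p\<in>mpolys_on S. p \<noteq> 0 \<longrightarrow> eval_over const_fun (\<lambda>(i, j). x i * y j + x j * y i) p \<noteq> 0) \<and>
    (\<forall>i j. x i \<noteq> 0 \<and> y i \<noteq> 0 \<and> x i * y j + x j * y i \<noteq> 0 \<and> (i \<noteq> j \<longrightarrow> x i * y j - x j * y i \<noteq> 0))"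
    by (elim exE) (rule that)
  note ev = gen[THEN conjunct1, rule_format]
  have xyn: "x i \<noteq> 0" "y i \<noteq> 0" "x i * y j + x j * y i \<noteq> 0" "i \<noteq> j \<Longrightarrow> x i * y j - x j * y i \<noteq> 0" for i j
    using gen[THEN conjunct2, rule_format, of i j] by simp_all
  define a where "a = (\<lambda>(i, j). x i * y j + x j * y i)"
  have anz: "a s \<noteq> 0" for s by (cases s) (simp add: a_def xyn(3))
  have aind: "eval_over const_fun a p \<noteq> 0" if "p \<in> mpolys_on S" "p \<noteq> 0" for p
    unfolding a_def using ev[OF that] .
  interpret independent_family const_fun S a
    by (rule independent_family.intro) (rule const_fun_hom finite anz aind; assumption?)+
  from separating_valuation obtain A where
    "is_subring A \<and> range const_fun \<subseteq> A \<and> (\<forall>x. x \<noteq> 0 \<longrightarrow> x \<in> A \<or> inverse x \<in> A) \<and>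
      (\<forall>c. laurent S a c \<in> A \<and> inverse (laurent S a c) \<in> A \<longrightarrow> (\<forall>s\<in>S. c s = 0))"
    by (elim exE) (rule that)
  then have A: "is_subring A" "range const_fun \<subseteq> A" "\<forall>x. x \<noteq> 0 \<longrightarrow> x \<in> A \<or> inverse x \<in> A"
    and sep: "\<forall>c. laurent S a c \<in> A \<and> inverse (laurent S a c) \<in> A \<longrightarrow> (\<forall>s\<in>S. c s = 0)" by simp_all
  interpret valuation_ring A by (rule valuation_ring.intro) (use A(1,3) in blast)+
  \<comment> \<open>Constants lie in the valuation ring together with their inverses, so 2 is a
    unit.\<close>
  have c2: "const_fun (2::'k) = 2" using const_fun_hom(3)[of 1 "1::'k"] by simp
  have "const_fun (2 * inverse (2::'k)) = 1" by simp
  then have inv: "2 * const_fun (inverse (2::'k)) = 1" by (simp only: const_fun_hom(4) c2)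
  then have "inverse 2 = const_fun (inverse (2::'k))" by (rule inverse_unique)
  moreover have "(2 :: 'k rat_fun) \<noteq> 0" using inv by auto
  moreover have "const_fun c \<in> A" for c using A(2) by blast
  ultimately have two: "unit 2" unfolding unit_def by (metis c2)
  define z where "z i = y i / x i" for i
  have az: "x i * y j + x j * y i = x i * x j * (z i + z j)" for i j
    using xyn(1) by (simp add: z_def field_simps)
  have zs: "z i + z j \<noteq> 0" for i j using xyn(3)[of i j] by (auto simp: az)
  have zd: "z i \<noteq> z j" if "i \<noteq> j" for i j using xyn(4)[OF that] xyn(1) by (auto simp: z_def field_simps)
  have z0: "z i \<noteq> 0" for i using xyn(1,2) by (simp add: z_def)
  have "\<exists>ts. fst ` set (leaves_of ts) = UNIV \<and> distinct (map fst (leaves_of ts)) \<and> forest_good z ts"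
    by (rule ex_good_forest) (simp_all add: two z0 zs zd)
  then obtain ts where ts: "fst ` set (leaves_of ts) = UNIV" "distinct (map fst (leaves_of ts))" "forest_good z ts"
    by (elim exE conjE) (rule that)
  have "\<omega> = (\<lambda>_ _. 0)" if w: "row_rel S \<omega>" "\<forall>t\<in>set ts. tree_rel \<omega> t" "trunk_rel \<omega> (map tips ts)"
    for \<omega> :: "'n \<Rightarrow> 'n \<Rightarrow> int"
  proof -
    have sym: "\<omega> i j = \<omega> j i" and supp: "i \<le> j \<Longrightarrow> (i, j) \<notin> S \<Longrightarrow> \<omega> i j = 0" and row: "(\<Sum>j\<in>UNIV. \<omega> i j) = 0" for i j
      using w(1) unfolding row_rel_def by blast+
    \<comment> \<open>Off-diagonal exponents are doubled because the product over all ordered pairs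
      meets each such entry twice.\<close>
    define c where "c = (\<lambda>(i, j). if i = j then \<omega> i i else \<omega> i j + \<omega> i j)"
    have powsum: "(\<Prod>j\<in>J. u powi k j) = u powi (\<Sum>j\<in>J. k j)" if "u \<noteq> 0" for u :: "'k rat_fun" and k :: "'n \<Rightarrow> int" and J
      by (induction J rule: infinite_finite_induct) (auto simp: power_int_add that)
    have dbl: "u powi (2 * k) = u powi k * u powi k" if "u \<noteq> 0" for u :: "'k rat_fun" and k
      using power_int_add[of u k k] that by simp
    have "laurent S a c = (\<Prod>s\<in>sym_entries. a s powi c s)"
      unfolding laurent_def
      by (rule prod.mono_neutral_left) (use S supp in \<open>auto simp: c_def sym_entries_def\<close>)
    also have "\<dots> = (\<Prod>(i, j)\<in>sym_entries. if i = j then a (i, i) powi \<omega> i i else a (i, j) powi \<omega> i j * a (i, j) powi \<omega> i j)"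
      by (rule prod.cong) (auto simp: c_def a_def dbl xyn(3))
    also have "\<dots> = (\<Prod>i\<in>UNIV. \<Prod>j\<in>UNIV. a (i, j) powi \<omega> i j)"
      by (rule prod_symmetric[symmetric]) (auto simp: a_def sym add.commute mult.commute)
    also have "\<dots> = (\<Prod>i\<in>UNIV. \<Prod>j\<in>UNIV. x i powi \<omega> i j) * (\<Prod>i\<in>UNIV. \<Prod>j\<in>UNIV. x j powi \<omega> i j) *
        (\<Prod>i\<in>UNIV. \<Prod>j\<in>UNIV. (z i + z j) powi \<omega> i j)"
      by (simp add: a_def az power_int_mult_distrib flip: prod.distrib)
    also have "(\<Prod>i\<in>UNIV. \<Prod>j\<in>UNIV. x i powi \<omega> i j) = 1"
      by (simp add: powsum xyn(1) row)
    also have "(\<Prod>i\<in>UNIV. \<Prod>j\<in>UNIV. x j powi \<omega> i j) = (\<Prod>j\<in>UNIV. \<Prod>i\<in>UNIV. x j powi \<omega> j i)"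
      by (subst prod.swap) (simp add: sym)
    also have "\<dots> = 1" by (simp add: powsum xyn(1) row)
    also have "(\<Prod>i\<in>UNIV. \<Prod>j\<in>UNIV. (z i + z j) powi \<omega> i j) = pair_prod (\<lambda>_ _. True) z \<omega> (leaves_of ts) (leaves_of ts)"
    proof -
      have U: "set (map fst (leaves_of ts)) = UNIV" using ts(1) by simp
      have p: "(\<Prod>i\<in>UNIV. f i) = (\<Prod>b\<leftarrow>leaves_of ts. f (fst b))" for f :: "'n \<Rightarrow> 'k rat_fun"
        using prod.distinct_set_conv_list[OF ts(2), of f] U by (simp add: o_def)
      show ?thesis unfolding pair_prod_def by (simp add: p)
    qed
    finally have "laurent S a c = pair_prod (\<lambda>_ _. True) z \<omega> (leaves_of ts) (leaves_of ts)" by simp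
    with pair_prod_forest[OF ts(3) sym w(2,3)] have "unit (laurent S a c)" by simp
    then have c0: "\<forall>s\<in>S. c s = 0" using spec[OF sep, of c] by (simp add: unit_def)
    have "\<omega> i j = 0" if "i \<le> j" for i j
      using c0 supp[OF that] by (cases "(i, j) \<in> S") (auto simp: c_def split: if_splits)
    then have "\<omega> i j = 0" for i j using sym[of i j] by (cases "i \<le> j") auto
    then show ?thesis by blast
  qed
  then show ?thesis using ts(1,2) by (intro exI[of _ ts]) (auto simp: leaves_of_def)
qed

section \<open>From integral to real relations\<close>

text \<open>A linear functional over the rationals, coming from a Hamel basis of the reals that
  contains \<open>r\<close>.\<close>

lemma additive_functional:
  fixes r :: real
  assumes "r \<noteq> 0"
  shows "\<exists>f :: real \<Rightarrow> rat. f 0 = 0 \<and> (\<forall>x y. f (x + y) = f x + f y) \<and> f r \<noteq> 0"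
proof -
  interpret vector_space_pair "\<lambda>q x. of_rat q * (x :: real)" "(*) :: rat \<Rightarrow> rat \<Rightarrow> rat"
    by unfold_locales (auto simp: algebra_simps of_rat_add of_rat_mult)
  have "vs1.independent {r}" using assms by (simp add: vs1.dependent_single)
  from linear_independent_extend[OF this, of "\<lambda>_. 1"] obtain g where
    g: "Vector_Spaces.linear (\<lambda>q x. of_rat q * (x :: real)) (*) g" "g r = 1" by auto
  interpret g: Vector_Spaces.linear "\<lambda>q x. of_rat q * (x :: real)" "(*) :: rat \<Rightarrow> rat \<Rightarrow> rat" g by (rule g(1))
  show ?thesis using g.zero g.add g(2) by (intro exI[of _ g]) auto
qed

lemma common_denominator:
  assumes "finite (X :: rat set)"
  shows "\<exists>N::int. N \<noteq> 0 \<and> (\<forall>q\<in>X. of_int N * q \<in> \<int>)"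
  using assms
proof (induction X)
  case empty
  then show ?case by (intro exI[of _ 1]) auto
next
  case (insert q X)
  then obtain N :: int where N: "N \<noteq> 0" "\<forall>q\<in>X. of_int N * q \<in> \<int>" by blast
  obtain a b where "quotient_of q = (a, b)" by (cases "quotient_of q")
  then have q: "q = of_int a / of_int b" "b > 0"
    by (auto dest: quotient_of_div quotient_of_denom_pos)
  have "of_int b * q \<in> \<int>" using q by simp
  moreover have "of_int (b * N) * p = of_int b * (of_int N * p)" "of_int (b * N) * p = of_int N * (of_int b * p)" for p :: rat
    by simp_all
  ultimately show ?case using N q(2) by (intro exI[of _ "b * N"]) (metis Ints_mult Ints_of_int insert_iff mult_eq_0_iff less_irrefl)
qed

text \<open>A nonzero real weight has a nonzero entry. Applying to all entries a rational functional
  that does not kill this one, and clearing denominators, gives a nonzero integral weight with the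
  same relations.\<close>

lemma integral_to_real:
  fixes S :: "('n::{finite,linorder} \<times> 'n) set"
  assumes int: "\<And>\<omega> :: 'n \<Rightarrow> 'n \<Rightarrow> int. row_rel S \<omega> \<Longrightarrow> \<forall>t\<in>set ts. tree_rel \<omega> t \<Longrightarrow> trunk_rel \<omega> xss \<Longrightarrow> \<omega> = (\<lambda>_ _. 0)"
    and w: "row_rel S \<omega>" "\<forall>t\<in>set ts. tree_rel \<omega> t" "trunk_rel \<omega> xss"
  shows "\<omega> = (\<lambda>_ _. 0 :: real)"
proof (rule ccontr)
  assume "\<omega> \<noteq> (\<lambda>_ _. 0)"
  then obtain i j where ij: "\<omega> i j \<noteq> 0" by (meson ext)
  obtain f :: "real \<Rightarrow> rat" where f: "f 0 = 0" "\<And>x y. f (x + y) = f x + f y" "f (\<omega> i j) \<noteq> 0"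
    using additive_functional[OF ij] by auto
  obtain N :: int where N: "N \<noteq> 0" "\<And>i j. of_int N * f (\<omega> i j) \<in> \<int>"
    using common_denominator[of "(\<lambda>(i, j). f (\<omega> i j)) ` UNIV"] by auto
  define h where "h x = of_int N * f x" for x
  have h: "h 0 = 0" "\<And>x y. h (x + y) = h x + h y" by (auto simp: h_def f algebra_simps)
  define \<omega>' where "\<omega>' i j = \<lfloor>h (\<omega> i j)\<rfloor>" for i j
  have w': "h (\<omega> i j) = rat_of_int (\<omega>' i j)" for i j
    using N(2)[of i j] by (simp add: \<omega>'_def h_def)
  have "row_rel S (\<lambda>i j. rat_of_int (\<omega>' i j))" "\<forall>t\<in>set ts. tree_rel (\<lambda>i j. rat_of_int (\<omega>' i j)) t"
    "trunk_rel (\<lambda>i j. rat_of_int (\<omega>' i j)) xss"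
    using row_rel_hom[of h, OF h w(1)] tree_rel_hom[of h \<omega>, OF h] w(2) trunk_rel_hom[of h, OF h w(3)]
    unfolding w' by auto
  then have "row_rel S \<omega>'" "\<forall>t\<in>set ts. tree_rel \<omega>' t" "trunk_rel \<omega>' xss"
    using row_rel_hom_inj[of rat_of_int S \<omega>'] tree_rel_hom_inj[of rat_of_int \<omega>'] trunk_rel_hom_inj[of rat_of_int \<omega>' xss]
    by auto
  from int[OF this] have "h (\<omega> i j) = 0" by (simp add: w')
  with N(1) f(3) show False by (simp add: h_def)
qed

text \<open>Row and trunk relations depend only on the leaf sets of the trees, so they stay fixed in
  the space \<open>R\<close> while the trees become caterpillars. The groups are made valid only
  afterwards, since this changes the trunk.\<close>

lemma caterpillar_structure:
  fixes S :: "('n::{finite,linorder} \<times> 'n) set"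
  assumes ind: "alg_indep (sym_rank_le_2 :: ('k::{alg_closed_field,field_char_0}^'n::{finite,linorder}^'n::{finite,linorder}) set) S"
    and S: "S \<subseteq> sym_entries"
  shows "\<exists>gs :: ('n \<times> bool) list list.
    set (map fst (concat gs)) = UNIV \<and> distinct (map fst (concat gs)) \<and> (\<forall>g\<in>set gs. valid_group g) \<and>
    (\<forall>\<omega> :: 'n \<Rightarrow> 'n \<Rightarrow> real. row_rel S \<omega> \<longrightarrow> (\<forall>g\<in>set gs. list_rel \<omega> g) \<longrightarrow> trunk_rel \<omega> gs \<longrightarrow> \<omega> = (\<lambda>_ _. 0))"
proof -
  obtain ts :: "('n \<times> bool) btree list" where
    ts: "set (map fst (concat (map tips ts))) = UNIV" "distinct (map fst (concat (map tips ts)))"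
    and int: "\<And>\<omega> :: 'n \<Rightarrow> 'n \<Rightarrow> int. row_rel S \<omega> \<Longrightarrow> \<forall>t\<in>set ts. tree_rel \<omega> t \<Longrightarrow> trunk_rel \<omega> (map tips ts) \<Longrightarrow> \<omega> = (\<lambda>_ _. 0)"
    using integral_forest[OF assms] by blast
  define R where "R = {\<omega> :: 'n \<Rightarrow> 'n \<Rightarrow> real. row_rel S \<omega> \<and> trunk_rel \<omega> (map tips ts)}"
  have "linear_closed R" by (auto simp: linear_closed_def R_def row_rel_linear trunk_rel_linear)
  moreover have "\<omega> i j = \<omega> j i" if "\<omega> \<in> R" for \<omega> i j
    using that unfolding R_def row_rel_def by blast
  moreover have "\<omega> = (\<lambda>_ _. 0)" if "\<omega> \<in> R" "\<forall>t\<in>set ts. tree_rel \<omega> t" for \<omega>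
    using integral_to_real[of S ts "map tips ts" \<omega>] int that unfolding R_def by blast
  ultimately have "\<exists>xss. map mset xss = map (mset \<circ> tips) ts \<and>
    (\<forall>\<omega>\<in>R. (\<forall>xs\<in>set xss. list_rel \<omega> xs) \<longrightarrow> \<omega> = (\<lambda>_ _. 0))"
    by (rule caterpillar_forest)
  then obtain xss where xss: "map mset xss = map (mset \<circ> tips) ts"
    "\<And>\<omega>. \<omega> \<in> R \<Longrightarrow> \<forall>xs\<in>set xss. list_rel \<omega> xs \<Longrightarrow> \<omega> = (\<lambda>_ _. 0)" by blast
  have mm: "map mset xss = map mset (map tips ts)" using xss(1) by simp
  have ne: "\<forall>xs\<in>set xss. xs \<noteq> []"
  proof
    fix xs assume "xs \<in> set xss"
    then have "mset xs \<in> set (map mset xss)" by simp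
    then show "xs \<noteq> []" unfolding xss(1) by auto
  qed
  obtain gs where gs: "mset (concat gs) = mset (concat xss)" "\<forall>g\<in>set gs. valid_group g"
    "\<And>\<omega> :: 'n \<Rightarrow> 'n \<Rightarrow> real. \<forall>i j. \<omega> i j = \<omega> j i \<Longrightarrow> trunk_rel \<omega> gs \<Longrightarrow> \<forall>g\<in>set gs. list_rel \<omega> g \<Longrightarrow>
      trunk_rel \<omega> xss \<and> (\<forall>xs\<in>set xss. list_rel \<omega> xs)"
    using refine_to_valid_groups[OF ne] by metis
  have "mset (concat gs) = mset (concat (map tips ts))"
    using gs(1) mm by (simp add: mset_concat)
  then have m: "mset (map fst (concat gs)) = mset (map fst (concat (map tips ts)))" by (metis mset_map)
  have "\<omega> = (\<lambda>_ _. 0)" if w: "row_rel S \<omega>" "\<forall>g\<in>set gs. list_rel \<omega> g" "trunk_rel \<omega> gs" for \<omega> :: "'n \<Rightarrow> 'n \<Rightarrow> real"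
  proof -
    have "\<forall>i j. \<omega> i j = \<omega> j i" using w(1) unfolding row_rel_def by blast
    from gs(3)[OF this w(3,2)] have "trunk_rel \<omega> xss" "\<forall>xs\<in>set xss. list_rel \<omega> xs" by auto
    moreover from this(1) have "trunk_rel \<omega> (map tips ts)" using trunk_rel_mset[OF mm] by blast
    ultimately show ?thesis using xss(2)[of \<omega>] w(1) by (simp add: R_def)
  qed
  then have "\<forall>\<omega> :: 'n \<Rightarrow> 'n \<Rightarrow> real. row_rel S \<omega> \<longrightarrow> (\<forall>g\<in>set gs. list_rel \<omega> g) \<longrightarrow> trunk_rel \<omega> gs \<longrightarrow> \<omega> = (\<lambda>_ _. 0)"
    by simp
  moreover have "set (map fst (concat gs)) = UNIV" using mset_eq_setD[OF m] ts(1) by simp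
  moreover have "distinct (map fst (concat gs))" using mset_eq_imp_distinct_iff[OF m] ts(2) by simp
  ultimately show ?thesis using gs(2) by (intro exI[of _ gs] conjI)
qed

section \<open>Rooted symbic trees\<close>

locale symbic =
  fixes T :: "('v, 'n::finite) labelled_tree"
  assumes symbic: "symbic_tree T"
begin

text \<open>The root is the vertex from which \<open>tree_matrix\<close> measures. As the involution
  fixes it, ancestors are carried to ancestors.\<close>

definition root :: 'v where "root = base_vertex T"
definition P :: "'v \<Rightarrow> 'v list" where "P v = tree_path T root v"
definition par :: "'v \<Rightarrow> 'v" where "par v = last (butlast (P v))"
abbreviation inv :: "'v \<Rightarrow> 'v" where "inv \<equiv> invol T"
abbreviation lu :: "'n \<Rightarrow> 'v" where "lu i \<equiv> leaf T (Unprimed i)"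
abbreviation lp :: "'n \<Rightarrow> 'v" where "lp i \<equiv> leaf T (Primed i)"

lemma tree_T: "is_tree (verts T) (edges T)"
  and leaf_bij: "bij_betw (leaf T) UNIV (leaves T)"
  and invV [simp]: "v \<in> verts T \<Longrightarrow> inv v \<in> verts T"
  and inv_inv [simp]: "v \<in> verts T \<Longrightarrow> inv (inv v) = v"
  and inv_edge: "u \<in> verts T \<Longrightarrow> v \<in> verts T \<Longrightarrow> {inv u, inv v} \<in> edges T \<longleftrightarrow> {u, v} \<in> edges T"
  and inv_leaf: "inv (leaf T x) = leaf T (prime_swap x)"
  and trunk_path: "\<exists>p. is_path (verts T) (edges T) p \<and> set p = trunk T"
  and valency_2: "v \<in> verts T \<Longrightarrow> valency T v = 2 \<Longrightarrow> trunk T = {v}"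
  and split_colors: "Q \<in> splits T \<Longrightarrow> A \<in> Q \<Longrightarrow> (\<exists>i. Unprimed i \<in> A) \<and> (\<exists>j. Primed j \<in> A)"
  using symbic unfolding symbic_tree_def by simp_all

lemma root_trunk: "root \<in> trunk T"
proof -
  obtain p where "is_path (verts T) (edges T) p" "set p = trunk T" using trunk_path by blast
  then have "trunk T \<noteq> {}" by (auto simp: is_path_def)
  then show ?thesis unfolding root_def base_vertex_def by (simp add: some_in_eq)
qed

lemma root_V [simp]: "root \<in> verts T" and inv_root [simp]: "inv root = root"
  using root_trunk by (auto simp: trunk_def)

lemma P_eq: "P = (\<lambda>v. THE p. path_between (verts T) (edges T) root p v)"
  by (auto simp: P_def tree_path_def)

sublocale rtree "verts T" root par P
  using is_tree_rtree(1)[OF tree_T root_V] unfolding par_def[abs_def] P_eq .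

lemma E_edges: "E = edges T"
  using is_tree_rtree(2)[OF tree_T root_V] unfolding par_def[abs_def] P_eq .

lemma inv_inj: "u \<in> verts T \<Longrightarrow> v \<in> verts T \<Longrightarrow> inv u = inv v \<longleftrightarrow> u = v"
  by (metis inv_inv)

lemma inv_root_iff [simp]: "v \<in> verts T \<Longrightarrow> inv v = root \<longleftrightarrow> v = root"
  using inv_inj[of v root] by simp

text \<open>An automorphism fixing the root maps root paths to root paths, and these are
  unique.\<close>

lemma P_inv: "v \<in> verts T \<Longrightarrow> P (inv v) = map inv (P v)"
proof -
  assume v: "v \<in> verts T"
  have p: "path_between (verts T) E root (P v) v" using path_P[OF v] .
  have "successively (\<lambda>u v. {u, v} \<in> E) (map inv (P v))"
    unfolding successively_map
    by (rule successively_mono[OF path_betweenD(4)[OF p]])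
       (use subsetD[OF set_P[OF v]] inv_edge in \<open>simp add: E_edges\<close>)
  moreover have "inj_on inv (set (P v))"
    using set_P[OF v] inv_inj by (auto simp: inj_on_def)
  ultimately have "path_between (verts T) E root (map inv (P v)) (inv v)"
    using v set_P[OF v] distinct_P[OF v]
    by (auto simp: path_between_def is_path_def distinct_map hd_map last_map)
  then show ?thesis by (simp add: path_r_iff)
qed

lemma par_inv: "v \<in> verts T \<Longrightarrow> v \<noteq> root \<Longrightarrow> par (inv v) = inv (par v)"
proof -
  assume v: "v \<in> verts T" "v \<noteq> root"
  have "P (inv v) = map inv (P v)" using v by (intro P_inv)
  also have "P v = P (par v) @ [v]" using v by (intro P_step)
  finally have "P (inv v) = map inv (P (par v)) @ [inv v]" by simp
  then have "par (inv v) = last (map inv (P (par v)))" by (simp add: par_def)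
  then show ?thesis using v parV by (simp add: last_map)
qed

lemma inv_desc: "v \<in> verts T \<Longrightarrow> w \<in> desc v \<Longrightarrow> inv w \<in> desc (inv v)"
  by (auto simp: desc_def P_inv)

lemma inv_children: "w \<in> children v \<Longrightarrow> inv w \<in> children (inv v)"
  by (auto simp: children_def par_inv)

lemma children_V: "w \<in> children v \<Longrightarrow> v \<in> verts T" "w \<in> children v \<Longrightarrow> w \<in> verts T"
  using parV by (auto simp: children_def)

lemma fin_children: "finite (children v)"
  using finV by (simp add: children_def)

lemma valency_eq: "v \<in> verts T \<Longrightarrow> valency T v = card (children v) + (if v = root then 0 else 1)"
  using card_edges unfolding valency_def E_edges by simp

lemma leaf_in: "leaf T x \<in> leaves T" and leaf_V [simp]: "leaf T x \<in> verts T"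
  using leaf_bij by (auto simp: bij_betw_def leaves_def)

lemma leaf_inj: "leaf T x = leaf T y \<longleftrightarrow> x = y"
  using leaf_bij by (auto simp: bij_betw_def inj_on_def)

lemma leaf_not_fixed: "v \<in> leaves T \<Longrightarrow> inv v \<noteq> v"
proof -
  assume "v \<in> leaves T"
  then obtain x where "v = leaf T x" using leaf_bij by (auto simp: bij_betw_def)
  moreover have "prime_swap x \<noteq> x" by (cases x) auto
  ultimately show ?thesis by (simp add: inv_leaf leaf_inj)
qed

lemma leaf_not_trunk: "v \<in> leaves T \<Longrightarrow> v \<notin> trunk T"
  using leaf_not_fixed by (auto simp: trunk_def)

lemma root_not_leaf: "root \<notin> leaves T"
  using leaf_not_fixed by fastforce

lemma leaf_neq_root [simp]: "leaf T x \<noteq> root"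
  using leaf_in root_not_leaf by metis

lemma leaf_iff: "v \<in> leaves T \<longleftrightarrow> v \<in> verts T \<and> v \<noteq> root \<and> children v = {}"
proof
  assume v: "v \<in> leaves T"
  then have "v \<in> verts T" "v \<noteq> root" "valency T v = 1" using root_not_leaf by (auto simp: leaves_def)
  with valency_eq[of v] fin_children[of v] show "v \<in> verts T \<and> v \<noteq> root \<and> children v = {}" by simp
next
  assume "v \<in> verts T \<and> v \<noteq> root \<and> children v = {}"
  with valency_eq[of v] show "v \<in> leaves T" by (simp add: leaves_def)
qed

lemma par_not_leaf: "w \<in> children v \<Longrightarrow> v \<notin> leaves T"
  by (auto simp: leaf_iff)

lemma desc_leaf: "v \<in> leaves T \<Longrightarrow> desc v = {v}"
proof -
  assume v: "v \<in> leaves T"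
  have "w = v" if "w \<in> desc v" for w
    using desc_child[OF that] v by (auto simp: leaf_iff)
  then show ?thesis using v by (auto simp: desc_def leaf_iff)
qed

lemma leaf_below:
  assumes "v \<in> verts T"
  shows "\<exists>x. leaf T x \<in> desc v"
proof -
  let ?L = "(\<lambda>w. length (P w)) ` desc v"
  have fin: "finite (desc v)" using finV by (simp add: desc_def)
  have "v \<in> desc v" using assms by (simp add: desc_def)
  then have "Max ?L \<in> ?L" using fin by (intro Max_in) auto
  then obtain w where w: "w \<in> desc v" "Max ?L = length (P w)" by blast
  have mx: "length (P u) \<le> length (P w)" if "u \<in> desc v" for u
    using that fin by (simp flip: w(2))
  have wV: "w \<in> verts T" using w(1) by (simp add: desc_def)
  have nochild: "u \<notin> children w" for u
  proof
    assume u: "u \<in> children w"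
    then have "u \<in> desc v" using w(1) children_V[OF u] by (auto simp: desc_def children_def P_step)
    with mx[of u] u show False by (simp add: children_def P_step)
  qed
  have "w \<noteq> root"
  proof
    assume "w = root"
    have "lu i \<in> desc root" for i using r_in_P by (simp add: desc_def)
    from desc_child[OF this] nochild \<open>w = root\<close> leaf_neq_root show False by blast
  qed
  then have "w \<in> leaves T" using nochild wV by (auto simp: leaf_iff)
  then obtain x where "w = leaf T x" using leaf_bij by (auto simp: bij_betw_def)
  with w(1) show ?thesis by blast
qed

definition internal :: "'v set" where "internal = verts T - leaves T"

lemma internal_inv: "v \<in> internal \<Longrightarrow> inv v \<in> internal"
proof -
  assume v: "v \<in> internal"
  then have vV: "v \<in> verts T" by (simp add: internal_def)
  show ?thesis
  proof (cases "v = root")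
    case False
    with v obtain w where "w \<in> children v" by (auto simp: internal_def leaf_iff)
    from par_not_leaf[OF inv_children[OF this]] vV show ?thesis by (simp add: internal_def)
  qed (use v in simp)
qed

lemma par_internal: "v \<in> verts T \<Longrightarrow> v \<noteq> root \<Longrightarrow> par v \<in> internal"
  using par_not_leaf[of v "par v"] parV by (auto simp: internal_def children_def)

lemma two_children:
  assumes "v \<in> internal" "v \<noteq> root"
  shows "card (children v) \<ge> 2"
proof -
  have v: "v \<in> verts T" using assms by (simp add: internal_def)
  have "valency T v \<noteq> 1" using assms by (auto simp: internal_def leaves_def)
  moreover have "valency T v \<noteq> 2" using valency_2[OF v] root_trunk assms(2) by auto
  moreover have "card (children v) \<noteq> 0" using assms v fin_children by (auto simp: internal_def leaf_iff)
  ultimately show ?thesis using valency_eq[OF v] assms(2) by simp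
qed

lemma internal_edges_eq: "internal_edges T = (\<lambda>v. {v, par v}) ` (internal - {root})"
proof -
  have "{v, par v} \<inter> leaves T = {} \<longleftrightarrow> v \<notin> leaves T" if "v \<in> verts T" "v \<noteq> root" for v
    using par_internal[OF that] by (auto simp: internal_def)
  then show ?thesis
    unfolding internal_edges_def E_edges[symmetric] E_def by (auto simp: internal_def)
qed

text \<open>The leaves below \<open>v\<close> form one side of the split at the edge above
  \<open>v\<close>.\<close>

lemma colors_below:
  assumes "v \<in> internal" "v \<noteq> root"
  shows "\<exists>i. lu i \<in> desc v" "\<exists>i. lp i \<in> desc v"
proof -
  have v: "v \<in> verts T" using assms by (simp add: internal_def)
  let ?e = "{v, par v}"
  have "?e \<in> internal_edges T" using assms internal_edges_eq by blast
  then have "split T ?e \<in> splits T" by (simp add: splits_def)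
  moreover have "side T ?e v = desc v"
    using side_child[OF v assms(2)] unfolding side_def E_edges by simp
  then have "{x. leaf T x \<in> desc v} \<in> split T ?e" by (auto simp: split_def)
  ultimately show "\<exists>i. lu i \<in> desc v" "\<exists>i. lp i \<in> desc v" using split_colors by blast+
qed

lemma trunk_par: "t \<in> trunk T \<Longrightarrow> t \<noteq> root \<Longrightarrow> par t \<in> trunk T"
  using par_inv[of t] parV[of t] by (auto simp: trunk_def)

text \<open>An edge joining two nonconsecutive vertices of a path would be a second path between
  them.\<close>

lemma path_adjacent:
  assumes p: "is_path (verts T) (edges T) p" and ij: "i < j" "j < length p" and e: "{p ! i, p ! j} \<in> edges T"
  shows "j = Suc i"
proof -
  let ?q = "take (Suc j - i) (drop i p)"
  have len: "length ?q = Suc j - i" using ij by simp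
  have "path_between (verts T) (edges T) (hd p) p (last p)" using p by (simp add: path_between_def)
  then have "path_between (verts T) (edges T) (hd p) ((take i p @ ?q) @ drop (Suc j) p) (last p)"
    using ij by (simp add: take_add[symmetric] flip: take_add)
  then have "path_between (verts T) (edges T) (hd p) (take i p @ ?q) (last (take i p @ ?q))"
    by (rule path_between_prefix) (use ij in auto)
  then have "path_between (verts T) (edges T) (hd ?q) ?q (last (take i p @ ?q))"
    by (rule path_between_suffix) (use ij in auto)
  moreover have "hd ?q = p ! i" using ij by (simp add: hd_conv_nth)
  moreover have "last (take i p @ ?q) = p ! j"
    using ij by (simp add: last_append last_conv_nth)
  ultimately have "path_between (verts T) (edges T) (p ! i) ?q (p ! j)" by simp
  moreover have "path_between (verts T) (edges T) (p ! i) [p ! i, p ! j] (p ! j)"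
    using p ij e by (auto simp: path_between_def is_path_def nth_eq_iff_index_eq)
  moreover have "p ! i \<in> verts T" "p ! j \<in> verts T" using p ij by (auto simp: is_path_def)
  ultimately have "?q = [p ! i, p ! j]" using is_treeD(5)[OF tree_T] by (metis (no_types, lifting))
  then have "length ?q = 2" by simp
  with len ij show ?thesis by simp
qed

lemma trunk_neighbours:
  assumes "t \<in> trunk T" "{a, b, c} \<subseteq> trunk T" "{t, a} \<in> edges T" "{t, b} \<in> edges T" "{t, c} \<in> edges T"
    and "a \<noteq> b" "b \<noteq> c" "a \<noteq> c"
  shows False
proof -
  obtain p where p: "is_path (verts T) (edges T) p" "set p = trunk T" using trunk_path by blast
  then obtain k where k: "k < length p" "p ! k = t" using assms(1) by (metis in_set_conv_nth)
  have nb: "\<exists>i. i < length p \<and> p ! i = x \<and> (i = Suc k \<or> k = Suc i)" if "x \<in> trunk T" "{t, x} \<in> edges T" for x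
  proof -
    obtain i where i: "i < length p" "p ! i = x" using p(2) \<open>x \<in> trunk T\<close> by (metis in_set_conv_nth)
    have "x \<noteq> t" using that(2) is_treeD(4)[OF tree_T] by blast
    then have "i \<noteq> k" using i k by auto
    then consider "i < k" | "k < i" by linarith
    then show ?thesis
    proof cases
      case 1
      have "{p ! i, p ! k} \<in> edges T" using i k that(2) by (simp add: insert_commute)
      from path_adjacent[OF p(1) 1 k(1) this] i show ?thesis by blast
    next
      case 2
      have "{p ! k, p ! i} \<in> edges T" using i k that(2) by simp
      from path_adjacent[OF p(1) 2 i(1) this] i show ?thesis by blast
    qed
  qed
  obtain i1 i2 i3 where "p ! i1 = a" "p ! i2 = b" "p ! i3 = c"
    "i1 = Suc k \<or> k = Suc i1" "i2 = Suc k \<or> k = Suc i2" "i3 = Suc k \<or> k = Suc i3"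
    using nb[of a] nb[of b] nb[of c] assms by auto
  with assms(6-8) show False by auto
qed

lemma child_edge: "w \<in> children v \<Longrightarrow> {v, w} \<in> edges T"
  using edgeI'[of w] E_edges by (auto simp: children_def)

lemma trunk_children_root:
  assumes "{a, b, c} \<subseteq> children root \<inter> trunk T" "a \<noteq> b" "b \<noteq> c" "a \<noteq> c"
  shows False
  using trunk_neighbours[OF root_trunk, of a b c] assms child_edge by auto

lemma trunk_children_nonroot:
  assumes "{a, b} \<subseteq> children t \<inter> trunk T" "a \<noteq> b"
  shows "t = root"
proof (rule ccontr)
  assume n: "t \<noteq> root"
  have a: "a \<in> children t" "b \<in> children t" "a \<in> trunk T" "b \<in> trunk T" using assms by auto
  have t: "t \<in> verts T" "t \<in> trunk T"
    using children_V(1)[OF a(1)] trunk_par[OF a(3)] a(1) by (auto simp: children_def)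
  have "par t \<noteq> x" if "x \<in> children t" for x
  proof
    assume "par t = x"
    then have "P t = P x @ [t]" "P x = P t @ [x]"
      using P_step[OF t(1) n] that P_step[of x] by (auto simp: children_def)
    then have "length (P t) = length (P x) + 1" "length (P x) = length (P t) + 1" by auto
    then show False by simp
  qed
  then have "par t \<noteq> a" "par t \<noteq> b" using a by blast+
  moreover have "{t, par t} \<in> edges T" using edgeI[OF t(1) n] E_edges by simp
  ultimately show False
    using trunk_neighbours[OF t(2), of "par t" a b] assms a trunk_par[OF t(2) n] child_edge by auto
qed

text \<open>If all children of \<open>t\<close> lay on the trunk, there would be at least two, so
  \<open>t\<close> is the root. With exactly two, \<open>t\<close> has degree 2 and would be the
  whole trunk; with three, the trunk would not be a path.\<close>

lemma trunk_nontrunk_child: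
  assumes "t \<in> trunk T"
  shows "\<exists>w\<in>children t. w \<notin> trunk T"
proof (rule ccontr)
  assume "\<not> ?thesis"
  then have all: "children t \<subseteq> trunk T" by blast
  have t: "t \<in> verts T" "t \<in> internal" using assms leaf_not_trunk by (auto simp: trunk_def internal_def)
  have "card (children t) \<ge> 2"
  proof (cases "t = root")
    case True
    have "lu i \<in> desc root" for i using r_in_P by (simp add: desc_def)
    from desc_child[OF this] have "children root \<noteq> {}" by auto
    moreover have "card (children root) \<noteq> 1"
      using root_not_leaf valency_eq[of root] by (auto simp: leaves_def)
    moreover have "card (children root) \<noteq> 0" using calculation(1) fin_children by simp
    ultimately show ?thesis using True by simp
  qed (use two_children t in simp)
  then have "\<not> card (children t) \<le> Suc 0" by simp
  then obtain a b where ab: "a \<in> children t" "b \<in> children t" "a \<noteq> b"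
    using card_le_Suc0_iff_eq[OF fin_children, of t] by blast
  with all have r: "t = root" using trunk_children_nonroot[of a b t] by auto
  show False
  proof (cases "card (children t) = 2")
    case True
    then have "trunk T = {root}" using valency_2[of root] valency_eq[of root] r by simp
    with all ab show False by (auto simp: children_def)
  next
    case False
    then have "card (children t - {a, b}) \<noteq> 0"
      using \<open>card (children t) \<ge> 2\<close> ab fin_children[of t] by (simp add: card_Diff_subset)
    then obtain c where "c \<in> children t" "c \<noteq> a" "c \<noteq> b" by (metis DiffE all_not_in_conv card.empty insertCI)
    with trunk_children_root[of a b c] ab all r show False by auto
  qed
qed

section \<open>Vertices where an unprimed and a primed leaf diverge\<close>

definition meet :: "'n \<Rightarrow> 'n \<Rightarrow> 'v" where
  "meet i j = diverge T root (lu i) (lp j)"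

lemma meet_eqI:
  "w1 \<in> children v \<Longrightarrow> w2 \<in> children v \<Longrightarrow> w1 \<noteq> w2 \<Longrightarrow> lu i \<in> desc w1 \<Longrightarrow> lp j \<in> desc w2 \<Longrightarrow> meet i j = v"
  using lcp_meet unfolding meet_def diverge_def P_def[symmetric] by blast

lemma meet_cases:
  obtains w1 w2 where "w1 \<in> children (meet i j)" "w2 \<in> children (meet i j)" "w1 \<noteq> w2"
    "lu i \<in> desc w1" "lp j \<in> desc w2"
proof -
  have "lu i \<notin> desc (lp j)" "lp j \<notin> desc (lu i)"
    using desc_leaf[OF leaf_in] by (auto simp: leaf_inj)
  from meet_exists[OF leaf_V leaf_V this] obtain v w1 w2 where
    w: "w1 \<in> children v" "w2 \<in> children v" "w1 \<noteq> w2" "lu i \<in> desc w1" "lp j \<in> desc w2" by blast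
  with meet_eqI[OF w] that show ?thesis by blast
qed

lemma meet_internal: "meet i j \<in> internal"
proof (rule meet_cases[of i j])
  fix w1 w2 assume "w1 \<in> children (meet i j)"
  then show ?thesis using par_not_leaf children_V by (auto simp: internal_def)
qed

lemma meet_V [simp]: "meet i j \<in> verts T"
  using meet_internal by (auto simp: internal_def)

lemma inv_meet: "inv (meet i j) = meet j i"
proof (rule meet_cases[of i j])
  fix w1 w2 assume w: "w1 \<in> children (meet i j)" "w2 \<in> children (meet i j)" "w1 \<noteq> w2"
    "lu i \<in> desc w1" "lp j \<in> desc w2"
  have "inv (lp j) \<in> desc (inv w2)" "inv (lu i) \<in> desc (inv w1)"
    using w children_V inv_desc by blast+
  then have "lu j \<in> desc (inv w2)" "lp i \<in> desc (inv w1)" by (simp_all add: inv_leaf)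
  moreover have "inv w2 \<noteq> inv w1" using w(1-3) children_V inv_inj by blast
  ultimately show ?thesis using meet_eqI[OF inv_children[OF w(2)] inv_children[OF w(1)]] by simp
qed

lemma meet_trunk: "meet i i \<in> trunk T"
  using inv_meet[of i i] by (simp add: trunk_def)

lemma trunk_meet_nontrunk_child:
  assumes "t \<in> trunk T" "w \<in> children t" "w \<notin> trunk T" "lu i \<in> desc w"
  shows "meet i i = t"
proof (rule meet_eqI)
  show "w \<in> children t" "lu i \<in> desc w" by fact+
  have "inv t = t" using assms(1) by (simp add: trunk_def)
  then show "inv w \<in> children t" using inv_children[OF assms(2)] by simp
  show "w \<noteq> inv w" using assms(2,3) children_V by (auto simp: trunk_def)
  show "lp i \<in> desc (inv w)" using inv_desc[OF children_V(2)[OF assms(2)] assms(4)] by (simp add: inv_leaf)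
qed

text \<open>A branch at \<open>t\<close> and its mirror image leave \<open>t\<close> through
  different children. One of the two contains an unprimed leaf, which diverges from its primed
  partner at \<open>t\<close>.\<close>

lemma trunk_hanging:
  assumes "t \<in> trunk T"
  shows "\<exists>i w. w \<in> children t \<and> w \<notin> trunk T \<and> lu i \<in> desc w \<and> meet i i = t"
proof -
  obtain w where w: "w \<in> children t" "w \<notin> trunk T" using trunk_nontrunk_child[OF assms] by blast
  have it: "inv t = t" using assms by (simp add: trunk_def)
  obtain x where x: "leaf T x \<in> desc w" using leaf_below children_V(2)[OF w(1)] by blast
  show ?thesis
  proof (cases x)
    case (Unprimed i)
    with w x trunk_meet_nontrunk_child[OF assms w] show ?thesis by blast
  next
    case (Primed i)
    have "inv w \<in> children t" using inv_children[OF w(1)] it by simp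
    moreover have "inv w \<notin> trunk T" using w children_V by (auto simp: trunk_def)
    moreover have "lu i \<in> desc (inv w)"
      using inv_desc[OF children_V(2)[OF w(1)] x] Primed by (simp add: inv_leaf)
    ultimately show ?thesis using trunk_meet_nontrunk_child[OF assms] by blast
  qed
qed

lemma siblings_disjoint: "w1 \<in> children v \<Longrightarrow> w2 \<in> children v \<Longrightarrow> a \<in> desc w1 \<Longrightarrow> a \<in> desc w2 \<Longrightarrow> w1 = w2"
  using P_below_child[of w1 v a] P_below_child[of w2 v a] by auto

text \<open>Off the trunk, both colours occur below \<open>v\<close>. If the two chosen leaves lie
  under one child, a leaf under another child differs in colour from one of them. Hence the height
  of every internal vertex is visible in the matrix.\<close>

lemma meet_surj:
  assumes v: "v \<in> internal"
  shows "\<exists>i j. meet i j = v"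
proof (cases "v \<in> trunk T")
  case True
  then show ?thesis using trunk_hanging by blast
next
  case False
  then have nr: "v \<noteq> root" using root_trunk by auto
  have vV: "v \<in> verts T" using v by (simp add: internal_def)
  obtain i where i: "lu i \<in> desc v" using colors_below[OF v nr] by blast
  obtain j where j: "lp j \<in> desc v" using colors_below[OF v nr] by blast
  have "lu i \<noteq> v" "lp j \<noteq> v" using v leaf_in by (auto simp: internal_def)
  then obtain w1 w2 where w: "w1 \<in> children v" "lu i \<in> desc w1" "w2 \<in> children v" "lp j \<in> desc w2"
    using desc_child i j by metis
  show ?thesis
  proof (cases "w1 = w2")
    case False
    with w show ?thesis using meet_eqI by blast
  next
    case True
    have "\<not> card (children v) \<le> Suc 0" using two_children[OF v nr] by simp
    then obtain w3 where w3: "w3 \<in> children v" "w3 \<noteq> w1"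
      using card_le_Suc0_iff_eq[OF fin_children, of v] by metis
    obtain x where x: "leaf T x \<in> desc w3" using leaf_below children_V(2)[OF w3(1)] by blast
    show ?thesis
    proof (cases x)
      case (Unprimed k)
      then have "meet k j = v" using meet_eqI[OF w3(1) w(3) _ _ w(4)] w3(2) x True by simp
      then show ?thesis by blast
    next
      case (Primed k)
      then have "meet i k = v" using meet_eqI[OF w(1) w3(1) _ w(2)] w3(2) x by simp
      then show ?thesis by blast
    qed
  qed
qed

end

section \<open>Coordinate projections of spaces of matrices\<close>

definition supported :: "('n \<times> 'n) set \<Rightarrow> (real^'n^'n) set" where
  "supported S = {A. \<forall>i j. (i, j) \<notin> S \<longrightarrow> A $ i $ j = 0}"

definition mat_proj :: "('n \<times> 'n) set \<Rightarrow> real^'n^'n \<Rightarrow> real^'n^'n" where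
  "mat_proj S A = (\<chi> i j. if (i, j) \<in> S then A $ i $ j else 0)"

lemma linear_mat_proj: "linear (mat_proj S)"
  by (rule linearI) (auto simp: mat_proj_def vec_eq_iff)

lemma mat_proj_supported: "mat_proj S A \<in> supported S"
  by (simp add: mat_proj_def supported_def)

text \<open>Functions on \<open>S\<close> are replaced by matrices vanishing outside
  \<open>S\<close>, where dimension and orthogonality are at hand.\<close>

lemma linear_indep_iff:
  fixes S :: "('n::finite \<times> 'n) set"
  shows "linear_indep W S \<longleftrightarrow> supported S \<subseteq> mat_proj S ` W"
proof
  assume l: "linear_indep W S"
  show "supported S \<subseteq> mat_proj S ` W"
  proof
    fix A assume A: "A \<in> supported S"
    have "restrict (\<lambda>(i, j). A $ i $ j) S \<in> S \<rightarrow>\<^sub>E UNIV" by auto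
    then obtain w where w: "w \<in> W" "restrict (\<lambda>(i, j). A $ i $ j) S = entries_proj S w"
      using l unfolding linear_indep_def by blast
    have "A $ i $ j = w $ i $ j" if "(i, j) \<in> S" for i j
      using fun_cong[OF w(2), of "(i, j)"] that by (simp add: entries_proj_def)
    then have "A = mat_proj S w" using A by (auto simp: mat_proj_def vec_eq_iff supported_def)
    with w(1) show "A \<in> mat_proj S ` W" by blast
  qed
next
  assume s: "supported S \<subseteq> mat_proj S ` W"
  have "f \<in> entries_proj S ` W" if f: "f \<in> S \<rightarrow>\<^sub>E UNIV" for f
  proof -
    let ?A = "\<chi> i j. if (i, j) \<in> S then f (i, j) else 0"
    have "?A \<in> supported S" by (simp add: supported_def)
    then obtain w where w: "w \<in> W" "?A = mat_proj S w" using s by blast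
    have e: "f (i, j) = w $ i $ j" if "(i, j) \<in> S" for i j
      using arg_cong[OF w(2), of "\<lambda>A. A $ i $ j"] that by (simp add: mat_proj_def)
    have "f = entries_proj S w"
    proof
      fix s :: "'n \<times> 'n"
      obtain i j where s: "s = (i, j)" by (cases s)
      show "f s = entries_proj S w s"
      proof (cases "s \<in> S")
        case True
        then show ?thesis using e[of i j] by (simp add: s entries_proj_def)
      next
        case False
        then show ?thesis using PiE_arb[OF f False] by (simp add: entries_proj_def)
      qed
    qed
    with w(1) show ?thesis by blast
  qed
  then show "linear_indep W S" unfolding linear_indep_def by (auto simp: entries_proj_def)
qed

lemma family_independent:
  fixes f :: "'j \<Rightarrow> 'a::real_vector"
  assumes "finite J" and z: "\<And>a. (\<Sum>j\<in>J. a j *\<^sub>R f j) = 0 \<Longrightarrow> \<forall>j\<in>J. a j = 0"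
  shows "inj_on f J" "independent (f ` J)"
proof -
  show inj: "inj_on f J"
  proof (rule inj_onI, rule ccontr)
    fix j k assume jk: "j \<in> J" "k \<in> J" "f j = f k" "j \<noteq> k"
    define a where "a i = (if i = j then 1 else if i = k then -1 else 0 :: real)" for i
    have "(\<Sum>i\<in>J. a i *\<^sub>R f i) = (\<Sum>i\<in>J. (if i = j then f j else 0) - (if i = k then f j else 0))"
      by (rule sum.cong) (use jk in \<open>auto simp: a_def\<close>)
    also have "\<dots> = 0" using assms(1) jk by (simp add: sum_subtractf)
    finally have "a j = 0" using z jk(1) by blast
    then show False by (simp add: a_def)
  qed
  show "independent (f ` J)"
  proof
    assume "dependent (f ` J)"
    then obtain u where u: "\<exists>v\<in>f ` J. u v \<noteq> 0" "(\<Sum>v\<in>f ` J. u v *\<^sub>R v) = 0"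
      using dependent_finite[of "f ` J"] assms(1) by blast
    have "(\<Sum>j\<in>J. u (f j) *\<^sub>R f j) = 0" using u(2) by (simp add: sum.reindex[OF inj])
    from z[OF this] u(1) show False by blast
  qed
qed

lemma subspace_supported: "subspace (supported S)"
  by (auto simp: subspace_def supported_def)

lemma dim_supported:
  fixes S :: "('n::finite \<times> 'n) set"
  shows "dim (supported S) = card S"
proof -
  have fS: "finite S" by (rule finite)
  define e where "e s = (\<chi> a b. if (a, b) = s then (1::real) else 0)" for s :: "'n \<times> 'n"
  have ent: "(\<Sum>s\<in>S. a s *\<^sub>R e s) $ i $ j = (if (i, j) \<in> S then a (i, j) else 0)" for a i j
  proof -
    have "(\<Sum>s\<in>S. a s *\<^sub>R e s) $ i $ j = (\<Sum>s\<in>S. if (i, j) = s then a s else 0)"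
      by (simp add: e_def if_distrib cong: if_cong)
    then show ?thesis using fS by simp
  qed
  have "\<forall>s\<in>S. a s = 0" if "(\<Sum>s\<in>S. a s *\<^sub>R e s) = 0" for a
  proof
    fix s assume "s \<in> S"
    then show "a s = 0" using ent[of a "fst s" "snd s"] that by simp
  qed
  from family_independent[OF fS this] have i: "inj_on e S" "independent (e ` S)" by blast+
  show ?thesis
  proof (rule dim_unique)
    show "e ` S \<subseteq> supported S" by (auto simp: e_def supported_def)
    show "supported S \<subseteq> span (e ` S)"
    proof
      fix A :: "real^'n^'n" assume "A \<in> supported S"
      then have "A = (\<Sum>s\<in>S. (case s of (i, j) \<Rightarrow> A $ i $ j) *\<^sub>R e s)"
        unfolding vec_eq_iff ent by (auto simp: supported_def)
      also have "\<dots> \<in> span (e ` S)" by (intro span_sum span_scale span_base) auto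
      finally show "A \<in> span (e ` S)" .
    qed
  qed (use i card_image in auto)
qed

lemma linear_indep_card_le:
  assumes "linear_indep W S"
  shows "card S \<le> dim W"
proof -
  have "card S \<le> dim (mat_proj S ` W)"
    using assms unfolding linear_indep_iff dim_supported[symmetric] by (rule dim_subset)
  also have "\<dots> \<le> dim W" by (rule dim_image_le[OF linear_mat_proj])
  finally show ?thesis .
qed

text \<open>A nonzero matrix of \<open>W\<close> vanishing on \<open>B\<close> would allow another
  entry to be added to \<open>B\<close>; so the projection to \<open>B\<close> is injective on
  \<open>W\<close>.\<close>

lemma linear_base_card_ge:
  fixes W :: "(real^'n::{finite,linorder}^'n::{finite,linorder}) set"
  assumes W: "subspace W" and sym: "\<And>A i j. A \<in> W \<Longrightarrow> A $ i $ j = A $ j $ i"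
    and B: "B \<in> matroid_bases sym_entries (linear_indep W)"
  shows "dim W \<le> card B"
proof -
  have Bl: "linear_indep W B" and mx: "\<And>B'. B \<subset> B' \<Longrightarrow> B' \<subseteq> sym_entries \<Longrightarrow> \<not> linear_indep W B'"
    and BE: "B \<subseteq> sym_entries"
    using B unfolding matroid_bases_def by blast+
  have ker: "A = 0" if A: "A \<in> W" "mat_proj B A = 0" for A
  proof (rule ccontr)
    assume "A \<noteq> 0"
    then obtain i j where ij: "A $ i $ j \<noteq> 0" by (auto simp: vec_eq_iff)
    define s where "s = (if i \<le> j then (i, j) else (j, i))"
    have sE: "s \<in> sym_entries" by (auto simp: s_def sym_entries_def)
    have As: "A $ fst s $ snd s \<noteq> 0" using ij sym[OF A(1)] by (auto simp: s_def)
    have zero: "A $ a $ b = 0" if "(a, b) \<in> B" for a b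
      using arg_cong[OF A(2), of "\<lambda>M. M $ a $ b"] that by (simp add: mat_proj_def)
    have sB: "s \<notin> B" using As zero[of "fst s" "snd s"] by auto
    have "supported (insert s B) \<subseteq> mat_proj (insert s B) ` W"
    proof
      fix M assume M: "M \<in> supported (insert s B)"
      have "mat_proj B M \<in> mat_proj B ` W"
        using Bl mat_proj_supported unfolding linear_indep_iff by blast
      then obtain w where w: "w \<in> W" "mat_proj B M = mat_proj B w" by blast
      \<comment> \<open>Adding this multiple of \<open>A\<close> corrects the entry at
        \<open>s\<close> and leaves the entries in \<open>B\<close> unchanged.\<close>
      define c where "c = (M $ fst s $ snd s - w $ fst s $ snd s) / A $ fst s $ snd s"
      have "M = mat_proj (insert s B) (w + c *\<^sub>R A)"
        unfolding vec_eq_iff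
      proof (intro allI)
        fix a b
        consider "(a, b) \<in> B" | "(a, b) = s" "(a, b) \<notin> B" | "(a, b) \<noteq> s" "(a, b) \<notin> B" by blast
        then show "M $ a $ b = mat_proj (insert s B) (w + c *\<^sub>R A) $ a $ b"
        proof cases
          case 1
          then show ?thesis
            using arg_cong[OF w(2), of "\<lambda>M. M $ a $ b"] zero[OF 1] by (simp add: mat_proj_def)
        next
          case 2
          then have "fst s = a" "snd s = b" by auto
          then show ?thesis using As 2 by (simp add: c_def mat_proj_def)
        next
          case 3
          then show ?thesis using M by (simp add: supported_def mat_proj_def)
        qed
      qed
      moreover have "w + c *\<^sub>R A \<in> W" using W w(1) A(1) by (simp add: subspace_add subspace_scale)
      ultimately show "M \<in> mat_proj (insert s B) ` W" by blast
    qed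
    then have "linear_indep W (insert s B)" by (simp add: linear_indep_iff)
    moreover have "B \<subset> insert s B" using sB by blast
    ultimately show False using mx BE sE by blast
  qed
  have "inj_on (mat_proj B) W"
    using ker by (simp add: linear_injective_on_subspace_0[OF linear_mat_proj W])
  then have "inj_on (mat_proj B) (span W)" using W by (simp add: span_eq_iff[THEN iffD2])
  then have "dim W = dim (mat_proj B ` W)" by (rule dim_image_eq[OF linear_mat_proj, symmetric])
  also have "\<dots> \<le> dim (supported B)" by (rule dim_subset) (use mat_proj_supported in blast)
  finally show ?thesis by (simp add: dim_supported)
qed

text \<open>If the projection were not onto, a vector orthogonal to its image would be a nonzero
  annihilator supported on \<open>S\<close>.\<close>

lemma linear_indep_dual:
  fixes W :: "(real^'n^'n) set"
  assumes W: "subspace W"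
    and dual: "\<And>c. c \<in> supported S \<Longrightarrow> (\<And>w. w \<in> W \<Longrightarrow> (\<Sum>i\<in>UNIV. \<Sum>j\<in>UNIV. c $ i $ j * w $ i $ j) = 0) \<Longrightarrow> c = 0"
  shows "linear_indep W S"
  unfolding linear_indep_iff
proof
  fix A assume A: "A \<in> supported S"
  let ?U = "mat_proj S ` W"
  have U: "subspace ?U" by (rule linear_subspace_image[OF linear_mat_proj W])
  obtain y z where yz: "y \<in> span ?U" "\<And>w. w \<in> span ?U \<Longrightarrow> orthogonal z w" "A = y + z"
    using orthogonal_subspace_decomp_exists[of ?U A] by blast
  have y: "y \<in> ?U" using yz(1) U by (simp add: span_eq_iff[THEN iffD2])
  have zS: "z \<in> supported S"
  proof -
    have "y \<in> supported S" using y mat_proj_supported by blast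
    with A have "A - y \<in> supported S" by (intro subspace_diff subspace_supported)
    then show ?thesis using yz(3) by simp
  qed
  have "(\<Sum>i\<in>UNIV. \<Sum>j\<in>UNIV. z $ i $ j * w $ i $ j) = 0" if "w \<in> W" for w
  proof -
    have "orthogonal z (mat_proj S w)" using that by (intro yz(2) span_base) blast
    then have "(\<Sum>i\<in>UNIV. \<Sum>j\<in>UNIV. z $ i $ j * mat_proj S w $ i $ j) = 0"
      by (simp add: orthogonal_def inner_vec_def)
    moreover have "z $ i $ j * mat_proj S w $ i $ j = z $ i $ j * w $ i $ j" for i j
      using zS by (auto simp: mat_proj_def supported_def)
    ultimately show ?thesis by simp
  qed
  from dual[OF zS this] yz(3) y show "A \<in> ?U" by simp
qed

section \<open>The span of the cone of a symbic tree\<close>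

context symbic
begin

definition height_matrix :: "('v \<Rightarrow> real) \<Rightarrow> ('n \<Rightarrow> real) \<Rightarrow> real^'n^'n" where
  "height_matrix h X = (\<chi> i j. h (meet i j) + X i + X j)"

text \<open>Positive edge lengths are replaced by arbitrary invariant heights of the internal
  vertices, in the role of distances from the root.\<close>

definition height_space :: "(real^'n^'n) set" where
  "height_space = {height_matrix h X | h X. \<forall>v\<in>internal. h (inv v) = h v}"

lemma tree_dist_root [simp]: "tree_dist T len root root = 0"
  using P_root by (simp add: tree_dist_def P_def[symmetric])

lemma tree_dist_step:
  assumes "v \<in> verts T" "v \<noteq> root"
  shows "tree_dist T len root v = tree_dist T len root (par v) + len {par v, v}"
proof -
  let ?p = "P (par v)"
  have pv: "par v \<in> verts T" using assms parV by blast
  then have ne: "?p \<noteq> []" by simp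
  then obtain m where m: "length ?p = Suc m" by (cases ?p) auto
  have Pv: "P v = ?p @ [v]" using assms by (intro P_step)
  have "tree_dist T len root v = (\<Sum>k<Suc m. len {P v ! k, P v ! Suc k})"
    by (simp add: tree_dist_def P_def[symmetric] Pv m Let_def del: sum.lessThan_Suc)
  also have "\<dots> = (\<Sum>k<m. len {P v ! k, P v ! Suc k}) + len {P v ! m, P v ! Suc m}" by simp
  also have "(\<Sum>k<m. len {P v ! k, P v ! Suc k}) = (\<Sum>k<m. len {?p ! k, ?p ! Suc k})"
    by (rule sum.cong) (auto simp: Pv nth_append m)
  also have "\<dots> = tree_dist T len root (par v)"
    by (simp add: tree_dist_def P_def[symmetric] m Let_def)
  also have "P v ! m = par v"
    using last_P[OF pv] last_conv_nth[OF ne] by (simp add: Pv nth_append m)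
  also have "P v ! Suc m = v" by (simp add: Pv nth_append m)
  finally show ?thesis .
qed

lemma tree_matrix_eq: "tree_matrix T len = (\<chi> i j. tree_dist T len root (meet i j))"
  by (simp add: tree_matrix_def meet_def root_def)

lemma tree_dist_inv:
  assumes "symbic_metric T len" "v \<in> internal"
  shows "tree_dist T len root (inv v) = tree_dist T len root v"
proof -
  have "v \<in> verts T" using assms by (simp add: internal_def)
  then show ?thesis using assms(2)
  proof (induction v rule: tree_induct)
    case (step v)
    have "{v, par v} \<in> internal_edges T" using step internal_edges_eq by blast
    then have "len (inv ` {v, par v}) = len {v, par v}"
      using assms(1) unfolding symbic_metric_def by blast
    moreover have "inv ` {v, par v} = {par (inv v), inv v}" using step par_inv[of v] by auto
    ultimately have "len {par (inv v), inv v} = len {par v, v}" by (simp add: insert_commute)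
    moreover have "tree_dist T len root (inv (par v)) = tree_dist T len root (par v)"
      using step par_internal by blast
    ultimately show ?case
      using step by (simp add: tree_dist_step[of v] tree_dist_step[of "inv v"] par_inv)
  qed simp
qed

lemma subspace_height_space: "subspace height_space"
  unfolding subspace_def
proof (intro conjI allI ballI)
  show "0 \<in> height_space" unfolding height_space_def
    by (rule CollectI, rule exI[of _ "\<lambda>_. 0"], rule exI[of _ "\<lambda>_. 0"]) (simp add: height_matrix_def vec_eq_iff)
  fix A B assume A: "A \<in> height_space" and "B \<in> height_space"
  then obtain h X h' X' where *: "A = height_matrix h X" "\<forall>v\<in>internal. h (inv v) = h v"
    "B = height_matrix h' X'" "\<forall>v\<in>internal. h' (inv v) = h' v" unfolding height_space_def by blast
  show "A + B \<in> height_space" unfolding height_space_def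
    by (rule CollectI, rule exI[of _ "\<lambda>v. h v + h' v"], rule exI[of _ "\<lambda>i. X i + X' i"])
       (use * in \<open>simp add: height_matrix_def vec_eq_iff\<close>)
  fix c show "c *\<^sub>R A \<in> height_space" unfolding height_space_def
    by (rule CollectI, rule exI[of _ "\<lambda>v. c * h v"], rule exI[of _ "\<lambda>i. c * X i"])
       (use * in \<open>simp add: height_matrix_def vec_eq_iff distrib_left\<close>)
qed

text \<open>For the harder inclusion, heights are written as the difference of two metrics: one
  whose lengths are the increments of \<open>h\<close> plus a large constant \<open>M\<close>, the
  other with all lengths equal to \<open>M\<close>.\<close>

lemma span_symbic_cone: "span (symbic_cone T) = height_space"
proof
  have "symbic_cone T \<subseteq> height_space"
  proof
    fix A assume "A \<in> symbic_cone T"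
    then obtain len X where A: "A = tree_matrix T len + (\<chi> i j. X $ i + X $ j)" "symbic_metric T len"
      unfolding symbic_cone_def by blast
    have "A = height_matrix (tree_dist T len root) (\<lambda>i. X $ i)"
      by (simp add: A(1) height_matrix_def tree_matrix_eq vec_eq_iff)
    then show "A \<in> height_space" unfolding height_space_def using tree_dist_inv[OF A(2)] by blast
  qed
  then show "span (symbic_cone T) \<subseteq> height_space"
    using subspace_height_space by (rule span_minimal)
next
  show "height_space \<subseteq> span (symbic_cone T)"
  proof
    fix A assume "A \<in> height_space"
    then obtain h X where A: "A = height_matrix h X" and h: "\<And>v. v \<in> internal \<Longrightarrow> h (inv v) = h v"
      unfolding height_space_def by blast
    \<comment> \<open>This exceeds every difference of two values of \<open>h\<close>, so the
      lengths below are positive.\<close>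
    define M where "M = 1 + 2 * (\<Sum>v\<in>verts T. \<bar>h v\<bar>)"
    have hb: "\<bar>h v\<bar> \<le> (\<Sum>v\<in>verts T. \<bar>h v\<bar>)" if "v \<in> verts T" for v
      using finV that by (intro member_le_sum) auto
    define child where "child e = (THE v. v \<in> verts T - {root} \<and> e = {v, par v})" for e
    have child: "child {v, par v} = v" if "v \<in> verts T" "v \<noteq> root" for v
      unfolding child_def using that edge_inj by (intro the_equality) blast+
    define len where "len e = h (child e) - h (par (child e)) + M" for e
    have lenv: "len {par v, v} = h v - h (par v) + M" if "v \<in> verts T" "v \<noteq> root" for v
      using child[OF that] by (simp add: len_def insert_commute)
    have M1: "M \<ge> 1" unfolding M_def by (simp add: sum_nonneg)
    have m1: "symbic_metric T len"
      unfolding symbic_metric_def internal_edges_eq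
    proof
      fix e assume "e \<in> (\<lambda>v. {v, par v}) ` (internal - {root})"
      then obtain v where v: "v \<in> internal" "v \<noteq> root" "e = {par v, v}" by (auto simp: insert_commute)
      have vV: "v \<in> verts T" using v(1) by (simp add: internal_def)
      have pv: "par v \<in> internal" "par v \<in> verts T" using par_internal[OF vV v(2)] by (auto simp: internal_def)
      have "inv ` e = {par (inv v), inv v}" using v(3) par_inv[OF vV v(2)] by simp
      moreover have "len {par (inv v), inv v} = h (inv v) - h (par (inv v)) + M"
        using vV v(2) by (intro lenv) simp_all
      moreover have "h (inv v) = h v" "h (par (inv v)) = h (par v)"
        using h[OF v(1)] h[OF pv(1)] par_inv[OF vV v(2)] by simp_all
      ultimately have "len (inv ` e) = len e"
        using v(3) lenv[OF vV v(2)] by simp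
      moreover have "0 < len e"
        using hb[OF vV] hb[OF pv(2)] v(3) lenv[OF vV v(2)] by (simp add: M_def)
      ultimately show "0 < len e \<and> len (inv ` e) = len e" by simp
    qed
    have m2: "symbic_metric T (\<lambda>_. M)" using M1 by (simp add: symbic_metric_def)
    have diff: "tree_dist T len root v - tree_dist T (\<lambda>_. M) root v = h v - h root" if "v \<in> verts T" for v
      using that by (induction v rule: tree_induct) (auto simp: tree_dist_step lenv)
    \<comment> \<open>Tree distances vanish at the root, so \<open>h root\<close> is restored by
      splitting it evenly between the two summands from \<open>L\<close>.\<close>
    let ?A1 = "tree_matrix T len + (\<chi> i j. (\<chi> i. X i + h root / 2) $ i + (\<chi> i. X i + h root / 2) $ j)"
    let ?A2 = "tree_matrix T (\<lambda>_. M) + (\<chi> i j. (0 :: real^'n) $ i + (0 :: real^'n) $ j)"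
    have "?A1 \<in> symbic_cone T" "?A2 \<in> symbic_cone T"
      unfolding symbic_cone_def using m1 m2 by blast+
    then have "?A1 - ?A2 \<in> span (symbic_cone T)" by (intro span_diff span_base)
    moreover have "?A1 - ?A2 = A"
      unfolding A height_matrix_def vec_eq_iff
    proof (intro allI)
      fix i j
      show "(?A1 - ?A2) $ i $ j = (\<chi> i j. h (meet i j) + X i + X j) $ i $ j"
        using diff[OF meet_V, of i j] by (simp add: tree_matrix_eq field_simps)
    qed
    ultimately show "A \<in> span (symbic_cone T)" by simp
  qed
qed

lemma height_space_sym: "A \<in> height_space \<Longrightarrow> A $ i $ j = A $ j $ i"
proof -
  assume "A \<in> height_space"
  then obtain h X where A: "A = height_matrix h X" "\<forall>v\<in>internal. h (inv v) = h v"
    unfolding height_space_def by blast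
  have "h (meet j i) = h (meet i j)" using bspec[OF A(2) meet_internal[of i j]] by (simp add: inv_meet)
  then show ?thesis by (simp add: A(1) height_matrix_def)
qed

text \<open>Induction along the trunk away from the root: with \<open>i\<close> hanging at
  \<open>t\<close> and \<open>j\<close> at its parent, the entries \<open>(i, i)\<close>,
  \<open>(i, j)\<close>, \<open>(j, j)\<close> involve only the heights of these two vertices and
  determine \<open>h t\<close>. The diagonal then gives \<open>X\<close>, and
  \<open>meet_surj\<close> the remaining heights.\<close>

lemma height_matrix_zero:
  assumes z: "height_matrix h X = 0" and "h root = 0"
  shows "\<forall>v\<in>internal. h v = 0" "X = (\<lambda>_. 0)"
proof -
  have e: "h (meet i j) + X i + X j = 0" for i j
    using arg_cong[OF z, of "\<lambda>A. A $ i $ j"] by (simp add: height_matrix_def)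
  have tr: "h t = 0" if "t \<in> trunk T" for t
  proof -
    have "t \<in> verts T" using that by (simp add: trunk_def)
    then show ?thesis using that
    proof (induction t rule: tree_induct)
      case (step t)
      have pt: "par t \<in> trunk T" using trunk_par step by blast
      obtain i where i: "lu i \<in> desc t" "meet i i = t"
      proof -
        obtain i w where iw: "w \<in> children t" "lu i \<in> desc w" "meet i i = t" using trunk_hanging[OF step.prems] by blast
        moreover have "lu i \<in> desc t"
          using anc_trans[of "lu i" w t] iw(1,2) children_desc[OF iw(1)] by (auto simp: desc_def)
        ultimately show ?thesis using that by blast
      qed
      obtain j w where jw: "w \<in> children (par t)" "w \<notin> trunk T" "lu j \<in> desc w" "meet j j = par t"
        using trunk_hanging[OF pt] by blast
      have "inv w \<in> children (par t)" using inv_children[OF jw(1)] pt by (simp add: trunk_def)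
      moreover have "lp j \<in> desc (inv w)" using inv_desc[OF children_V(2)[OF jw(1)] jw(3)] by (simp add: inv_leaf)
      moreover have "t \<in> children (par t)" using step by (simp add: children_def)
      moreover have "t \<noteq> inv w"
        using jw(1,2) step.prems children_V(2)[OF jw(1)] by (metis (mono_tags, lifting) inv_inv mem_Collect_eq trunk_def)
      ultimately have "meet i j = par t" using meet_eqI i(1) by blast
      with e[of i j] e[of i i] e[of j j] i(2) jw(4) step.IH[OF pt] show ?case by simp
    qed (use assms(2) in simp)
  qed
  have "X i = 0" for i using e[of i i] tr[OF meet_trunk[of i]] by simp
  then show X: "X = (\<lambda>_. 0)" by blast
  show "\<forall>v\<in>internal. h v = 0"
  proof
    fix v assume "v \<in> internal"
    then obtain i j where "meet i j = v" using meet_surj by blast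
    with e[of i j] X show "h v = 0" by simp
  qed
qed

text \<open>A vertex other than the root stands for the edge to its parent, so these correspond to
  the orbits of internal edges counted by \<open>regular\<close>.\<close>

definition orbits :: "'v set set" where
  "orbits = (\<lambda>v. {v, inv v}) ` (internal - {root})"

lemma regular_iff: "regular T \<longleftrightarrow> card orbits = CARD('n) - 1"
proof -
  let ?e = "\<lambda>v. {v, par v}"
  have sub: "\<Union> orbits \<subseteq> verts T - {root}"
    using internal_inv by (auto simp: orbits_def internal_def)
  have "inj_on ?e (verts T - {root})" using edge_inj by (rule inj_onI)
  then have inj: "inj_on ((`) ?e) orbits" using sub by (intro inj_on_image) (rule inj_on_subset)
  have "(\<lambda>e. {e, inv ` e}) ` internal_edges T = (`) ?e ` orbits"
    unfolding internal_edges_eq orbits_def image_image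
  proof (rule image_cong[OF refl])
    fix v assume "v \<in> internal - {root}"
    then have "inv ` {v, par v} = {inv v, par (inv v)}" by (simp add: internal_def par_inv)
    then show "{{v, par v}, inv ` {v, par v}} = ?e ` {v, inv v}" by simp
  qed
  then show ?thesis using card_image[OF inj] by (simp add: regular_def)
qed

lemma orbit_mem: "v \<in> internal \<Longrightarrow> Q \<in> orbits \<Longrightarrow> v \<in> Q \<longleftrightarrow> v \<noteq> root \<and> Q = {v, inv v}"
  by (auto simp: orbits_def internal_def)

lemma finite_orbits: "finite orbits"
  using finV by (simp add: orbits_def internal_def)

text \<open>Coordinates are one height for each of the n - 1 orbits, with height 0 at the root, and
  the n numbers \<open>X k\<close>; they are independent by
  \<open>height_matrix_zero\<close>.\<close>

lemma dim_height_space: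
  assumes "regular T"
  shows "dim height_space = 2 * CARD('n) - 1"
proof -
  define J where "J = orbits <+> (UNIV :: 'n set)"
  define f :: "'v set + 'n \<Rightarrow> real^'n^'n" where
    "f = case_sum (\<lambda>Q. \<chi> i j. if meet i j \<in> Q then 1 else 0) (\<lambda>k. \<chi> i j. (if i = k then 1 else 0) + (if j = k then 1 else 0))"
  have finJ: "finite J" using finite_orbits by (simp add: J_def)
  have comb: "(\<Sum>x\<in>J. a x *\<^sub>R f x) = height_matrix (\<lambda>v. if v = root then 0 else a (Inl {v, inv v})) (\<lambda>k. a (Inr k))" for a
    unfolding vec_eq_iff
  proof (intro allI)
    fix i j
    have "(\<Sum>x\<in>J. a x *\<^sub>R f x) $ i $ j =
      (\<Sum>Q\<in>orbits. (a (Inl Q) *\<^sub>R f (Inl Q)) $ i $ j) + (\<Sum>k\<in>UNIV. (a (Inr k) *\<^sub>R f (Inr k)) $ i $ j)"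
      unfolding J_def sum.Plus[OF finite_orbits finite] by (simp add: sum_component)
    also have "(\<Sum>Q\<in>orbits. (a (Inl Q) *\<^sub>R f (Inl Q)) $ i $ j) = (\<Sum>Q\<in>orbits. if meet i j \<in> Q then a (Inl Q) else 0)"
      by (rule sum.cong) (auto simp: f_def)
    also have "(\<Sum>k\<in>UNIV. (a (Inr k) *\<^sub>R f (Inr k)) $ i $ j) =
      (\<Sum>k\<in>UNIV. (if i = k then a (Inr k) else 0) + (if j = k then a (Inr k) else 0))"
      by (rule sum.cong) (auto simp: f_def)
    also have "(\<Sum>Q\<in>orbits. if meet i j \<in> Q then a (Inl Q) else 0) =
      (\<Sum>Q\<in>orbits. if Q = {meet i j, inv (meet i j)} then (if meet i j = root then 0 else a (Inl {meet i j, inv (meet i j)})) else 0)"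
      by (rule sum.cong) (use orbit_mem[OF meet_internal] in auto)
    also have "\<dots> = (if meet i j = root then 0 else a (Inl {meet i j, inv (meet i j)}))"
      using finite_orbits meet_internal[of i j] by (simp add: orbits_def)
    finally show "(\<Sum>x\<in>J. a x *\<^sub>R f x) $ i $ j =
      height_matrix (\<lambda>v. if v = root then 0 else a (Inl {v, inv v})) (\<lambda>k. a (Inr k)) $ i $ j"
      by (simp add: height_matrix_def sum.distrib)
  qed
  have "\<forall>x\<in>J. a x = 0" if "(\<Sum>x\<in>J. a x *\<^sub>R f x) = 0" for a
  proof
    fix x assume x: "x \<in> J"
    let ?h = "\<lambda>v. if v = root then 0 else a (Inl {v, inv v})"
    have "height_matrix ?h (\<lambda>k. a (Inr k)) = 0" using that unfolding comb .
    from height_matrix_zero[OF this] have z: "\<forall>v\<in>internal. ?h v = 0" "(\<lambda>k. a (Inr k)) = (\<lambda>_. 0)" by simp_all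
    from x consider (1) Q where "Q \<in> orbits" "x = Inl Q" | (2) k where "x = Inr k"
      unfolding J_def by auto
    then show "a x = 0"
    proof cases
      case (1 Q)
      then obtain v where "v \<in> internal" "v \<noteq> root" "Q = {v, inv v}" by (auto simp: orbits_def)
      with z(1) 1 show ?thesis by auto
    next
      case (2 k)
      with fun_cong[OF z(2), of k] show ?thesis by simp
    qed
  qed
  from family_independent[OF finJ this] have ind: "inj_on f J" "independent (f ` J)" by blast+
  have "card (f ` J) = 2 * CARD('n) - 1"
    using card_image[OF ind(1)] assms[unfolded regular_iff] finite_orbits by (simp add: J_def card_Plus)
  moreover have "f ` J \<subseteq> height_space"
  proof
    fix A assume "A \<in> f ` J"
    then obtain x where x: "x \<in> J" "A = f x" by blast
    let ?a = "\<lambda>y. if y = x then 1 else 0 :: real"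
    let ?h = "\<lambda>v. if v = root then 0 else ?a (Inl {v, inv v})"
    have "(\<Sum>y\<in>J. ?a y *\<^sub>R f y) = (\<Sum>y\<in>J. if y = x then f x else 0)" by (rule sum.cong) auto
    also have "\<dots> = f x" using finJ x(1) by simp
    finally have "A = height_matrix ?h (\<lambda>k. ?a (Inr k))" unfolding comb x(2) by (rule sym)
    moreover have "\<forall>v\<in>internal. ?h (inv v) = ?h v"
      by (auto simp: internal_def insert_commute)
    ultimately show "A \<in> height_space" unfolding height_space_def by blast
  qed
  moreover have "height_space \<subseteq> span (f ` J)"
  proof
    fix A assume "A \<in> height_space"
    then obtain h X where A: "A = height_matrix h X" and h: "\<And>v. v \<in> internal \<Longrightarrow> h (inv v) = h v"
      unfolding height_space_def by blast
    define a where "a = case_sum (\<lambda>Q. h (SOME v. v \<in> Q) - h root) (\<lambda>k. X k + h root / 2)"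
    have s: "h (SOME w. w = v \<or> w = inv v) = h v" if "v \<in> internal" for v
    proof -
      have "(SOME w. w = v \<or> w = inv v) = v \<or> (SOME w. w = v \<or> w = inv v) = inv v"
        by (rule someI[of _ v]) simp
      then show ?thesis using h[OF that] by auto
    qed
    have "A = (\<Sum>x\<in>J. a x *\<^sub>R f x)"
      unfolding comb A by (auto simp: height_matrix_def vec_eq_iff a_def s[OF meet_internal] field_simps)
    also have "\<dots> \<in> span (f ` J)" by (intro span_sum span_scale span_base) auto
    finally show "A \<in> span (f ` J)" .
  qed
  ultimately show ?thesis using ind(2) by (intro dim_unique)
qed

end

section \<open>Independence in a symbic tree implies algebraic independence\<close>

text \<open>For a height function increasing away from the root, the leaf \<open>a\<close> gets the polynomial
  \<open>\<Sum>u. c u * t ^ h (par u)\<close> over the ancestors \<open>u \<noteq> root\<close> of \<open>a\<close>; two leaves then agree exactly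
  up to order \<open>h\<close> of the vertex where they diverge. The coefficients are odd under the involution,
  so primed leaves get the negatives of the unprimed ones. Two trunk children of the root have
  equal coefficients \<open>0\<close>; one of the two directions is treated as approaching infinity.\<close>

locale symbic_nat = symbic T for T :: "(nat, 'n::finite) labelled_tree"
begin

text \<open>The smaller vertex of an orbit gets its own number plus one, which avoids 0, and its
  mirror image the negative. In characteristic 0 distinct vertices collide only on the trunk
  (\<open>coef_inj\<close>).\<close>

definition coef :: "nat \<Rightarrow> 'k::field_char_0" where
  "coef v = (if v < inv v then of_nat (Suc v) else if inv v < v then - of_nat (Suc (inv v)) else 0)"

lemma coef_inv: "v \<in> verts T \<Longrightarrow> coef (inv v) = - coef v"
  by (auto simp: coef_def)

lemma coef_trunk: "v \<in> trunk T \<Longrightarrow> coef v = 0"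
  by (simp add: coef_def trunk_def)

lemma coef_inj:
  assumes "u \<in> verts T" "v \<in> verts T" "coef u = (coef v :: 'k::field_char_0)"
  shows "u = v \<or> u \<in> trunk T \<and> v \<in> trunk T"
proof -
  have p: "of_nat (Suc a) \<noteq> - (of_nat (Suc b) :: 'k)" for a b
  proof
    assume "of_nat (Suc a) = - (of_nat (Suc b) :: 'k)"
    then have "of_nat (Suc a + Suc b) = (0 :: 'k)" by (simp only: of_nat_add) simp
    then show False by (simp only: of_nat_eq_0_iff)
  qed
  have n: "- of_nat (Suc a) \<noteq> (of_nat (Suc b) :: 'k)" for a b using p[of b a] by metis
  have z: "of_nat (Suc a) \<noteq> (0::'k)" "- of_nat (Suc a) \<noteq> (0::'k)" "0 \<noteq> (of_nat (Suc a)::'k)" "0 \<noteq> - (of_nat (Suc a)::'k)" for a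
    by (simp_all only: of_nat_eq_0_iff neg_equal_0_iff_equal neg_0_equal_iff_equal, simp_all add: eq_commute[of 0] del: of_nat_Suc)
  have i: "of_nat (Suc a) = (of_nat (Suc b) :: 'k) \<longleftrightarrow> a = b" for a b by (simp del: of_nat_Suc)
  consider "u < inv u" | "inv u < u" | "inv u = u" by linarith
  then show ?thesis
  proof cases
    case 1
    consider "v < inv v" | "inv v < v" | "inv v = v" by linarith
    then show ?thesis using assms(3) 1 i[of u v] p[of u "inv v"] z(1)[of u] by cases (simp_all add: coef_def del: of_nat_Suc)
  next
    case 2
    consider "v < inv v" | "inv v < v" | "inv v = v" by linarith
    then show ?thesis
      using assms 2 i[of "inv u" "inv v"] n[of "inv u" v] z(2)[of "inv u"] inv_inj[of u v]
      by cases (simp_all add: coef_def del: of_nat_Suc)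
  next
    case 3
    consider "v < inv v" | "inv v < v" | "inv v = v" by linarith
    then show ?thesis using assms 3 z(3)[of v] z(4)[of "inv v"] by cases (simp_all add: coef_def trunk_def del: of_nat_Suc)
  qed
qed

definition zpoly :: "(nat \<Rightarrow> nat) \<Rightarrow> nat \<Rightarrow> 'k::field_char_0 poly" where
  "zpoly H v = (\<Sum>u\<in>set (P v) - {root}. monom (coef u) (H (par u)))"

lemma zpoly_root [simp]: "zpoly H root = 0"
  by (simp add: zpoly_def P_root)

lemma zpoly_step: "v \<in> verts T \<Longrightarrow> v \<noteq> root \<Longrightarrow> zpoly H v = zpoly H (par v) + monom (coef v) (H (par v))"
proof -
  assume v: "v \<in> verts T" "v \<noteq> root"
  have "set (P v) - {root} = insert v (set (P (par v)) - {root})" using v by (auto simp: P_step)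
  moreover have "v \<notin> set (P (par v)) - {root}" using par_notin[OF v] by blast
  ultimately show ?thesis unfolding zpoly_def by (simp add: add.commute)
qed

lemma zpoly_inv:
  assumes "\<And>v. v \<in> verts T \<Longrightarrow> H (inv v) = H v" "v \<in> verts T"
  shows "zpoly H (inv v) = - zpoly H v"
  using assms(2)
proof (induction v rule: tree_induct)
  case (step v)
  then show ?case
    using assms(1)[of "par v"] parV[of v]
    by (simp add: zpoly_step[of v] zpoly_step[of "inv v"] par_inv coef_inv minus_monom)
qed simp

lemma height_mono:
  assumes "\<And>v. v \<in> verts T \<Longrightarrow> v \<noteq> root \<Longrightarrow> H (par v) < (H v :: nat)" "v \<in> verts T" "u \<in> set (P v)"
  shows "H u \<le> H v"
  using assms(2,3)
proof (induction v rule: tree_induct)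
  case (step v)
  show ?case
  proof (cases "u = v")
    case False
    then have "u \<in> set (P (par v))" using step by (simp add: P_step)
    with step assms(1)[of v] show ?thesis by fastforce
  qed simp
qed (simp add: P_root)

text \<open>Below \<open>d\<close> only the term of \<open>w\<close> has exponent
  \<open>H d\<close>, all later ones are larger. So \<open>coef w\<close> is the coefficient at the
  order where leaves under different children of \<open>d\<close> separate.\<close>

lemma zpoly_below:
  assumes H: "\<And>v. v \<in> verts T \<Longrightarrow> v \<noteq> root \<Longrightarrow> H (par v) < H v"
    and w: "w \<in> children d" "a \<in> desc w"
  shows "\<exists>Q. (zpoly H a :: 'k::field_char_0 poly) = zpoly H d + monom 1 (H d) * ([:coef w:] + [:0, 1:] * Q)"
proof -
  have wV: "w \<in> verts T" "w \<noteq> root" "par w = d" using w(1) by (auto simp: children_def)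
  have "a \<in> verts T" "w \<in> set (P a)" using w(2) by (auto simp: desc_def)
  then show ?thesis
  proof (induction a rule: tree_induct)
    case root
    then show ?case using wV(2) by (simp add: P_root)
  next
    case (step a)
    show ?case
    proof (cases "a = w")
      case True
      have "(monom (coef w) (H d) :: 'k poly) = monom 1 (H d) * [:coef w:]"
        by (simp add: smult_monom)
      then show ?thesis using wV True by (intro exI[of _ 0]) (simp add: zpoly_step)
    next
      case False
      with step have pa: "w \<in> set (P (par a))" by (simp add: P_step)
      with step obtain Q where Q: "(zpoly H (par a) :: 'k poly) = zpoly H d + monom 1 (H d) * ([:coef w:] + [:0, 1:] * Q)" by blast
      have "H w \<le> H (par a)" using height_mono[of H, OF H _ pa] parV step by blast
      moreover have "H d < H w" using H[OF wV(1,2)] wV(3) by simp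
      ultimately obtain e where e: "H (par a) = H d + 1 + e"
        by (metis Suc_eq_plus1 Suc_leI le_iff_add le_trans)
      have "(monom (coef a) (H (par a)) :: 'k poly) = monom 1 (H d) * ([:0, 1:] * monom (coef a) e)"
        by (simp add: e mult_monom monom_Suc add.commute add.left_commute flip: monom_Suc)
      then have "(zpoly H a :: 'k poly) = zpoly H d + monom 1 (H d) * ([:coef w:] + [:0, 1:] * (Q + monom (coef a) e))"
        using step by (simp add: zpoly_step Q distrib_left)
      then show ?thesis by blast
    qed
  qed
qed

text \<open>\<open>D\<close> is one of the two trunk directions at the root if there are two, and
  empty otherwise. Only at the root can a vertex have two trunk children, and there \<open>D\<close>
  tells them apart.\<close>

lemma second_trunk_direction:
  "\<exists>D. (\<forall>v\<in>D. \<exists>\<tau>\<in>children root \<inter> trunk T. D = desc \<tau>) \<and>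
    (\<forall>d w1 w2. w1 \<in> children d \<inter> trunk T \<longrightarrow> w2 \<in> children d \<inter> trunk T \<longrightarrow> w1 \<noteq> w2 \<longrightarrow>
      d = root \<and> (D = desc w1 \<or> D = desc w2))"
proof (cases "\<exists>w1 w2. w1 \<in> children root \<inter> trunk T \<and> w2 \<in> children root \<inter> trunk T \<and> w1 \<noteq> w2")
  case True
  then obtain a b where ab: "a \<in> children root \<inter> trunk T" "b \<in> children root \<inter> trunk T" "a \<noteq> b" by blast
  have "d = root \<and> (desc a = desc w1 \<or> desc a = desc w2)"
    if "w1 \<in> children d \<inter> trunk T" "w2 \<in> children d \<inter> trunk T" "w1 \<noteq> w2" for d w1 w2
  proof -
    have d: "d = root" using trunk_children_nonroot[of w1 w2 d] that by simp
    have "a = w1 \<or> a = w2" using trunk_children_root[of a w1 w2] ab that d by auto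
    with d show ?thesis by auto
  qed
  with ab(1) show ?thesis by (intro exI[of _ "desc a"]) blast
next
  case False
  then have "\<not> (w1 \<in> children d \<inter> trunk T \<and> w2 \<in> children d \<inter> trunk T \<and> w1 \<noteq> w2)" for d w1 w2
    using trunk_children_nonroot[of w1 w2 d] by auto
  then show ?thesis by (intro exI[of _ "{}"]) blast
qed

text \<open>Indices outside \<open>D\<close> get the vector \<open>(1, z i)\<close>, those in
  \<open>D\<close> the reversed vector \<open>(z i, 1)\<close>. Two indices on the same side give
  \<open>z i + z j\<close>, which vanishes exactly to the height of the meeting vertex above the
  root. Indices on different sides meet at the root and give \<open>1 + z i * z j\<close>, which is
  nonzero at 0.\<close>

lemma matrix_of_heights:
  fixes h X :: "_ \<Rightarrow> nat"
  assumes H: "\<And>v. v \<in> verts T \<Longrightarrow> v \<noteq> root \<Longrightarrow> h (par v) < h v"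
    and Hinv: "\<And>v. v \<in> verts T \<Longrightarrow> h (inv v) = h v"
  shows "\<exists>U :: 'n \<times> 'n \<Rightarrow> 'k::{alg_closed_field,field_char_0} poly. (\<forall>s. poly (U s) 0 \<noteq> 0) \<and>
    (\<forall>t. (\<chi> i j. t ^ (h (meet i j) + X i + X j) * poly (U (i, j)) t) \<in> sym_rank_le_2)"
proof -
  \<comment> \<open>Heights are normalised to 0 at the root; the missing power of \<open>t\<close>
    is put back into the first vector at the end.\<close>
  define h' where "h' v = h v - h root" for v
  have hr: "h root \<le> h v" if "v \<in> verts T" for v using height_mono[of h, OF H that r_in_P[OF that]] .
  have H': "h' (par v) < h' v" if "v \<in> verts T" "v \<noteq> root" for v
    using H[OF that] hr[OF parV[OF that]] by (simp add: h'_def)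
  have H'inv: "h' (inv v) = h' v" if "v \<in> verts T" for v using Hinv[OF that] by (simp add: h'_def)
  define z where "z i = (zpoly h' (lu i) :: 'k poly)" for i
  have zp: "zpoly h' (lp j) = - z j" for j
    using zpoly_inv[of h', OF H'inv leaf_V, of "Unprimed j"] by (simp add: z_def inv_leaf)
  obtain D where D: "\<forall>v\<in>D. \<exists>\<tau>\<in>children root \<inter> trunk T. D = desc \<tau>"
    "\<And>d w1 w2. w1 \<in> children d \<inter> trunk T \<Longrightarrow> w2 \<in> children d \<inter> trunk T \<Longrightarrow> w1 \<noteq> w2 \<Longrightarrow>
      d = root \<and> (D = desc w1 \<or> D = desc w2)"
    using second_trunk_direction by blast
  have Dinv: "lp i \<in> D \<longleftrightarrow> lu i \<in> D" for i
  proof -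
    have *: "inv v \<in> D" if vD: "v \<in> D" for v
    proof -
      obtain \<tau> where t: "\<tau> \<in> children root \<inter> trunk T" "D = desc \<tau>" using D(1) vD by blast
      then have "\<tau> \<in> verts T" "inv \<tau> = \<tau>" by (auto simp: trunk_def)
      with inv_desc[of \<tau> v] vD t show ?thesis by simp
    qed
    show ?thesis using *[of "lu i"] *[of "lp i"] by (auto simp: inv_leaf)
  qed
  define x where "x i = (if lu i \<in> D then z i else 1)" for i
  define y where "y i = (if lu i \<in> D then 1 else z i)" for i
  have mixed: "meet i j = root \<and> poly (z i) 0 = 0" if ij: "lu i \<in> D" "lu j \<notin> D" for i j
  proof -
    obtain \<tau> where t: "\<tau> \<in> children root \<inter> trunk T" "D = desc \<tau>" using D(1) ij(1) by blast
    have "lp j \<in> desc root" using r_in_P by (simp add: desc_def)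
    then obtain w where w: "w \<in> children root" "lp j \<in> desc w" using desc_child leaf_neq_root by blast
    have "w \<noteq> \<tau>" using w(2) t(2) ij(2) Dinv by auto
    then have "meet i j = root" using meet_eqI[of \<tau> root w i j] t w ij(1) by auto
    obtain Q where "zpoly h' (lu i) = zpoly h' root + monom 1 (h' root) * ([:coef \<tau>:] + [:0, 1:] * Q :: 'k poly)"
      using zpoly_below[of h' \<tau> root "lu i", OF H'] t ij(1) by blast
    then have "poly (z i) 0 = 0" using t(1) by (simp add: z_def coef_trunk)
    with \<open>meet i j = root\<close> show ?thesis by blast
  qed
  have ring_id: "(a + m * (k + t * q)) - (a + m * (k' + t * q')) = m * (k - k' + t * (q - q'))"
    for a m k k' t q q' :: "'k poly" by (simp add: algebra_simps)
  have ex: "\<exists>U :: 'k poly. poly U 0 \<noteq> 0 \<and> x i * y j + x j * y i = monom 1 (h' (meet i j)) * U" for i j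
  proof (cases "lu i \<in> D \<longleftrightarrow> lu j \<in> D")
    case True
    obtain w1 w2 where w: "w1 \<in> children (meet i j)" "w2 \<in> children (meet i j)" "w1 \<noteq> w2"
      "lu i \<in> desc w1" "lp j \<in> desc w2" by (rule meet_cases)
    obtain Q1 where Q1: "z i = zpoly h' (meet i j) + monom 1 (h' (meet i j)) * ([:coef w1:] + [:0, 1:] * Q1)"
      using zpoly_below[of h', OF H' w(1,4)] unfolding z_def by blast
    have "\<exists>Q. (zpoly h' (lp j) :: 'k poly) = zpoly h' (meet i j) + monom 1 (h' (meet i j)) * ([:coef w2:] + [:0, 1:] * Q)"
      using H' w(2,5) by (rule zpoly_below)
    then obtain Q2 where Q2: "- z j = zpoly h' (meet i j) + monom 1 (h' (meet i j)) * ([:coef w2:] + [:0, 1:] * Q2)"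
      unfolding zp by blast
    have "coef w1 \<noteq> (coef w2 :: 'k)"
    proof
      assume "coef w1 = (coef w2 :: 'k)"
      then have tr: "w1 \<in> trunk T" "w2 \<in> trunk T"
        using coef_inj[of w1 w2] w(1-3) children_V by blast+
      from D(2)[of w1 "meet i j" w2] w tr have "D = desc w1 \<or> D = desc w2" by blast
      then show False
        using True Dinv[of j] w siblings_disjoint[OF w(1,2)] by metis
    qed
    then have "poly ([:coef w1:] - [:coef w2:] + [:0, 1:] * (Q1 - Q2)) 0 \<noteq> 0" by simp
    moreover have "x i * y j + x j * y i = z i - (- z j)" using True by (auto simp: x_def y_def)
    then have "x i * y j + x j * y i = monom 1 (h' (meet i j)) * ([:coef w1:] - [:coef w2:] + [:0, 1:] * (Q1 - Q2))"
      unfolding Q1 Q2 using ring_id by metis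
    ultimately show ?thesis by blast
  next
    case False
    have "meet i j = root \<and> poly (z i * z j) 0 = 0"
    proof (cases "lu i \<in> D")
      case True
      then show ?thesis using mixed[of i j] False by simp
    next
      case F: False
      then have m: "meet j i = root \<and> poly (z j) 0 = 0" using mixed[of j i] False by simp
      then have "meet i j = root" using inv_meet[of j i] by simp
      with m show ?thesis by simp
    qed
    moreover have "x i * y j + x j * y i = 1 + z i * z j" using False by (auto simp: x_def y_def mult.commute)
    ultimately show ?thesis by (intro exI[of _ "1 + z i * z j"]) (auto simp: h'_def)
  qed
  define U where "U s = (SOME U. poly U 0 \<noteq> 0 \<and> x (fst s) * y (snd s) + x (snd s) * y (fst s) = monom 1 (h' (meet (fst s) (snd s))) * U)" for s
  have U: "poly (U (i, j)) 0 \<noteq> 0" "x i * y j + x j * y i = monom 1 (h' (meet i j)) * U (i, j)" for i j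
    using someI_ex[OF ex[of i j]] unfolding U_def by simp_all
  have "(\<chi> i j. t ^ (h (meet i j) + X i + X j) * poly (U (i, j)) t) \<in> sym_rank_le_2" for t
    unfolding sym_rank_le_2_iff
  proof (rule exI[of _ "\<lambda>i. t ^ (X i + h root) * poly (x i) t"], rule exI[of _ "\<lambda>i. t ^ X i * poly (y i) t"], intro allI)
    fix i j
    have "h (meet i j) = h root + h' (meet i j)" using hr[of "meet i j"] by (simp add: h'_def)
    then have "t ^ (h (meet i j) + X i + X j) * poly (U (i, j)) t =
      t ^ (h root + X i + X j) * poly (monom 1 (h' (meet i j)) * U (i, j)) t"
      by (simp add: poly_monom power_add mult_ac)
    also have "\<dots> = t ^ (h root + X i + X j) * poly (x i * y j + x j * y i) t" unfolding U(2) ..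
    finally show "(\<chi> i j. t ^ (h (meet i j) + X i + X j) * poly (U (i, j)) t) $ i $ j =
      t ^ (X i + h root) * poly (x i) t * (t ^ X j * poly (y j) t) + t ^ (X j + h root) * poly (x j) t * (t ^ X i * poly (y i) t)"
      by (simp add: power_add algebra_simps)
  qed
  moreover have "\<forall>s. poly (U s) 0 \<noteq> 0" using U(1) by auto
  ultimately show ?thesis by blast
qed

text \<open>By independence of \<open>S\<close>, a \<delta> not vanishing on \<open>S\<close> gives
  a nonzero linear form in the orbit heights and \<open>X\<close>, so a point of the moment curve
  avoids the zeros of all these forms. Since heights must also increase away from the root, the
  depth is added as a further coordinate with the largest exponent.\<close>

lemma separating_heights:
  fixes \<Delta> :: "('n \<times> 'n \<Rightarrow> real) set"
  assumes S: "linear_indep height_space S" and fin: "finite \<Delta>" and nz: "\<And>\<delta>. \<delta> \<in> \<Delta> \<Longrightarrow> \<exists>s\<in>S. \<delta> s \<noteq> 0"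
  shows "\<exists>(h :: nat \<Rightarrow> nat) (X :: 'n \<Rightarrow> nat). (\<forall>v\<in>verts T. v \<noteq> root \<longrightarrow> h (par v) < h v) \<and> (\<forall>v\<in>verts T. h (inv v) = h v) \<and>
    (\<forall>\<delta>\<in>\<Delta>. (\<Sum>(i, j)\<in>S. \<delta> (i, j) * real (h (meet i j) + X i + X j)) \<noteq> 0)"
proof -
  have fS: "finite S" by (rule finite)
  define orb where "orb v = {v, inv v}" for v
  \<comment> \<open>\<open>None\<close> is the coordinate of the depth; the others belong to the
    vertex orbits and to the indices.\<close>
  define J where "J = insert None (Some ` (orb ` verts T <+> (UNIV :: 'n set)))"
  have finJ0: "finite (orb ` verts T <+> (UNIV :: 'n set))" using finV by simp
  then have finJ: "finite J" by (simp add: J_def)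
  obtain g :: "nat set + 'n \<Rightarrow> nat" and B where g: "g ` (orb ` verts T <+> UNIV) = {i. i < B}" "inj_on g (orb ` verts T <+> UNIV)"
    using finite_imp_inj_to_nat_seg[OF finJ0] by blast
  define idx where "idx = case_option B g"
  have idx_inj: "inj_on idx J"
    using g by (auto simp: J_def idx_def inj_on_def)
  define cf :: "('n \<times> 'n \<Rightarrow> real) \<Rightarrow> (nat set + 'n) option \<Rightarrow> real" where
    "cf \<delta> = case_option (\<Sum>(i, j)\<in>S. \<delta> (i, j) * real (length (P (meet i j))))
      (case_sum (\<lambda>Q. \<Sum>(i, j)\<in>S. if orb (meet i j) = Q then \<delta> (i, j) else 0)
        (\<lambda>k. \<Sum>(i, j)\<in>S. (if i = k then \<delta> (i, j) else 0) + (if j = k then \<delta> (i, j) else 0)))" for \<delta>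
  have pair: "(\<Sum>(i, j)\<in>S. \<delta> (i, j) * (h (orb (meet i j)) + X i + X j)) =
    (\<Sum>Q\<in>orb ` verts T. cf \<delta> (Some (Inl Q)) * h Q) + (\<Sum>k\<in>UNIV. cf \<delta> (Some (Inr k)) * X k)"
    for \<delta> :: "'n \<times> 'n \<Rightarrow> real" and h :: "nat set \<Rightarrow> real" and X :: "'n \<Rightarrow> real"
  proof -
    have 1: "(\<Sum>Q\<in>orb ` verts T. cf \<delta> (Some (Inl Q)) * h Q) = (\<Sum>(i, j)\<in>S. \<delta> (i, j) * h (orb (meet i j)))"
    proof -
      have "(\<Sum>Q\<in>orb ` verts T. cf \<delta> (Some (Inl Q)) * h Q) =
        (\<Sum>Q\<in>orb ` verts T. \<Sum>s\<in>S. if orb (meet (fst s) (snd s)) = Q then \<delta> s * h Q else 0)"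
        unfolding cf_def by (auto simp: sum_distrib_right case_prod_unfold intro!: sum.cong)
      also have "\<dots> = (\<Sum>s\<in>S. \<Sum>Q\<in>orb ` verts T. if orb (meet (fst s) (snd s)) = Q then \<delta> s * h Q else 0)"
        by (rule sum.swap)
      also have "\<dots> = (\<Sum>s\<in>S. \<delta> s * h (orb (meet (fst s) (snd s))))"
        by (rule sum.cong) (use finV in \<open>simp_all add: sum.delta\<close>)
      finally show ?thesis by (simp add: case_prod_unfold)
    qed
    have 2: "(\<Sum>k\<in>UNIV. cf \<delta> (Some (Inr k)) * X k) = (\<Sum>(i, j)\<in>S. \<delta> (i, j) * (X i + X j))"
    proof -
      have "(\<Sum>k\<in>UNIV. cf \<delta> (Some (Inr k)) * X k) =
        (\<Sum>k\<in>UNIV. \<Sum>s\<in>S. (if fst s = k then \<delta> s * X k else 0) + (if snd s = k then \<delta> s * X k else 0))"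
        unfolding cf_def by (auto simp: sum_distrib_right case_prod_unfold intro!: sum.cong)
      also have "\<dots> = (\<Sum>s\<in>S. \<Sum>k\<in>UNIV. (if fst s = k then \<delta> s * X k else 0) + (if snd s = k then \<delta> s * X k else 0))"
        by (rule sum.swap)
      also have "\<dots> = (\<Sum>s\<in>S. \<delta> s * (X (fst s) + X (snd s)))"
        by (rule sum.cong) (simp_all add: sum.distrib distrib_left)
      finally show ?thesis by (simp add: case_prod_unfold)
    qed
    show ?thesis unfolding 1 2 by (simp add: case_prod_unfold distrib_left sum.distrib add.assoc)
  qed
  have "\<exists>x\<in>J. cf \<delta> x \<noteq> 0" if d: "\<delta> \<in> \<Delta>" for \<delta>
  proof (rule ccontr)
    assume "\<not> ?thesis"
    then have c0: "cf \<delta> (Some (Inl Q)) = 0" "cf \<delta> (Some (Inr k)) = 0" if "Q \<in> orb ` verts T" for Q k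
      using that by (auto simp: J_def)
    obtain i0 j0 where s0: "(i0, j0) \<in> S" "\<delta> (i0, j0) \<noteq> 0" using nz[OF d] by auto
    \<comment> \<open>This selects a height matrix that is a unit vector on \<open>S\<close>;
      pairing it with \<delta> returns one value of \<delta>.\<close>
    have "restrict (\<lambda>s. if s = (i0, j0) then 1 else 0) S \<in> entries_proj S ` height_space"
      using S unfolding linear_indep_def by simp
    then obtain A where A: "A \<in> height_space" "restrict (\<lambda>s. if s = (i0, j0) then 1 else 0) S = entries_proj S A" by blast
    then obtain h X where hX: "A = height_matrix h X" "\<forall>v\<in>internal. h (inv v) = h v" unfolding height_space_def by blast
    have e: "(if (i, j) = (i0, j0) then 1 else 0) = h (meet i j) + X i + X j" if "(i, j) \<in> S" for i j
      using fun_cong[OF A(2), of "(i, j)"] that by (simp add: entries_proj_def hX(1) height_matrix_def split: if_splits)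
    define h' where "h' Q = h (SOME v. v \<in> Q)" for Q
    have h': "h' (orb v) = h v" if "v \<in> internal" for v
    proof -
      have "(SOME w. w \<in> orb v) \<in> orb v" by (rule someI[of _ v]) (simp add: orb_def)
      then show ?thesis using hX(2) that by (auto simp: h'_def orb_def)
    qed
    have "(\<Sum>(i, j)\<in>S. \<delta> (i, j) * (h' (orb (meet i j)) + X i + X j)) = (\<Sum>s\<in>S. if s = (i0, j0) then \<delta> s else 0)"
    proof (rule sum.cong[OF refl])
      fix s assume "s \<in> S"
      moreover obtain i j where s: "s = (i, j)" by (cases s)
      ultimately have "h' (orb (meet i j)) + X i + X j = (if s = (i0, j0) then 1 else 0)"
        using e[of i j] h'[OF meet_internal[of i j]] by simp
      then show "(case s of (i, j) \<Rightarrow> \<delta> (i, j) * (h' (orb (meet i j)) + X i + X j)) = (if s = (i0, j0) then \<delta> s else 0)"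
        by (simp add: s)
    qed
    also have "\<dots> = \<delta> (i0, j0)" using s0(1) fS by simp
    finally have "\<delta> (i0, j0) = 0" unfolding pair by (simp add: c0 finV) (metis (no_types, lifting) c0 imageI mult_zero_left root_V sum.neutral)
    with s0(2) show False by simp
  qed
  then obtain M :: nat where M: "M \<ge> 1" "\<And>\<delta>. \<delta> \<in> \<Delta> \<Longrightarrow> (\<Sum>x\<in>J. cf \<delta> x * real (M ^ idx x)) \<noteq> 0"
    using moment_curve_avoids[of "cf ` \<Delta>" J idx] fin finJ idx_inj by auto
  \<comment> \<open>As \<open>B\<close> bounds the other exponents, one step of depth outweighs the
    orbit term of the parent.\<close>
  define h where "h v = M ^ B * length (P v) + M ^ g (Inl (orb v))" for v
  define X where "X k = M ^ g (Inr k)" for k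
  have gB: "g (Inl (orb v)) \<le> B" if "v \<in> verts T" for v
    using g(1) that by (metis (no_types, lifting) imageI InlI less_imp_le mem_Collect_eq)
  have "h (par v) < h v" if v: "v \<in> verts T" "v \<noteq> root" for v
  proof -
    have "M ^ g (Inl (orb (par v))) \<le> M ^ B" using gB[OF parV[OF v]] M(1) by (rule power_increasing)
    moreover have "0 < M ^ g (Inl (orb v))" using M(1) by simp
    moreover have "length (P v) = Suc (length (P (par v)))" using v by (simp add: P_step)
    ultimately show ?thesis unfolding h_def by (simp only: mult_Suc_right)
  qed
  moreover have "h (inv v) = h v" if "v \<in> verts T" for v
    using that by (simp add: h_def orb_def P_inv insert_commute)
  moreover have "(\<Sum>(i, j)\<in>S. \<delta> (i, j) * real (h (meet i j) + X i + X j)) \<noteq> 0" if "\<delta> \<in> \<Delta>" for \<delta>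
  proof -
    have "(\<Sum>(i, j)\<in>S. \<delta> (i, j) * real (h (meet i j) + X i + X j)) =
      cf \<delta> None * real (M ^ B) + (\<Sum>(i, j)\<in>S. \<delta> (i, j) * (real (M ^ g (Inl (orb (meet i j)))) + real (X i) + real (X j)))"
    proof -
      have "cf \<delta> None * real (M ^ B) = (\<Sum>(i, j)\<in>S. \<delta> (i, j) * real (length (P (meet i j))) * real (M ^ B))"
        by (simp add: cf_def sum_distrib_right case_prod_unfold)
      moreover have "(\<Sum>(i, j)\<in>S. \<delta> (i, j) * real (h (meet i j) + X i + X j)) =
        (\<Sum>(i, j)\<in>S. \<delta> (i, j) * real (length (P (meet i j))) * real (M ^ B) +
          \<delta> (i, j) * (real (M ^ g (Inl (orb (meet i j)))) + real (X i) + real (X j)))"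
        by (rule sum.cong) (auto simp: h_def algebra_simps)
      ultimately show ?thesis by (simp add: case_prod_unfold sum.distrib)
    qed
    also have "\<dots> = (\<Sum>x\<in>J. cf \<delta> x * real (M ^ idx x))"
      using finJ0 finV unfolding J_def pair[of \<delta> "\<lambda>Q. real (M ^ g (Inl Q))" "\<lambda>k. real (X k)"]
      by (simp add: sum.reindex idx_def sum.Plus X_def)
    finally show ?thesis using M(2)[OF that] by simp
  qed
  ultimately show ?thesis by (intro exI[of _ h] exI[of _ X]) blast
qed

lemma linear_indep_imp_alg_indep:
  assumes S: "linear_indep height_space S"
  shows "alg_indep (sym_rank_le_2 :: ('k::{alg_closed_field,field_char_0}^'n^'n) set) S"
  unfolding alg_indep_iff
proof (intro ballI impI, rule ccontr)
  fix p :: "('n \<times> 'n \<Rightarrow>\<^sub>0 nat) \<Rightarrow>\<^sub>0 'k"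
  assume p: "p \<in> mpolys_on S" "p \<noteq> 0" and van: "\<forall>A\<in>sym_rank_le_2. mpoly_eval p (\<lambda>(i, j). A $ i $ j) = 0"
  have "\<exists>(h :: nat \<Rightarrow> nat) (X :: 'n \<Rightarrow> nat). (\<forall>v\<in>verts T. v \<noteq> root \<longrightarrow> h (par v) < h v) \<and> (\<forall>v\<in>verts T. h (inv v) = h v) \<and>
    (\<forall>\<delta>\<in>exponent_differences p. (\<Sum>(i, j)\<in>S. \<delta> (i, j) * real (h (meet i j) + X i + X j)) \<noteq> 0)"
    by (rule separating_heights[OF S finite_exponent_differences exponent_differences_nonzero[OF p(1)]])
  then obtain h :: "nat \<Rightarrow> nat" and X :: "'n \<Rightarrow> nat" where
    h: "\<forall>v\<in>verts T. v \<noteq> root \<longrightarrow> h (par v) < h v" "\<forall>v\<in>verts T. h (inv v) = h v"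
    and sep: "\<forall>\<delta>\<in>exponent_differences p. (\<Sum>(i, j)\<in>S. \<delta> (i, j) * real (h (meet i j) + X i + X j)) \<noteq> 0"
    by (elim exE conjE) (rule that)
  define w where "w = (\<lambda>(i, j). h (meet i j) + X i + X j)"
  have "inj_on (\<lambda>m. \<Sum>s\<in>S. w s * Poly_Mapping.lookup m s) (Poly_Mapping.keys p)"
    by (rule inj_on_weights) (use sep in \<open>simp add: w_def case_prod_unfold\<close>)
  moreover obtain U :: "'n \<times> 'n \<Rightarrow> 'k poly" where U: "\<forall>s. poly (U s) 0 \<noteq> 0"
    "\<forall>t. (\<chi> i j. t ^ (h (meet i j) + X i + X j) * poly (U (i, j)) t) \<in> sym_rank_le_2"
  proof -
    have "\<exists>U :: 'n \<times> 'n \<Rightarrow> 'k poly. (\<forall>s. poly (U s) 0 \<noteq> 0) \<and>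
      (\<forall>t. (\<chi> i j. t ^ (h (meet i j) + X i + X j) * poly (U (i, j)) t) \<in> sym_rank_le_2)"
      by (rule matrix_of_heights) (use h in blast)+
    with that show ?thesis by blast
  qed
  ultimately obtain t where t: "mpoly_eval p (\<lambda>s. t ^ w s * poly (U s) t) \<noteq> 0"
    using mpoly_eval_curve_nonzero[OF p(2,1), of w U] by auto
  let ?A = "\<chi> i j. t ^ (h (meet i j) + X i + X j) * poly (U (i, j)) t"
  have A: "(\<lambda>(i, j). ?A $ i $ j) = (\<lambda>s. t ^ w s * poly (U s) t)" by (auto simp: w_def)
  have "mpoly_eval p (\<lambda>(i, j). ?A $ i $ j) = 0" by (rule bspec[OF van spec[OF U(2)]])
  with t show False unfolding A by contradiction
qed

end

section \<open>Symbic trees with caterpillar branches\<close>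

text \<open>\<open>Tr c\<close> is the \<open>c\<close>-th trunk vertex and \<open>Br c l b\<close> the \<open>l\<close>-th internal vertex of the branch of
  colour \<open>b\<close> attached to it.\<close>

datatype 'n node = Tr nat | Br nat nat bool | Lf "'n label"

instance label :: (countable) countable by countable_datatype
instance node :: (countable) countable by countable_datatype

primrec idx :: "'n label \<Rightarrow> 'n" where
  "idx (Unprimed i) = i" | "idx (Primed i) = i"

lemma idx_swap [simp]: "idx (prime_swap x) = idx x" by (cases x) auto
lemma swap_swap [simp]: "prime_swap (prime_swap x) = x" by (cases x) auto

text \<open>Index \<open>i\<close> has position \<open>k i\<close> in group \<open>q i\<close> and
  sign \<open>s i\<close>; there are \<open>N\<close> groups, of sizes \<open>m c\<close>, and
  \<open>opp\<close> makes the last two signs of a group opposite. Since \<open>base_vertex\<close>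
  is an arbitrary choice among the trunk vertices, \<open>enc_root\<close> arranges that it falls on
  the end \<open>Tr 0\<close> of the trunk.\<close>

locale grouping =
  fixes q k :: "'n::finite \<Rightarrow> nat" and s :: "'n \<Rightarrow> bool" and N :: nat and m :: "nat \<Rightarrow> nat"
    and enc :: "'n node \<Rightarrow> nat"
  assumes qN: "q i < N" and km: "k i < m (q i)"
    and ex_at: "c < N \<Longrightarrow> l < m c \<Longrightarrow> \<exists>i. q i = c \<and> k i = l"
    and pos_inj: "q i = q j \<Longrightarrow> k i = k j \<Longrightarrow> i = j"
    and m0: "c < N \<Longrightarrow> 0 < m c"
    and opp: "q i = q j \<Longrightarrow> Suc (Suc (k i)) = m (q i) \<Longrightarrow> Suc (k j) = m (q i) \<Longrightarrow> s i \<noteq> s j"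
    and enc: "inj enc" and enc_root: "enc (Tr 0) = (SOME v. v \<in> enc ` Tr ` {..<N})"
begin

lemma N0: "0 < N" using qN by (metis gr_zeroI not_less_zero)

lemma enc_eq [simp]: "enc a = enc b \<longleftrightarrow> a = b" using enc by (auto simp: inj_def)

definition dec :: "nat \<Rightarrow> 'n node" where "dec = inv_into UNIV enc"

lemma dec_enc [simp]: "dec (enc a) = a" using enc by (simp add: dec_def)

definition elt :: "nat \<Rightarrow> nat \<Rightarrow> 'n" where "elt c l = (SOME i. q i = c \<and> k i = l)"

lemma elt: "c < N \<Longrightarrow> l < m c \<Longrightarrow> q (elt c l) = c \<and> k (elt c l) = l"
  unfolding elt_def by (rule someI_ex[OF ex_at])

lemma elt_eq: "elt (q i) (k i) = i"
  using elt[OF qN km] pos_inj by blast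

text \<open>The side of the trunk on which a leaf hangs: the unprimed leaf on the branch named by
  its sign, the primed leaf on the mirror branch.\<close>

definition bs :: "'n label \<Rightarrow> bool" where
  "bs x = (case x of Unprimed i \<Rightarrow> s i | Primed i \<Rightarrow> \<not> s i)"

lemma bs_simps [simp]: "bs (Unprimed i) = s i" "bs (Primed i) = (\<not> s i)" "bs (prime_swap x) = (\<not> bs x)"
  by (auto simp: bs_def split: label.splits)

text \<open>The leaf of index \<open>i\<close> that hangs on side \<open>b\<close>.\<close>

definition lab :: "'n \<Rightarrow> bool \<Rightarrow> 'n label" where
  "lab i b = (if s i = b then Unprimed i else Primed i)"

lemma lab_simps [simp]: "idx (lab i b) = i" "bs (lab i b) = b"
  by (auto simp: lab_def)

definition nd :: "nat \<Rightarrow> nat \<Rightarrow> bool \<Rightarrow> 'n node" where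
  "nd c l b = (case l of 0 \<Rightarrow> Tr c | Suc l' \<Rightarrow> Br c l' b)"

lemma nd_simps [simp]: "nd c 0 b = Tr c" "nd c (Suc l) b = Br c l b"
  by (auto simp: nd_def)

text \<open>The level of the vertex carrying the leaf. The cap puts the last two positions on one
  vertex, the cherry, and hangs the leaves of a group of size 1 directly on the trunk.\<close>

definition lev :: "'n \<Rightarrow> nat" where "lev i = min (Suc (k i)) (m (q i) - 1)"

definition npar :: "'n node \<Rightarrow> 'n node" where
  "npar v = (case v of Tr c \<Rightarrow> Tr (c - 1) | Br c l b \<Rightarrow> nd c l b | Lf x \<Rightarrow> nd (q (idx x)) (lev (idx x)) (bs x))"

definition spine :: "nat \<Rightarrow> nat \<Rightarrow> bool \<Rightarrow> 'n node list" where
  "spine c l b = map Tr [0..<Suc c] @ map (\<lambda>l. Br c l b) [0..<l]"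

definition npath :: "'n node \<Rightarrow> 'n node list" where
  "npath v = (case v of Tr c \<Rightarrow> spine c 0 True | Br c l b \<Rightarrow> spine c (Suc l) b
     | Lf x \<Rightarrow> spine (q (idx x)) (lev (idx x)) (bs x) @ [Lf x])"

definition ninv :: "'n node \<Rightarrow> 'n node" where
  "ninv v = (case v of Tr c \<Rightarrow> Tr c | Br c l b \<Rightarrow> Br c l (\<not> b) | Lf x \<Rightarrow> Lf (prime_swap x))"

lemma node_simps [simp]:
  "npar (Tr c) = Tr (c - 1)" "npar (Br c l b) = nd c l b" "npar (Lf x) = nd (q (idx x)) (lev (idx x)) (bs x)"
  "ninv (Tr c) = Tr c" "ninv (Br c l b) = Br c l (\<not> b)" "ninv (Lf x) = Lf (prime_swap x)"
  by (auto simp: npar_def ninv_def)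

lemma ninv_ninv [simp]: "ninv (ninv v) = v"
  by (cases v) auto

lemma npath_nd: "npath (nd c l b) = spine c l b"
  by (cases l) (auto simp: npath_def spine_def)

lemma set_npath:
  "u \<in> set (npath (Tr c)) \<longleftrightarrow> (\<exists>c'\<le>c. u = Tr c')"
  "u \<in> set (npath (Br c l b)) \<longleftrightarrow> (\<exists>c'\<le>c. u = Tr c') \<or> (\<exists>l'\<le>l. u = Br c l' b)"
  "u \<in> set (npath (Lf x)) \<longleftrightarrow> (\<exists>c'\<le>q (idx x). u = Tr c') \<or> (\<exists>l'<lev (idx x). u = Br (q (idx x)) l' (bs x)) \<or> u = Lf x"
  by (auto simp: npath_def spine_def)

definition nodes :: "'n node set" where
  "nodes = Tr ` {..<N} \<union> {Br c l b | c l b. c < N \<and> Suc l < m c} \<union> range Lf"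

lemma nodes_simps [simp]:
  "Tr c \<in> nodes \<longleftrightarrow> c < N" "Br c l b \<in> nodes \<longleftrightarrow> c < N \<and> Suc l < m c" "Lf x \<in> nodes"
  by (auto simp: nodes_def)

lemma finite_nodes: "finite nodes"
proof -
  have "{Br c l b | c l b. c < N \<and> Suc l < m c} \<subseteq> (\<lambda>(c, l, b). Br c l b) ` ((SIGMA c:{..<N}. {..<m c} \<times> UNIV))"
    by (auto simp: image_iff)
  moreover have "finite (SIGMA c:{..<N}. {..<m c} \<times> (UNIV :: bool set))" by auto
  ultimately have "finite {Br c l b :: 'n node | c l b. c < N \<and> Suc l < m c}"
    using finite_subset by blast
  moreover have "finite (range (Lf :: 'n label \<Rightarrow> _))"
  proof -
    have "(UNIV :: 'n label set) \<subseteq> range Unprimed \<union> range Primed" by (auto, metis label.exhaust rangeI)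
    then have "finite (UNIV :: 'n label set)" by (rule finite_subset) simp
    then show ?thesis by simp
  qed
  ultimately show ?thesis by (simp add: nodes_def)
qed

lemma lev_le: "lev i \<le> m (q i) - 1" by (simp add: lev_def)

lemma nd_nodes: "c < N \<Longrightarrow> l \<le> m c - 1 \<Longrightarrow> nd c l b \<in> nodes"
  using m0[of c] by (cases l) auto

lemma npar_nodes: "v \<in> nodes \<Longrightarrow> npar v \<in> nodes"
  by (cases v) (auto intro!: nd_nodes lev_le qN)

lemma npath_step: "v \<noteq> Tr 0 \<Longrightarrow> npath v = npath (npar v) @ [v]"
proof (cases v)
  case (Tr c)
  assume "v \<noteq> Tr 0"
  then obtain c' where "c = Suc c'" using Tr by (cases c) auto
  then show ?thesis using Tr by (simp add: npath_def spine_def)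
next
  case (Br c l b)
  have "npath (npar v) = spine c l b" using Br by (simp add: npath_nd)
  then show ?thesis using Br by (simp add: npath_def spine_def)
next
  case (Lf x)
  then show ?thesis by (simp add: npath_nd) (simp add: npath_def)
qed

section \<open>The labelled tree of a grouping\<close>

definition vs :: "nat set" where "vs = enc ` nodes"
definition rt :: nat where "rt = enc (Tr 0)"
definition pr :: "nat \<Rightarrow> nat" where "pr v = enc (npar (dec v))"
definition pt :: "nat \<Rightarrow> nat list" where "pt v = map enc (npath (dec v))"

lemma enc_rt [simp]: "enc v = rt \<longleftrightarrow> v = Tr 0" by (simp add: rt_def)

sublocale g: rtree vs rt pr pt
proof
  show "finite vs" using finite_nodes by (simp add: vs_def)
  show "rt \<in> vs" using N0 by (simp add: vs_def rt_def)
  show "pt rt = [rt]" by (simp add: pt_def rt_def npath_def spine_def)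
  fix v assume "v \<in> vs" "v \<noteq> rt"
  then obtain u where u: "u \<in> nodes" "v = enc u" "u \<noteq> Tr 0" by (auto simp: vs_def)
  show "pr v \<in> vs" using npar_nodes[OF u(1)] u(2) by (simp add: pr_def vs_def)
  show "pt v = pt (pr v) @ [v]" using npath_step[OF u(3)] u(2) by (simp add: pt_def pr_def)
qed

lemma vs_iff [simp]: "enc v \<in> vs \<longleftrightarrow> v \<in> nodes"
  by (auto simp: vs_def)

lemma children_iff: "enc w \<in> g.children (enc v) \<longleftrightarrow> w \<in> nodes \<and> w \<noteq> Tr 0 \<and> npar w = v"
  by (simp add: g.children_def pr_def)

lemma desc_iff: "enc w \<in> g.desc (enc v) \<longleftrightarrow> w \<in> nodes \<and> v \<in> set (npath w)"
  by (auto simp: g.desc_def pt_def)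

definition tree :: "(nat, 'n) labelled_tree" where
  "tree = \<lparr>verts = vs, edges = g.E, leaf = (\<lambda>x. enc (Lf x)), invol = (\<lambda>v. enc (ninv (dec v)))\<rparr>"

lemma tree_simps [simp]: "verts tree = vs" "edges tree = g.E" "leaf tree = (\<lambda>x. enc (Lf x))" "invol tree (enc v) = enc (ninv v)"
  by (auto simp: tree_def)

lemma ninv_nodes [simp]: "ninv v \<in> nodes \<longleftrightarrow> v \<in> nodes"
  by (cases v) auto

lemma npar_ninv: "npar (ninv v) = ninv (npar v)"
proof -
  have "ninv (nd c l b) = nd c l (\<not> b)" for c l b by (cases l) auto
  then show ?thesis by (cases v) auto
qed

lemma valency_tree: "v \<in> nodes \<Longrightarrow> valency tree (enc v) = card (g.children (enc v)) + (if v = Tr 0 then 0 else 1)"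
  using g.card_edges[of "enc v"] by (simp add: valency_def)

text \<open>The child of \<open>Tr c\<close> through which the branch on side \<open>b\<close>
  leaves the trunk.\<close>

definition first :: "nat \<Rightarrow> bool \<Rightarrow> 'n node" where
  "first c b = (if m c = 1 then Lf (lab (elt c 0) b) else Br c 0 b)"

lemma first_children: "c < N \<Longrightarrow> enc (first c b) \<in> g.children (enc (Tr c))"
  using elt[of c 0] m0[of c] by (auto simp: children_iff first_def lev_def)

lemma first_desc: "enc (Lf x) \<in> g.desc (enc (first (q (idx x)) (bs x)))"
proof (cases "m (q (idx x)) = 1")
  case True
  have "k (idx x) = 0" using km[of "idx x"] True by simp
  then have "idx x = elt (q (idx x)) 0" using elt_eq[of "idx x"] by simp
  then have "lab (elt (q (idx x)) 0) (bs x) = x" by (cases x) (auto simp: lab_def)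
  then show ?thesis using True by (simp add: first_def desc_iff set_npath)
next
  case False
  then have "lev (idx x) > 0" using m0[OF qN, of "idx x"] by (simp add: lev_def)
  then show ?thesis using False by (auto simp: first_def desc_iff set_npath)
qed

text \<open>The child of \<open>Br c l b\<close> besides the leaf at position
  \<open>l\<close>.\<close>

definition second :: "nat \<Rightarrow> nat \<Rightarrow> bool \<Rightarrow> 'n node" where
  "second c l b = (if Suc (Suc l) = m c then Lf (lab (elt c (Suc l)) b) else Br c (Suc l) b)"

lemma Br_children:
  assumes "c < N" "Suc l < m c"
  shows "enc (Lf (lab (elt c l) b)) \<in> g.children (enc (Br c l b))" "enc (second c l b) \<in> g.children (enc (Br c l b))"
    "Lf (lab (elt c l) b) \<noteq> second c l b"
proof -
  have a: "q (elt c l) = c" "k (elt c l) = l" "q (elt c (Suc l)) = c" "k (elt c (Suc l)) = Suc l"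
    using elt[of c l] elt[of c "Suc l"] assms by auto
  have "lev (elt c l) = Suc l" using assms(2) a by (simp add: lev_def)
  then show "enc (Lf (lab (elt c l) b)) \<in> g.children (enc (Br c l b))" using a by (simp add: children_iff)
  have "lev (elt c (Suc l)) = Suc l" if "Suc (Suc l) = m c" using that a by (simp add: lev_def)
  then show "enc (second c l b) \<in> g.children (enc (Br c l b))"
    using assms a by (auto simp: children_iff second_def)
  have "elt c l \<noteq> elt c (Suc l)" using a by (metis n_not_Suc_n)
  then show "Lf (lab (elt c l) b) \<noteq> second c l b"
    by (auto simp: second_def lab_def split: if_splits)
qed

lemma fin_children: "finite (g.children v)"
  using g.finV by (simp add: g.children_def)

lemma two_children: "x \<in> g.children v \<Longrightarrow> y \<in> g.children v \<Longrightarrow> x \<noteq> y \<Longrightarrow> 2 \<le> card (g.children v)"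
  using card_mono[OF fin_children, of "{x, y}" v] by simp

lemma valency_Lf: "valency tree (enc (Lf x)) = 1"
proof -
  have "g.children (enc (Lf x)) = {}"
  proof -
    have "npar v \<noteq> Lf x" for v by (cases v) (auto simp: nd_def split: nat.split)
    then show ?thesis by (auto simp: g.children_def pr_def)
  qed
  then show ?thesis by (simp add: valency_tree)
qed

lemma valency_Br: "Br c l b \<in> nodes \<Longrightarrow> valency tree (enc (Br c l b)) \<ge> 3"
  using two_children[OF Br_children(1,2)[of c l b]] Br_children(3)[of c l b] by (simp add: valency_tree)

lemma first_neq: "first c True \<noteq> first c False"
  unfolding first_def lab_def by auto

text \<open>There are always two mirror children. Degree 2 excludes a parent as well as a further
  trunk child, so the trunk is a single vertex.\<close>

lemma valency_Tr:
  assumes "c < N"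
  shows "valency tree (enc (Tr c)) \<ge> 2" "valency tree (enc (Tr c)) = 2 \<Longrightarrow> N = 1"
proof -
  have ch: "enc (first c True) \<in> g.children (enc (Tr c))" "enc (first c False) \<in> g.children (enc (Tr c))"
    using first_children[OF assms] by auto
  have 2: "2 \<le> card (g.children (enc (Tr c)))" using two_children[OF ch] first_neq by simp
  then show "valency tree (enc (Tr c)) \<ge> 2" using assms by (simp add: valency_tree)
  assume v: "valency tree (enc (Tr c)) = 2"
  show "N = 1"
  proof (rule ccontr)
    assume "N \<noteq> 1"
    have "c = 0" using v 2 assms by (auto simp: valency_tree split: if_splits)
    then have "enc (Tr 1) \<in> g.children (enc (Tr c))" using \<open>N \<noteq> 1\<close> N0 by (simp add: children_iff)
    then have "{enc (first c True), enc (first c False), enc (Tr 1)} \<subseteq> g.children (enc (Tr c))" using ch by simp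
    from card_mono[OF fin_children this] have "3 \<le> card (g.children (enc (Tr c)))"
      using first_neq by (simp add: first_def split: if_splits)
    with v \<open>c = 0\<close> assms show False by (simp add: valency_tree)
  qed
qed

lemma leaves_tree: "leaves tree = range (\<lambda>x. enc (Lf x))"
proof -
  have iff: "valency tree (enc v) = 1 \<longleftrightarrow> v \<in> range Lf" if "v \<in> nodes" for v
  proof (cases v)
    case (Tr c)
    then show ?thesis using valency_Tr(1)[of c] that by auto
  next
    case (Br c l b)
    then show ?thesis using valency_Br[of c l b] that by auto
  qed (simp add: valency_Lf)
  have "leaves tree = {u \<in> enc ` nodes. valency tree u = 1}" by (simp add: leaves_def vs_def)
  also have "\<dots> = enc ` {v \<in> nodes. valency tree (enc v) = 1}" by blast
  also have "{v \<in> nodes. valency tree (enc v) = 1} = range Lf" using iff nodes_simps(3) by blast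
  finally show ?thesis by (simp add: image_image)
qed

lemma trunk_tree: "trunk tree = enc ` Tr ` {..<N}"
proof -
  have "ninv v = v \<longleftrightarrow> v \<in> range Tr" for v
  proof (cases v)
    case (Lf x)
    then show ?thesis by (cases x) auto
  qed auto
  then show ?thesis by (auto simp: trunk_def vs_def)
qed

lemma edge_inv: "{u, v} \<in> g.E \<Longrightarrow> {invol tree u, invol tree v} \<in> g.E"
proof -
  have *: "{enc (ninv w), enc (ninv (npar w))} \<in> g.E" if "w \<in> nodes" "w \<noteq> Tr 0" for w
  proof -
    have "ninv w \<noteq> Tr 0" using that(2) by (cases w) auto
    then have "{enc (ninv w), pr (enc (ninv w))} \<in> g.E" using that(1) by (intro g.edgeI) auto
    then show ?thesis by (simp add: pr_def npar_ninv)
  qed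
  assume "{u, v} \<in> g.E"
  then show ?thesis
  proof (cases rule: g.edge_cases)
    case 1
    then obtain w where "u = enc w" "w \<in> nodes" "w \<noteq> Tr 0" by (auto simp: vs_def)
    then show ?thesis using *[of w] 1 by (simp add: pr_def)
  next
    case 2
    then obtain w where "v = enc w" "w \<in> nodes" "w \<noteq> Tr 0" by (auto simp: vs_def)
    then show ?thesis using *[of w] 2 by (simp add: pr_def insert_commute)
  qed
qed

lemma internal_edge_cases:
  assumes "e \<in> internal_edges tree"
  obtains v where "v \<in> nodes" "v \<notin> range Lf" "v \<noteq> Tr 0" "e = {enc v, pr (enc v)}"
proof -
  from assms obtain u where u: "u \<in> vs" "u \<noteq> rt" "e = {u, pr u}" "e \<inter> leaves tree = {}"
    by (auto simp: internal_edges_def g.E_def)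
  then obtain v where v: "u = enc v" "v \<in> nodes" "v \<noteq> Tr 0" by (auto simp: vs_def)
  have "enc v \<notin> leaves tree" using u(3,4) v(1) by blast
  then have "v \<notin> range Lf" by (auto simp: leaves_tree)
  then show ?thesis using u(3) v by (intro that) simp_all
qed

lemma side_tree:
  assumes "v \<in> nodes" "v \<noteq> Tr 0"
  shows "side tree {enc v, pr (enc v)} (enc v) = g.desc (enc v)"
    "side tree {enc v, pr (enc v)} (pr (enc v)) = vs - g.desc (enc v)"
  unfolding side_def tree_simps
  by (rule g.side_child g.side_parent; simp add: assms)+

lemma last_two:
  assumes "c < N" "1 < m c"
  shows "\<exists>i j. q i = c \<and> q j = c \<and> k i = m c - 2 \<and> k j = m c - 1 \<and> s i \<noteq> s j"
proof -
  let ?i = "elt c (m c - 2)" and ?j = "elt c (m c - 1)"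
  have "q ?i = c" "k ?i = m c - 2" "q ?j = c" "k ?j = m c - 1" using elt[of c] assms by auto
  moreover from this have "s ?i \<noteq> s ?j" using opp[of ?i ?j] assms(2) by simp
  ultimately show ?thesis by blast
qed

lemma Lf_desc_Br: "enc (Lf x) \<in> g.desc (enc (Br c l b)) \<longleftrightarrow> q (idx x) = c \<and> l < lev (idx x) \<and> bs x = b"
  by (auto simp: desc_iff set_npath)

lemma Lf_desc_Tr: "enc (Lf x) \<in> g.desc (enc (Tr c)) \<longleftrightarrow> c \<le> q (idx x)"
  by (auto simp: desc_iff set_npath)

lemma two_colors:
  assumes "s i \<noteq> s j" "lab i b \<in> A" "lab j b \<in> A"
  shows "(\<exists>i. Unprimed i \<in> A) \<and> (\<exists>j. Primed j \<in> A)"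
  using assms by (auto simp: lab_def split: if_splits)

text \<open>A trunk edge separates whole groups, each containing both leaves of its indices. An edge
  inside a branch has the last two leaves of the group below it, which differ in colour by
  \<open>opp\<close>, and their mirror images above it.\<close>

lemma split_colors_tree:
  assumes "Q \<in> splits tree" "A \<in> Q"
  shows "(\<exists>i. Unprimed i \<in> A) \<and> (\<exists>j. Primed j \<in> A)"
proof -
  obtain v where v: "v \<in> nodes" "v \<notin> range Lf" "v \<noteq> Tr 0" "A = {x. enc (Lf x) \<in> g.desc (enc v)} \<or> A = {x. enc (Lf x) \<notin> g.desc (enc v)}"
  proof -
    obtain e where e: "e \<in> internal_edges tree" "A \<in> split tree e" using assms by (auto simp: splits_def)
    then obtain v where v: "v \<in> nodes" "v \<notin> range Lf" "v \<noteq> Tr 0" "e = {enc v, pr (enc v)}" using internal_edge_cases by blast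
    have "A = {x. enc (Lf x) \<in> g.desc (enc v)} \<or> A = {x. enc (Lf x) \<notin> g.desc (enc v)}"
      using e(2) side_tree[OF v(1,3)] by (auto simp: split_def v(4))
    with v that show ?thesis by blast
  qed
  show ?thesis
  proof (cases v)
    case (Tr c)
    then have c: "0 < c" "c < N" using v by auto
    have A: "q (elt c 0) = c" "q (elt 0 0) = 0" using elt[of c 0] elt[of 0 0] m0 c N0 by auto
    from v(4) show ?thesis
    proof
      assume "A = {x. enc (Lf x) \<in> g.desc (enc v)}"
      then have "Unprimed (elt c 0) \<in> A" "Primed (elt c 0) \<in> A" using A Tr by (auto simp: Lf_desc_Tr)
      then show ?thesis by blast
    next
      assume "A = {x. enc (Lf x) \<notin> g.desc (enc v)}"
      then have "Unprimed (elt 0 0) \<in> A" "Primed (elt 0 0) \<in> A" using A Tr c by (auto simp: Lf_desc_Tr)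
      then show ?thesis by blast
    qed
  next
    case (Br c l b)
    then have c: "c < N" "Suc l < m c" using v(1) by auto
    obtain i j where ij: "q i = c" "q j = c" "k i = m c - 2" "k j = m c - 1" "s i \<noteq> s j" using last_two[of c] c by auto
    have lv: "l < lev i" "l < lev j" using ij c by (auto simp: lev_def)
    from v(4) show ?thesis
    proof
      assume "A = {x. enc (Lf x) \<in> g.desc (enc v)}"
      then show ?thesis using ij lv Br by (intro two_colors[OF ij(5), of b]) (auto simp: Lf_desc_Br)
    next
      assume "A = {x. enc (Lf x) \<notin> g.desc (enc v)}"
      then show ?thesis using Br by (intro two_colors[OF ij(5), of "\<not> b"]) (auto simp: Lf_desc_Br)
    qed
  qed (use v(2) in auto)
qed

lemma symbic_tree_tree: "symbic_tree tree"
  unfolding symbic_tree_def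
proof (intro conjI)
  show "is_tree (verts tree) (edges tree)" using g.tree by simp
  show "bij_betw (leaf tree) UNIV (leaves tree)"
    by (simp add: bij_betw_def leaves_tree inj_def)
  show "\<forall>v\<in>verts tree. invol tree v \<in> verts tree \<and> invol tree (invol tree v) = v"
    by (auto simp: vs_def)
  show "\<forall>u\<in>verts tree. \<forall>v\<in>verts tree. {invol tree u, invol tree v} \<in> edges tree \<longleftrightarrow> {u, v} \<in> edges tree"
  proof (intro ballI iffI)
    fix u v assume uv: "u \<in> verts tree" "v \<in> verts tree"
    then have ii: "invol tree (invol tree u) = u" "invol tree (invol tree v) = v" by (auto simp: vs_def)
    show "{invol tree u, invol tree v} \<in> edges tree \<Longrightarrow> {u, v} \<in> edges tree"
      using edge_inv[of "invol tree u" "invol tree v"] unfolding ii by simp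
    show "{u, v} \<in> edges tree \<Longrightarrow> {invol tree u, invol tree v} \<in> edges tree"
      using edge_inv[of u v] by simp
  qed
  show "\<forall>x. invol tree (leaf tree x) = leaf tree (prime_swap x)" by simp
  show "\<exists>p. is_path (verts tree) (edges tree) p \<and> set p = trunk tree"
  proof (intro exI conjI)
    have "enc (Tr (N - 1)) \<in> vs" using N0 by simp
    from g.path_P[OF this] show "is_path (verts tree) (edges tree) (pt (enc (Tr (N - 1))))"
      by (simp add: path_between_def)
    show "set (pt (enc (Tr (N - 1)))) = trunk tree"
      using N0 by (auto simp: pt_def trunk_tree npath_def spine_def)
  qed
  show "\<forall>v\<in>verts tree. valency tree v = 2 \<longrightarrow> trunk tree = {v}"
  proof (intro ballI impI)
    fix v assume "v \<in> verts tree" and v2: "valency tree v = 2"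
    then obtain u where u: "u \<in> nodes" "v = enc u" by (auto simp: vs_def)
    show "trunk tree = {v}"
    proof (cases u)
      case (Tr c)
      then have c: "c < N" "N = 1" using valency_Tr(2)[of c] v2 u by auto
      then have "{..<N} = {0}" "c = 0" by auto
      then show ?thesis using u Tr unfolding trunk_tree by simp
    next
      case (Br c l b)
      then show ?thesis using valency_Br[of c l b] v2 u by simp
    next
      case (Lf x)
      then show ?thesis using valency_Lf[of x] v2 u by simp
    qed
  qed
  show "\<forall>Q\<in>splits tree. \<forall>A\<in>Q. (\<exists>i. Unprimed i \<in> A) \<and> (\<exists>j. Primed j \<in> A)"
    using split_colors_tree by blast
qed

lemma cherry_iff: "(i, j) \<in> cherries tree \<longleftrightarrow> npar (Lf (Unprimed i)) = npar (Lf (Primed j))"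
proof -
  have e: "{w, enc (Lf x)} \<in> g.E \<longleftrightarrow> w = enc (npar (Lf x))" for w x
  proof
    assume "{w, enc (Lf x)} \<in> g.E"
    then show "w = enc (npar (Lf x))"
    proof (cases rule: g.edge_cases)
      case 1
      then obtain u where "w = enc u" "npar u = Lf x" by (auto simp: vs_def pr_def)
      then show ?thesis by (cases u) (auto simp: nd_def split: nat.splits)
    qed (simp add: pr_def)
  next
    assume "w = enc (npar (Lf x))"
    then show "{w, enc (Lf x)} \<in> g.E" using g.edgeI'[of "enc (Lf x)"] by (simp add: pr_def)
  qed
  have "enc (npar (Lf x)) \<in> vs - leaves tree" for x
    using npar_nodes[of "Lf x"] by (auto simp: leaves_tree nd_def split: nat.splits)
  then show ?thesis unfolding cherries_def by (auto simp: e simp del: node_simps)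
qed

text \<open>Inside a branch two leaves share a vertex only at its end, where the last two positions
  of the group meet; a group of size 1 has single leaf edges as branches.\<close>

lemma caterpillar_tree: "caterpillar_branches tree"
  unfolding caterpillar_branches_def
proof
  fix B assume "B \<in> branches tree"
  then obtain t u where tu: "t \<in> trunk tree" "u \<notin> trunk tree" "{t, u} \<in> g.E" "B = insert t (side tree {t, u} u)"
    unfolding branches_def by auto
  obtain c where c: "t = enc (Tr c)" "c < N" using tu(1) by (auto simp: trunk_tree)
  have pu: "u \<in> vs \<and> u \<noteq> rt \<and> t = pr u"
    using tu(3)
  proof (cases rule: g.edge_cases)
    case 1
    then have "u \<in> trunk tree" using c by (auto simp: pr_def trunk_tree)
    with tu(2) show ?thesis by simp
  qed simp
  then obtain v where v: "u = enc v" "v \<in> nodes" "v \<noteq> Tr 0" "npar v = Tr c" using c by (auto simp: vs_def pr_def)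
  have "{t, u} = {enc v, pr (enc v)}" using pu v(1) by auto
  then have B: "B = insert t (g.desc (enc v))" using side_tree[OF v(2,3)] tu(4) v(1) by simp
  show "caterpillar_branch tree B"
  proof (cases v)
    case (Tr c')
    then show ?thesis using tu(2) v by (auto simp: trunk_tree)
  next
    case (Lf x)
    have "g.desc (enc (Lf x)) = {enc (Lf x)}"
    proof -
      have "w = Lf x" if "Lf x \<in> set (npath w)" for w using that by (cases w) (auto simp: set_npath)
      then have "u \<in> g.desc (enc (Lf x)) \<longleftrightarrow> u = enc (Lf x)" if uvs: "u \<in> vs" for u
      proof -
        obtain w where "u = enc w" using uvs by (auto simp: vs_def)
        then show ?thesis using \<open>\<And>w. _ \<Longrightarrow> w = Lf x\<close> by (auto simp: desc_iff set_npath)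
      qed
      moreover have "g.desc (enc (Lf x)) \<subseteq> vs" by (auto simp: g.desc_def)
      ultimately show ?thesis using vs_iff nodes_simps(3) by blast
    qed
    then have "B = {t, leaf tree x}" using B Lf by auto
    then show ?thesis using tu(1) unfolding caterpillar_branch_def by blast
  next
    case (Br c' l b)
    then have l: "l = 0" "c' = c" "Suc 0 < m c" using v(2,4) by (cases l; auto)+
    have inB: "enc (Lf x) \<in> B \<longleftrightarrow> q (idx x) = c \<and> 0 < lev (idx x) \<and> bs x = b" for x
      unfolding B Br l by (auto simp: c Lf_desc_Br)
    obtain i1 i2 where i: "q i1 = c" "q i2 = c" "k i1 = m c - 2" "k i2 = m c - 1" "s i1 \<noteq> s i2" using last_two[of c] c l by auto
    \<comment> \<open>Which of the last two leaves is unprimed depends on the side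
      \<open>b\<close>.\<close>
    define i0 j0 where "i0 = (if s i1 = b then i1 else i2)" and "j0 = (if s i1 = b then i2 else i1)"
    have "{(i, j) \<in> cherries tree. leaf tree (Unprimed i) \<in> B \<and> leaf tree (Primed j) \<in> B} = {(i0, j0)}"
    proof (intro set_eqI iffI; clarify)
      fix i j assume ij: "(i, j) \<in> cherries tree" "leaf tree (Unprimed i) \<in> B" "leaf tree (Primed j) \<in> B"
      have a: "q i = c" "q j = c" "s i = b" "s j = (\<not> b)" "0 < lev i" "0 < lev j"
        using ij(2,3) by (auto simp: inB)
      have "nd c (lev i) b = nd c (lev j) b" using ij(1) a by (simp add: cherry_iff)
      then have "lev i = lev j" using a(5,6) by (cases "lev i"; cases "lev j"; simp)
      moreover have "k i \<noteq> k j" using pos_inj[of i j] a by auto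
      moreover have "k i < m c" "k j < m c" using km[of i] km[of j] a by auto
      ultimately have "k i = m c - 2 \<and> k j = m c - 1 \<or> k i = m c - 1 \<and> k j = m c - 2"
        using a by (auto simp: lev_def min_def split: if_splits)
      then show "i = i0 \<and> j = j0"
      proof
        assume "k i = m c - 2 \<and> k j = m c - 1"
        then have "i = i1" "j = i2" using pos_inj i a by auto
        then show ?thesis using a by (simp add: i0_def j0_def)
      next
        assume "k i = m c - 1 \<and> k j = m c - 2"
        then have "i = i2" "j = i1" using pos_inj i a by auto
        then show ?thesis using a by (auto simp: i0_def j0_def)
      qed
    next
      have lv: "lev i1 = m c - 1" "lev i2 = m c - 1" using i l(3) by (auto simp: lev_def)
      then have "(i0, j0) \<in> cherries tree" using i by (auto simp: cherry_iff i0_def j0_def)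
      moreover have "leaf tree (Unprimed i0) \<in> B" "leaf tree (Primed j0) \<in> B"
        using i lv l(3) by (auto simp: inB i0_def j0_def)
      ultimately show "(i0, j0) \<in> cherries tree \<and> leaf tree (Unprimed i0) \<in> B \<and> leaf tree (Primed j0) \<in> B" by blast
    qed
    then show ?thesis unfolding caterpillar_branch_def by simp
  qed
qed

section \<open>Meeting vertices and regularity of the constructed tree\<close>

sublocale sy: symbic tree
  by unfold_locales (rule symbic_tree_tree)

lemma sy_root: "sy.root = rt"
  unfolding sy.root_def base_vertex_def trunk_tree rt_def enc_root ..

lemma sy_P: "v \<in> vs \<Longrightarrow> sy.P v = pt v"
proof -
  assume v: "v \<in> vs"
  have "path_between (verts tree) (edges tree) sy.root (sy.P v) v"
    using sy.path_P[of v] v unfolding sy.E_edges by simp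
  then have "path_between vs g.E rt (sy.P v) v" by (simp add: sy_root)
  then show ?thesis by (simp add: g.path_r_iff)
qed

lemma sy_par: "v \<in> vs \<Longrightarrow> v \<noteq> rt \<Longrightarrow> sy.par v = pr v"
  unfolding sy.par_def using sy_P g.P_step[of v] g.parV[of v] by simp

lemma sy_children: "sy.children v = g.children v"
  unfolding sy.children_def g.children_def using sy_par by (auto simp: sy_root)

lemma sy_desc: "sy.desc v = g.desc v"
  unfolding sy.desc_def g.desc_def using sy_P by auto

lemma sy_internal: "enc v \<in> sy.internal \<longleftrightarrow> v \<in> nodes \<and> v \<notin> range Lf"
  by (auto simp: sy.internal_def leaves_tree)

text \<open>Inside a group the primed leaf of \<open>j\<close> shares the branch of the unprimed
  leaf of \<open>i\<close> exactly when the signs differ; equal signs put them on mirror branches,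
  which meet on the trunk.\<close>

definition meet_node :: "'n \<Rightarrow> 'n \<Rightarrow> 'n node" where
  "meet_node i j = (if q i \<noteq> q j then Tr (min (q i) (q j)) else if s i = s j then Tr (q i)
     else Br (q i) (min (k i) (k j)) (s i))"

lemma meet_lt:
  assumes "q i < q j"
  shows "sy.meet i j = enc (Tr (q i))"
proof (rule sy.meet_eqI)
  show "enc (first (q i) (s i)) \<in> sy.children (enc (Tr (q i)))"
    unfolding sy_children using first_children qN by blast
  show "enc (Tr (Suc (q i))) \<in> sy.children (enc (Tr (q i)))"
    unfolding sy_children using assms qN[of j] by (simp add: children_iff)
  show "leaf tree (Unprimed i) \<in> sy.desc (enc (first (q i) (s i)))"
    unfolding sy_desc using first_desc[of "Unprimed i"] by simp
  show "leaf tree (Primed j) \<in> sy.desc (enc (Tr (Suc (q i))))"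
    unfolding sy_desc using assms by (simp add: Lf_desc_Tr)
qed (auto simp: first_def)

lemma meet_same:
  assumes "q i = q j" "s i = s j"
  shows "sy.meet i j = enc (Tr (q i))"
proof (rule sy.meet_eqI)
  show "enc (first (q i) (s i)) \<in> sy.children (enc (Tr (q i)))" "enc (first (q i) (\<not> s i)) \<in> sy.children (enc (Tr (q i)))"
    unfolding sy_children using first_children qN by blast+
  show "leaf tree (Unprimed i) \<in> sy.desc (enc (first (q i) (s i)))"
    unfolding sy_desc using first_desc[of "Unprimed i"] by simp
  show "leaf tree (Primed j) \<in> sy.desc (enc (first (q i) (\<not> s i)))"
    unfolding sy_desc using first_desc[of "Primed j"] assms by simp
  show "enc (first (q i) (s i)) \<noteq> enc (first (q i) (\<not> s i))"
    using first_neq[of "q i"] by (cases "s i") auto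
qed

lemma meet_opposite:
  assumes "q i = q j" "s i \<noteq> s j" "k i < k j"
  shows "sy.meet i j = enc (Br (q i) (k i) (s i))"
proof (rule sy.meet_eqI)
  have c: "q i < N" "Suc (k i) < m (q i)" using qN km[of j] assms by auto
  have "lab (elt (q i) (k i)) (s i) = Unprimed i" by (simp add: elt_eq lab_def)
  then show "enc (Lf (Unprimed i)) \<in> sy.children (enc (Br (q i) (k i) (s i)))"
    "enc (second (q i) (k i) (s i)) \<in> sy.children (enc (Br (q i) (k i) (s i)))"
    "enc (Lf (Unprimed i)) \<noteq> enc (second (q i) (k i) (s i))"
    unfolding sy_children using Br_children[OF c, of "s i"] by auto
  show "leaf tree (Unprimed i) \<in> sy.desc (enc (Lf (Unprimed i)))"
    unfolding sy_desc by (simp add: desc_iff set_npath)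
  show "leaf tree (Primed j) \<in> sy.desc (enc (second (q i) (k i) (s i)))"
  proof (cases "Suc (Suc (k i)) = m (q i)")
    case True
    then have "k j = Suc (k i)" using assms km[of j] by simp
    then have "elt (q i) (Suc (k i)) = j" using elt_eq[of j] assms(1) by simp
    then have "second (q i) (k i) (s i) = Lf (Primed j)" using True assms(2) by (simp add: second_def lab_def)
    then show ?thesis unfolding sy_desc by (simp add: desc_iff set_npath)
  next
    case False
    then have "Suc (k i) < lev j" using assms c km[of j] by (auto simp: lev_def)
    then show ?thesis unfolding sy_desc using False assms by (simp add: second_def Lf_desc_Br)
  qed
qed

lemma meet_eq: "sy.meet i j = enc (meet_node i j)"
proof -
  have inv: "sy.meet i j = enc (ninv v)" if "sy.meet j i = enc v" for v
    using sy.inv_meet[of j i] that by simp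
  consider "q i < q j" | "q j < q i" | "q i = q j" "s i = s j" | "q i = q j" "s i \<noteq> s j" "k i < k j"
    | "q i = q j" "s i \<noteq> s j" "k j < k i" | "q i = q j" "s i \<noteq> s j" "k i = k j" by linarith
  then show ?thesis
  proof cases
    case 5
    then show ?thesis using inv[OF meet_opposite[of j i]] by (auto simp: meet_node_def)
  next
    case 6
    then show ?thesis using pos_inj[of i j] by simp
  next
    case 2
    then show ?thesis using inv[OF meet_lt[of j i]] by (simp add: meet_node_def)
  qed (simp_all add: meet_node_def meet_same meet_opposite meet_lt)
qed

text \<open>Every index gives the orbit of the vertex of level \<open>k i\<close> at trunk vertex
  \<open>q i\<close>. Position 0 of group 0 gives the root, which leaves n - 1 orbits.\<close>

lemma regular_tree: "regular tree"
  unfolding sy.regular_iff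
proof -
  define f where "f i = {enc (nd (q i) (k i) True), enc (nd (q i) (k i) False)}" for i
  let ?o = "elt 0 0"
  have o: "q ?o = 0" "k ?o = 0" using elt[of 0 0] N0 m0 by auto
  have nd_inj: "nd (q i) (k i) b = nd (q j) (k j) b' \<Longrightarrow> i = j" for i j b b'
    using pos_inj[of i j] by (cases "k i"; cases "k j"; simp)
  have "sy.orbits = f ` (UNIV - {?o})"
  proof
    show "sy.orbits \<subseteq> f ` (UNIV - {?o})"
    proof
      fix Q assume "Q \<in> sy.orbits"
      then obtain v where v: "v \<in> sy.internal" "v \<noteq> rt" "Q = {v, invol tree v}" by (auto simp: sy.orbits_def sy_root)
      have "v \<in> vs" using v(1) by (simp add: sy.internal_def)
      then obtain u where "v = enc u" by (auto simp: vs_def)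
      with v have u: "u \<in> nodes" "u \<notin> range Lf" "u \<noteq> Tr 0" "Q = {enc u, enc (ninv u)}"
        by (simp_all add: sy_internal)
      show "Q \<in> f ` (UNIV - {?o})"
      proof (cases u)
        case (Tr c)
        then have a: "q (elt c 0) = c" "k (elt c 0) = 0" "c \<noteq> 0" using elt[of c 0] m0 u by auto
        then have "Q = f (elt c 0)" using u Tr by (simp add: f_def)
        moreover have "elt c 0 \<noteq> ?o" using a o by auto
        ultimately show ?thesis by blast
      next
        case (Br c l b)
        then have a: "q (elt c (Suc l)) = c" "k (elt c (Suc l)) = Suc l" using elt[of c "Suc l"] u by auto
        then have "Q = f (elt c (Suc l))" using u Br by (cases b) (auto simp: f_def)
        moreover have "elt c (Suc l) \<noteq> ?o" using a o by auto
        ultimately show ?thesis by blast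
      qed (use u in auto)
    qed
    show "f ` (UNIV - {?o}) \<subseteq> sy.orbits"
    proof
      fix Q assume "Q \<in> f ` (UNIV - {?o})"
      then obtain i where i: "i \<noteq> ?o" "Q = f i" by blast
      let ?u = "nd (q i) (k i) True"
      have "?u \<in> nodes" using nd_nodes[OF qN, of "k i" i] km[of i] by simp
      moreover have "?u \<notin> range Lf" by (cases "k i") auto
      moreover have "?u \<noteq> Tr 0" using i(1) pos_inj[of i ?o] o by (cases "k i") auto
      moreover have "ninv ?u = nd (q i) (k i) False" by (cases "k i") auto
      ultimately show "Q \<in> sy.orbits"
        unfolding sy.orbits_def by (intro image_eqI[of _ _ "enc ?u"]) (auto simp: i(2) f_def sy_internal sy_root)
    qed
  qed
  moreover have "inj_on f (UNIV - {?o})"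
  proof (rule inj_onI)
    fix i j assume "f i = f j"
    then have "enc (nd (q i) (k i) True) \<in> f j" unfolding f_def by blast
    then show "i = j" using nd_inj by (auto simp: f_def)
  qed
  ultimately show "card sy.orbits = CARD('n) - 1"
    by (simp add: card_image card_Diff_singleton)
qed

end

section \<open>From relations to symbic trees\<close>

lemma sum_filter:
  fixes f :: "'a::finite \<Rightarrow> 'b::finite \<Rightarrow> 'c::comm_monoid_add"
  shows "(\<Sum>i | A i. \<Sum>j | B j. f i j) = (\<Sum>i\<in>UNIV. \<Sum>j\<in>UNIV. if A i \<and> B j then f i j else 0)"
proof -
  have "(\<Sum>i | A i. \<Sum>j | B j. f i j) = (\<Sum>i\<in>UNIV. if A i then (\<Sum>j\<in>UNIV. if B j then f i j else 0) else 0)"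
    by (simp add: sum.inter_filter[of UNIV, simplified, symmetric])
  also have "\<dots> = (\<Sum>i\<in>UNIV. \<Sum>j\<in>UNIV. if A i \<and> B j then f i j else 0)"
    by (rule sum.cong) (auto intro!: sum.cong)
  finally show ?thesis .
qed

context grouping
begin

text \<open>An annihilator of the height space is tested against indicators of vertex orbits and of
  single indices. This yields the trunk, branch and row relations for its symmetrisation, which
  therefore vanishes. As \<open>S\<close> contains at most one of two transposed positions, the
  annihilator vanishes as well.\<close>

lemma linear_indep_tree:
  fixes S :: "('n \<times> 'n) set"
  assumes rel: "\<And>\<omega> :: 'n \<Rightarrow> 'n \<Rightarrow> real.
    (\<And>i j. \<omega> i j = \<omega> j i) \<Longrightarrow> (\<And>i j. (i, j) \<notin> S \<Longrightarrow> (j, i) \<notin> S \<Longrightarrow> \<omega> i j = 0) \<Longrightarrow> (\<And>i. (\<Sum>j\<in>UNIV. \<omega> i j) = 0) \<Longrightarrow>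
    (\<And>c. c < N \<Longrightarrow> (\<Sum>i | q i = c. \<Sum>j | q j = c. if s i = s j then \<omega> i j else 0) +
       (\<Sum>i | q i = c. \<Sum>j | c < q j. \<omega> i j) + (\<Sum>i | q i = c. \<Sum>j | c < q j. \<omega> i j) = 0) \<Longrightarrow>
    (\<And>i. (\<Sum>j | q j = q i \<and> k i < k j. if s i \<noteq> s j then \<omega> i j else 0) = 0) \<Longrightarrow> \<omega> = (\<lambda>_ _. 0)"
    and anti: "\<And>i j. (i, j) \<in> S \<Longrightarrow> (j, i) \<in> S \<Longrightarrow> i = j"
  shows "linear_indep sy.height_space S"
proof (rule linear_indep_dual[OF sy.subspace_height_space])
  fix c :: "real^'n^'n"
  assume c: "c \<in> supported S" and ann: "\<And>w. w \<in> sy.height_space \<Longrightarrow> (\<Sum>i\<in>UNIV. \<Sum>j\<in>UNIV. c $ i $ j * w $ i $ j) = 0"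
  define \<omega> where "\<omega> i j = c $ i $ j + c $ j $ i" for i j
  have ann': "(\<Sum>i\<in>UNIV. \<Sum>j\<in>UNIV. \<omega> i j * w $ i $ j) = 0" if w: "w \<in> sy.height_space" for w
  proof -
    have "(\<Sum>i\<in>UNIV. \<Sum>j\<in>UNIV. \<omega> i j * w $ i $ j) =
      (\<Sum>i\<in>UNIV. \<Sum>j\<in>UNIV. c $ i $ j * w $ i $ j) + (\<Sum>i\<in>UNIV. \<Sum>j\<in>UNIV. c $ j $ i * w $ i $ j)"
      by (simp add: \<omega>_def distrib_right sum.distrib)
    also have "(\<Sum>i\<in>UNIV. \<Sum>j\<in>UNIV. c $ j $ i * w $ i $ j) = (\<Sum>j\<in>UNIV. \<Sum>i\<in>UNIV. c $ j $ i * w $ j $ i)"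
      by (subst sum.swap) (use sy.height_space_sym[OF w] in \<open>auto intro!: sum.cong\<close>)
    finally show ?thesis using ann[OF w] by simp
  qed
  have sym: "\<omega> i j = \<omega> j i" for i j by (simp add: \<omega>_def)
  have heights: "(\<Sum>i\<in>UNIV. \<Sum>j\<in>UNIV. if meet_node i j \<in> Q then \<omega> i j else 0) = 0" if Q: "\<And>v. ninv v \<in> Q \<longleftrightarrow> v \<in> Q" for Q
  proof -
    have "sy.height_matrix (\<lambda>v. if dec v \<in> Q then 1 else 0) (\<lambda>_. 0) \<in> sy.height_space"
      unfolding sy.height_space_def
    proof (rule CollectI, intro exI conjI, rule refl, rule ballI)
      fix v assume "v \<in> sy.internal"
      then have "v \<in> vs" by (simp add: sy.internal_def)
      then obtain u where "v = enc u" by (auto simp: vs_def)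
      then show "(if dec (invol tree v) \<in> Q then 1 else 0) = (if dec v \<in> Q then 1 else (0::real))" using Q by simp
    qed
    from ann'[OF this] have "(\<Sum>i\<in>UNIV. \<Sum>j\<in>UNIV. \<omega> i j * (if meet_node i j \<in> Q then 1 else 0)) = 0"
      by (simp add: sy.height_matrix_def meet_eq)
    moreover have "\<omega> i j * (if meet_node i j \<in> Q then 1 else 0) = (if meet_node i j \<in> Q then \<omega> i j else 0)" for i j
      by simp
    ultimately show ?thesis by (simp only:)
  qed
  have row: "(\<Sum>j\<in>UNIV. \<omega> a j) = 0" for a
  proof -
    have "sy.height_matrix (\<lambda>_. 0) (\<lambda>i. if i = a then 1 else 0) \<in> sy.height_space"
      unfolding sy.height_space_def by (rule CollectI, intro exI conjI, rule refl) simp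
    from ann'[OF this] have "(\<Sum>i\<in>UNIV. \<Sum>j\<in>UNIV. \<omega> i j * ((if i = a then 1 else 0) + (if j = a then 1 else 0))) = 0"
      by (simp add: sy.height_matrix_def)
    moreover have "\<omega> i j * ((if i = a then 1 else 0) + (if j = a then 1 else 0)) = (if i = a then \<omega> i j else 0) + (if j = a then \<omega> i j else 0)" for i j
      by simp
    ultimately have "(\<Sum>i\<in>UNIV. \<Sum>j\<in>UNIV. (if i = a then \<omega> i j else 0) + (if j = a then \<omega> i j else 0)) = 0"
      by (simp only:)
    moreover have "(\<Sum>i\<in>UNIV. \<Sum>j\<in>UNIV. if i = a then \<omega> i j else 0) = (\<Sum>j\<in>UNIV. \<omega> a j)"
      by (subst sum.swap) simp
    moreover have "(\<Sum>i\<in>UNIV. \<Sum>j\<in>UNIV. if j = a then \<omega> i j else 0) = (\<Sum>j\<in>UNIV. \<omega> a j)"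
      using sym[of _ a] by simp
    ultimately show ?thesis by (simp add: sum.distrib)
  qed
  have "\<omega> = (\<lambda>_ _. 0)"
  proof (rule rel)
    show "\<omega> i j = \<omega> j i" for i j by (rule sym)
    show "\<omega> i j = 0" if "(i, j) \<notin> S" "(j, i) \<notin> S" for i j using c that by (simp add: \<omega>_def supported_def)
    show "(\<Sum>j\<in>UNIV. \<omega> i j) = 0" for i by (rule row)
    show "(\<Sum>i | q i = c. \<Sum>j | q j = c. if s i = s j then \<omega> i j else 0) +
       (\<Sum>i | q i = c. \<Sum>j | c < q j. \<omega> i j) + (\<Sum>i | q i = c. \<Sum>j | c < q j. \<omega> i j) = 0" for c
    proof -
      \<comment> \<open>One of the two mixed sums is transposed, so that both orders of a pair
        occur.\<close>
      have "(\<Sum>i | q i = c. \<Sum>j | c < q j. \<omega> i j) = (\<Sum>i\<in>UNIV. \<Sum>j\<in>UNIV. if q j = c \<and> c < q i then \<omega> i j else 0)"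
        unfolding sum_filter by (subst sum.swap) (auto intro!: sum.cong simp: sym)
      then have "(\<Sum>i | q i = c. \<Sum>j | q j = c. if s i = s j then \<omega> i j else 0) +
       (\<Sum>i | q i = c. \<Sum>j | c < q j. \<omega> i j) + (\<Sum>i | q i = c. \<Sum>j | c < q j. \<omega> i j) =
       (\<Sum>i\<in>UNIV. \<Sum>j\<in>UNIV. (if q i = c \<and> q j = c then if s i = s j then \<omega> i j else 0 else 0) +
        (if q i = c \<and> c < q j then \<omega> i j else 0) + (if q j = c \<and> c < q i then \<omega> i j else 0))"
        by (simp add: sum_filter sum.distrib)
      also have "\<dots> = (\<Sum>i\<in>UNIV. \<Sum>j\<in>UNIV. if meet_node i j \<in> {Tr c} then \<omega> i j else 0)"
        by (intro sum.cong refl) (auto simp: meet_node_def min_def)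
      also have "\<dots> = 0"
      proof (rule heights)
        show "ninv v \<in> {Tr c} \<longleftrightarrow> v \<in> {Tr c}" for v by (cases v) auto
      qed
      finally show ?thesis .
    qed
    show "(\<Sum>j | q j = q a \<and> k a < k j. if s a \<noteq> s j then \<omega> a j else 0) = 0" for a
    proof -
      let ?C = "\<lambda>j. q j = q a \<and> k a < k j \<and> s a \<noteq> s j"
      have e: "(\<Sum>j | q j = q a \<and> k a < k j. if s a \<noteq> s j then \<omega> a j else 0) = (\<Sum>j\<in>UNIV. if ?C j then \<omega> a j else 0)"
        using sum.inter_filter[of UNIV "\<lambda>j. if s a \<noteq> s j then \<omega> a j else 0" "\<lambda>j. q j = q a \<and> k a < k j"]
        by (auto intro!: sum.cong)
      \<comment> \<open>Every pair diverging on this orbit has \<open>a\<close> as its member of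
        smaller position and occurs in both orders, which gives twice the branch relation.\<close>
      have "0 = (\<Sum>i\<in>UNIV. \<Sum>j\<in>UNIV. if meet_node i j \<in> {Br (q a) (k a) True, Br (q a) (k a) False} then \<omega> i j else 0)"
      proof (rule heights[symmetric])
        show "ninv v \<in> {Br (q a) (k a) True, Br (q a) (k a) False} \<longleftrightarrow> v \<in> {Br (q a) (k a) True, Br (q a) (k a) False}" for v
          by (cases v) auto
      qed
      also have "\<dots> = (\<Sum>i\<in>UNIV. \<Sum>j\<in>UNIV. (if i = a then if ?C j then \<omega> i j else 0 else 0) + (if j = a then if ?C i then \<omega> i j else 0 else 0))"
      proof (intro sum.cong refl)
        fix i j
        have eq: "meet_node i j \<in> {Br (q a) (k a) True, Br (q a) (k a) False} \<longleftrightarrow> i = a \<and> ?C j \<or> j = a \<and> ?C i"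
        proof (cases "q i = q a \<and> q j = q a \<and> s i \<noteq> s j")
          case True
          then have "meet_node i j = Br (q a) (min (k i) (k j)) (s i)" by (simp add: meet_node_def)
          then have L: "meet_node i j \<in> {Br (q a) (k a) True, Br (q a) (k a) False} \<longleftrightarrow> min (k i) (k j) = k a"
            by (cases "s i") simp_all
          have kij: "k i \<noteq> k j" using pos_inj[of i j] True by auto
          consider "i = a" | "j = a" | "i \<noteq> a" "j \<noteq> a" by blast
          then show ?thesis
          proof cases
            case 1
            with True kij show ?thesis unfolding L by (auto simp: min_def)
          next
            case 2
            with True kij show ?thesis unfolding L by (auto simp: min_def)
          next
            case 3
            then have "k i \<noteq> k a" "k j \<noteq> k a" using pos_inj[of i a] pos_inj[of j a] True by auto
            with 3 show ?thesis unfolding L by (simp add: min_def)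
          qed
        next
          case False
          have "meet_node i j \<notin> {Br (q a) (k a) True, Br (q a) (k a) False}"
            using False by (auto simp: meet_node_def)
          with False show ?thesis by auto
        qed
        show "(if meet_node i j \<in> {Br (q a) (k a) True, Br (q a) (k a) False} then \<omega> i j else 0) =
          (if i = a then if ?C j then \<omega> i j else 0 else 0) + (if j = a then if ?C i then \<omega> i j else 0 else 0)"
          unfolding eq by (cases "i = a"; cases "j = a") simp_all
      qed
      also have "\<dots> = (\<Sum>j\<in>UNIV. if ?C j then \<omega> a j else 0) + (\<Sum>i\<in>UNIV. if ?C i then \<omega> i a else 0)"
      proof -
        have "(\<Sum>i\<in>UNIV. \<Sum>j\<in>UNIV. if i = a then if ?C j then \<omega> i j else 0 else 0) = (\<Sum>j\<in>UNIV. if ?C j then \<omega> a j else 0)"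
          by (subst sum.swap) simp
        then show ?thesis by (simp add: sum.distrib)
      qed
      also have "(\<Sum>i\<in>UNIV. if ?C i then \<omega> i a else 0) = (\<Sum>j\<in>UNIV. if ?C j then \<omega> a j else 0)"
        by (rule sum.cong) (auto simp: sym)
      finally show ?thesis unfolding e by simp
    qed
  qed
  then have "\<omega> i j = 0" for i j by simp
  then have z: "c $ i $ j + c $ j $ i = 0" for i j unfolding \<omega>_def .
  have "c $ i $ j = 0" for i j
  proof (cases "(i, j) \<in> S")
    case True
    show ?thesis
    proof (cases "i = j")
      case True
      then show ?thesis using z[of i i] by simp
    next
      case False
      then have "(j, i) \<notin> S" using anti True by blast
      then show ?thesis using z[of i j] c by (simp add: supported_def)
    qed
  qed (use c in \<open>simp add: supported_def\<close>)
  then show "c = 0" by (simp add: vec_eq_iff)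
qed

end

text \<open>Start from any injection and see which trunk code the choice operator picks. Exchanging
  that trunk vertex with \<open>Tr 0\<close> leaves the set of codes unchanged, so the picked code
  now belongs to \<open>Tr 0\<close>.\<close>

lemma encoding_exists:
  assumes "0 < N"
  shows "\<exists>enc :: 'n::finite node \<Rightarrow> nat. inj enc \<and> enc (Tr 0) = (SOME v. v \<in> enc ` Tr ` {..<N})"
proof -
  let ?f = "to_nat :: 'n node \<Rightarrow> nat"
  define v0 where "v0 = (SOME v. v \<in> ?f ` Tr ` {..<N})"
  have "v0 \<in> ?f ` Tr ` {..<N}" unfolding v0_def by (rule someI[of _ "?f (Tr 0)"]) (use assms in simp)
  then obtain c0 where c0: "c0 < N" "v0 = ?f (Tr c0)" by auto
  define enc where "enc v = ?f (if v = Tr 0 then Tr c0 else if v = Tr c0 then Tr 0 else v)" for v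
  have "inj enc" by (auto simp: inj_def enc_def split: if_splits)
  moreover have "enc ` Tr ` {..<N} = ?f ` Tr ` {..<N}"
  proof
    show "enc ` Tr ` {..<N} \<subseteq> ?f ` Tr ` {..<N}" using c0(1) assms by (auto simp: enc_def)
    show "?f ` Tr ` {..<N} \<subseteq> enc ` Tr ` {..<N}"
    proof clarify
      fix c assume "c < N"
      define c' where "c' = (if c = 0 then c0 else if c = c0 then 0 else c)"
      have "?f (Tr c) = enc (Tr c')" "c' < N" using \<open>c < N\<close> c0(1) assms by (auto simp: enc_def c'_def)
      then show "?f (Tr c) \<in> enc ` Tr ` {..<N}" by blast
    qed
  qed
  ultimately show ?thesis using c0(2) unfolding v0_def by (intro exI[of _ enc]) (simp add: enc_def)
qed

lemma distinct_concat_nth: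
  assumes "distinct (concat hs)" "c < length hs" "c' < length hs" "l < length (hs ! c)" "l' < length (hs ! c')"
    and "hs ! c ! l = hs ! c' ! l'"
  shows "c = c' \<and> l = l'"
  using assms
proof (induction hs arbitrary: c c')
  case (Cons h hs)
  have disj: "h ! l \<noteq> hs ! c ! l'" if "l < length h" "c < length hs" "l' < length (hs ! c)" for l l' c
  proof
    assume e: "h ! l = hs ! c ! l'"
    have "h ! l \<in> set h" using that by simp
    moreover have "hs ! c ! l' \<in> set (concat hs)"
      using nth_mem[OF that(3)] nth_mem[OF that(2)] by auto
    ultimately show False using Cons.prems(1) e by auto
  qed
  show ?case
  proof (cases c)
    case 0
    show ?thesis
    proof (cases c')
      case 0
      with \<open>c = 0\<close> Cons.prems show ?thesis by (simp add: nth_eq_iff_index_eq)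
    next
      case (Suc d)
      with \<open>c = 0\<close> Cons.prems disj[of l d l'] show ?thesis by simp
    qed
  next
    case (Suc d)
    show ?thesis
    proof (cases c')
      case 0
      with Suc Cons.prems disj[of l' d l] show ?thesis by simp
    next
      case (Suc d')
      with \<open>c = Suc d\<close> Cons show ?thesis by simp
    qed
  qed
qed simp

lemma trunk_rel_nth:
  assumes "\<And>c. c < length gs \<Longrightarrow> same \<omega> (gs ! c) (gs ! c) + full \<omega> (gs ! c) (concat (drop (Suc c) gs)) + full \<omega> (gs ! c) (concat (drop (Suc c) gs)) = 0"
  shows "trunk_rel \<omega> gs"
  using assms
proof (induction gs)
  case (Cons g gs)
  have "trunk_rel \<omega> gs"
  proof (rule Cons.IH)
    fix c assume "c < length gs"
    then show "same \<omega> (gs ! c) (gs ! c) + full \<omega> (gs ! c) (concat (drop (Suc c) gs)) + full \<omega> (gs ! c) (concat (drop (Suc c) gs)) = 0"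
      using Cons.prems[of "Suc c"] by simp
  qed
  with Cons.prems[of 0] show ?case by simp
qed simp

lemma list_rel_nth:
  assumes "\<And>l. l < length xs \<Longrightarrow> cross \<omega> [xs ! l] (drop (Suc l) xs) = 0"
  shows "list_rel \<omega> xs"
  using assms
proof (induction xs)
  case (Cons x xs)
  have "list_rel \<omega> xs"
  proof (rule Cons.IH)
    fix l assume "l < length xs"
    then show "cross \<omega> [xs ! l] (drop (Suc l) xs) = 0" using Cons.prems[of "Suc l"] by simp
  qed
  with Cons.prems[of 0] show ?case by simp
qed simp

lemma pair_sum_set:
  assumes "distinct (map fst xs)" "distinct (map fst ys)"
    and "\<And>x. x \<in> set xs \<Longrightarrow> snd x = s (fst x)" "\<And>y. y \<in> set ys \<Longrightarrow> snd y = s (fst y)"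
  shows "pair_sum R \<omega> xs ys = (\<Sum>i\<in>fst ` set xs. \<Sum>j\<in>fst ` set ys. if R (s i) (s j) then \<omega> i j else 0)"
proof -
  have *: "(\<Sum>a\<leftarrow>xs. f a) = (\<Sum>i\<in>fst ` set xs. F i)"
    if "distinct (map fst xs)" "\<And>a. a \<in> set xs \<Longrightarrow> f a = F (fst a)" for xs :: "('y \<times> 'z) list" and f F
  proof -
    have "(\<Sum>a\<leftarrow>xs. f a) = (\<Sum>a\<leftarrow>xs. F (fst a))" using that(2) by (auto intro!: arg_cong[of _ _ sum_list] map_cong)
    also have "\<dots> = sum F (set (map fst xs))" using sum.distinct_set_conv_list[OF that(1), of F] by (simp add: o_def)
    finally show ?thesis by simp
  qed
  show ?thesis
    unfolding pair_sum_def
    by (rule *[OF assms(1)], rule *[OF assms(2)]) (simp add: assms(3,4))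
qed

text \<open>The lists of \<open>caterpillar_structure\<close> become position functions, and their
  relations become sums over sets of positions; these are the hypotheses under which the dual
  criterion \<open>linear_indep_tree\<close> applies.\<close>

lemma caterpillar_symbic_tree:
  fixes S :: "('n::{finite,linorder} \<times> 'n) set"
  assumes S: "S \<subseteq> sym_entries"
    and ind: "alg_indep (sym_rank_le_2 :: ('k::{alg_closed_field,field_char_0}^'n::{finite,linorder}^'n::{finite,linorder}) set) S"
  shows "\<exists>T :: (nat, 'n) labelled_tree. T \<in> regular_symbic_trees \<and> caterpillar_branches T \<and> linear_indep (span (symbic_cone T)) S"
proof -
  obtain gs :: "('n \<times> bool) list list" where
    gs: "set (map fst (concat gs)) = UNIV" "distinct (map fst (concat gs))" "\<forall>g\<in>set gs. valid_group g"
    and rel: "\<forall>\<omega> :: 'n \<Rightarrow> 'n \<Rightarrow> real. row_rel S \<omega> \<longrightarrow> (\<forall>g\<in>set gs. list_rel \<omega> g) \<longrightarrow> trunk_rel \<omega> gs \<longrightarrow> \<omega> = (\<lambda>_ _. 0)"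
    using caterpillar_structure[OF ind S] by (elim exE conjE) (rule that)
  let ?N = "length gs"
  define m where "m c = length (gs ! c)" for c
  have "\<exists>c l. c < ?N \<and> l < m c \<and> fst (gs ! c ! l) = i" for i
  proof -
    have "i \<in> set (map fst (concat gs))" using gs(1) by simp
    then obtain g x where "g \<in> set gs" "x \<in> set g" "fst x = i" by auto
    then show ?thesis unfolding m_def by (metis in_set_conv_nth)
  qed
  then obtain q k where qk: "\<And>i. q i < ?N" "\<And>i. k i < m (q i)" "\<And>i. fst (gs ! q i ! k i) = i" by metis
  define s where "s i = snd (gs ! q i ! k i)" for i
  have elem: "gs ! q i ! k i = (i, s i)" for i using qk(3)[of i] by (simp add: s_def prod_eq_iff)
  have uniq: "c = c' \<and> l = l'" if "c < ?N" "l < m c" "c' < ?N" "l' < m c'" "fst (gs ! c ! l) = fst (gs ! c' ! l')" for c c' l l'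
  proof -
    have "distinct (concat (map (map fst) gs))" using gs(2) by (simp add: map_concat)
    from distinct_concat_nth[OF this, of c c' l l'] that show ?thesis by (simp add: m_def)
  qed
  have pos: "q (fst (gs ! c ! l)) = c \<and> k (fst (gs ! c ! l)) = l" if "c < ?N" "l < m c" for c l
    using uniq[OF qk(1,2) that] qk(3) by blast
  have vg: "valid_group (gs ! c)" if "c < ?N" for c using gs(3) that by simp
  have m0: "0 < m c" if "c < ?N" for c using vg[OF that] by (simp add: valid_group_def m_def)
  have N0: "0 < ?N" using qk(1) by (metis gr_zeroI not_less_zero)
  obtain enc :: "'n node \<Rightarrow> nat" where enc: "inj enc" "enc (Tr 0) = (SOME v. v \<in> enc ` Tr ` {..<?N})"
    using encoding_exists[OF N0] by blast
  interpret gr: grouping q k s ?N m enc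
  proof
    show "\<exists>i. q i = c \<and> k i = l" if "c < ?N" "l < m c" for c l using pos[OF that] by blast
    show "i = j" if "q i = q j" "k i = k j" for i j using qk(3) that by metis
    show "s i \<noteq> s j" if "q i = q j" "Suc (Suc (k i)) = m (q i)" "Suc (k j) = m (q i)" for i j
    proof -
      let ?g = "gs ! q i"
      have l: "length ?g = Suc (Suc (k i))" "k j = Suc (k i)" using that by (auto simp: m_def)
      then have ne: "?g \<noteq> []" "butlast ?g \<noteq> []" by (auto simp flip: length_0_conv)
      have "last ?g = (j, s j)" using elem[of j] that(1) l last_conv_nth[OF ne(1)] by simp
      moreover have "last (butlast ?g) = (i, s i)"
        using elem[of i] l last_conv_nth[OF ne(2)] by (simp add: nth_butlast)
      moreover have "snd (last (butlast ?g)) \<noteq> snd (last ?g)"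
        using vg[OF qk(1)[of i]] l by (simp add: valid_group_def)
      ultimately show ?thesis by simp
    qed
  qed (use qk m0 enc in auto)
  have sgn: "snd x = s (fst x)" if xc: "x \<in> set (gs ! c)" "c < ?N" for x c
  proof -
    obtain l where "l < m c" "x = gs ! c ! l" using xc(1) by (auto simp: in_set_conv_nth m_def)
    then show ?thesis using pos[OF xc(2), of l] by (simp add: s_def)
  qed
  have grp: "fst ` set (gs ! c) = {i. q i = c}" if "c < ?N" for c
  proof
    show "fst ` set (gs ! c) \<subseteq> {i. q i = c}"
    proof
      fix i assume "i \<in> fst ` set (gs ! c)"
      then obtain x where x: "x \<in> set (gs ! c)" "i = fst x" by blast
      then obtain l where "l < m c" "x = gs ! c ! l" unfolding m_def by (metis in_set_conv_nth)
      then show "i \<in> {i. q i = c}" using pos[OF \<open>c < ?N\<close>, of l] x(2) by simp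
    qed
    show "{i. q i = c} \<subseteq> fst ` set (gs ! c)"
    proof clarify
      fix i
      have "gs ! q i ! k i \<in> set (gs ! q i)" using qk(2)[of i] by (simp add: m_def)
      then show "i \<in> fst ` set (gs ! q i)" unfolding elem by force
    qed
  qed
  have low: "fst ` set (concat (drop (Suc c) gs)) = {j. c < q j}" for c
  proof
    show "fst ` set (concat (drop (Suc c) gs)) \<subseteq> {j. c < q j}"
    proof
      fix i assume "i \<in> fst ` set (concat (drop (Suc c) gs))"
      then obtain x where x: "x \<in> set (concat (drop (Suc c) gs))" "i = fst x" by blast
      then obtain g where g: "g \<in> set (drop (Suc c) gs)" "x \<in> set g" by (auto simp only: set_concat UN_iff)
      then obtain d where "d < length (drop (Suc c) gs)" "g = drop (Suc c) gs ! d" by (metis in_set_conv_nth)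
      with g(2) have d: "d < ?N - Suc c" "x \<in> set (gs ! (Suc c + d))" by simp_all
      have "i \<in> fst ` set (gs ! (Suc c + d))" using d(2) x(2) by blast
      also have "\<dots> = {i. q i = Suc c + d}" by (rule grp) (use d(1) in linarith)
      finally show "i \<in> {j. c < q j}" by simp
    qed
    show "{j. c < q j} \<subseteq> fst ` set (concat (drop (Suc c) gs))"
    proof
      fix j assume "j \<in> {j. c < q j}"
      then have "c < q j" by simp
      then have "gs ! q j = drop (Suc c) gs ! (q j - Suc c)" "q j - Suc c < length (drop (Suc c) gs)"
        using qk(1)[of j] by auto
      then have "gs ! q j \<in> set (drop (Suc c) gs)" by (metis nth_mem)
      moreover have "j \<in> fst ` set (gs ! q j)" using grp[OF qk(1)] by auto
      ultimately show "j \<in> fst ` set (concat (drop (Suc c) gs))" by auto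
    qed
  qed
  have rest: "fst ` set (drop (Suc l) (gs ! c)) = {j. q j = c \<and> l < k j}" if c: "c < ?N" for c l
  proof
    show "fst ` set (drop (Suc l) (gs ! c)) \<subseteq> {j. q j = c \<and> l < k j}"
    proof
      fix i assume "i \<in> fst ` set (drop (Suc l) (gs ! c))"
      then obtain x where x: "x \<in> set (drop (Suc l) (gs ! c))" "i = fst x" by blast
      then obtain e where e: "e < length (drop (Suc l) (gs ! c))" "x = drop (Suc l) (gs ! c) ! e" by (metis in_set_conv_nth)
      then have d: "Suc l + e < m c" "x = gs ! c ! (Suc l + e)" by (simp_all add: m_def)
      then have "q i = c \<and> k i = Suc l + e" using pos[OF c d(1)] x(2) by metis
      then show "i \<in> {j. q j = c \<and> l < k j}" by simp
    qed
    show "{j. q j = c \<and> l < k j} \<subseteq> fst ` set (drop (Suc l) (gs ! c))"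
    proof
      fix j assume "j \<in> {j. q j = c \<and> l < k j}"
      then have j: "l < k j" "q j = c" by simp_all
      then have "(j, s j) = drop (Suc l) (gs ! c) ! (k j - Suc l)" "k j - Suc l < length (drop (Suc l) (gs ! c))"
        using qk(2)[of j] elem[of j] j(2) by (auto simp: m_def)
      then have "(j, s j) \<in> set (drop (Suc l) (gs ! c))" by (metis nth_mem)
      then show "j \<in> fst ` set (drop (Suc l) (gs ! c))" by force
    qed
  qed
  have dgs: "distinct (map fst (gs ! c))" if "c < ?N" for c
    using gs(2) that by (simp add: map_concat distinct_concat_iff)
  have dlow: "distinct (map fst (concat (drop (Suc c) gs)))" for c
  proof -
    have "map fst (concat gs) = map fst (concat (take (Suc c) gs)) @ map fst (concat (drop (Suc c) gs))"
      by (metis append_take_drop_id concat_append map_append)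
    with gs(2) show ?thesis by (metis distinct_append)
  qed
  have slow: "snd x = s (fst x)" if "x \<in> set (concat (drop (Suc c) gs))" for x c
  proof -
    have "x \<in> set (concat gs)" using that by (auto dest: in_set_dropD)
    then obtain g where "g \<in> set gs" "x \<in> set g" by auto
    then obtain d where "d < ?N" "x \<in> set (gs ! d)" by (metis in_set_conv_nth)
    then show ?thesis using sgn by blast
  qed
  have "linear_indep gr.sy.height_space S"
  proof (rule gr.linear_indep_tree)
    show "i = j" if "(i, j) \<in> S" "(j, i) \<in> S" for i j
    proof (rule antisym)
      show "i \<le> j" "j \<le> i" using that S unfolding sym_entries_def by blast+
    qed
    fix \<omega> :: "'n \<Rightarrow> 'n \<Rightarrow> real"
    assume sym: "\<And>i j. \<omega> i j = \<omega> j i" and supp: "\<And>i j. (i, j) \<notin> S \<Longrightarrow> (j, i) \<notin> S \<Longrightarrow> \<omega> i j = 0"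
      and row: "\<And>i. (\<Sum>j\<in>UNIV. \<omega> i j) = 0"
      and tr: "\<And>c. c < ?N \<Longrightarrow> (\<Sum>i | q i = c. \<Sum>j | q j = c. if s i = s j then \<omega> i j else 0) +
       (\<Sum>i | q i = c. \<Sum>j | c < q j. \<omega> i j) + (\<Sum>i | q i = c. \<Sum>j | c < q j. \<omega> i j) = 0"
      and br: "\<And>i. (\<Sum>j | q j = q i \<and> k i < k j. if s i \<noteq> s j then \<omega> i j else 0) = 0"
    have "trunk_rel \<omega> gs"
    proof (rule trunk_rel_nth)
      fix c assume c: "c < ?N"
      have "same \<omega> (gs ! c) (gs ! c) = (\<Sum>i | q i = c. \<Sum>j | q j = c. if s i = s j then \<omega> i j else 0)"
        using pair_sum_set[of "gs ! c" "gs ! c" s "(=)" \<omega>] dgs[OF c] sgn[OF _ c] unfolding grp[OF c] by blast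
      moreover have "full \<omega> (gs ! c) (concat (drop (Suc c) gs)) = (\<Sum>i | q i = c. \<Sum>j | c < q j. \<omega> i j)"
        using pair_sum_set[of "gs ! c" "concat (drop (Suc c) gs)" s "\<lambda>_ _. True" \<omega>] dgs[OF c] dlow[of c] sgn[OF _ c] slow[of _ c]
        unfolding grp[OF c] low by simp
      ultimately show "same \<omega> (gs ! c) (gs ! c) + full \<omega> (gs ! c) (concat (drop (Suc c) gs)) + full \<omega> (gs ! c) (concat (drop (Suc c) gs)) = 0"
        using tr[OF c] by simp
    qed
    moreover have "list_rel \<omega> g" if "g \<in> set gs" for g
    proof -
      obtain c where c: "c < ?N" "g = gs ! c" using \<open>g \<in> set gs\<close> by (auto simp: in_set_conv_nth)
      show ?thesis
      proof (rule list_rel_nth)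
        fix l assume "l < length g"
        then have l: "l < m c" by (simp add: c m_def)
        define a where "a = fst (gs ! c ! l)"
        have a: "q a = c" "k a = l" using pos[OF c(1) l] by (auto simp: a_def)
        then have ga: "g ! l = (a, s a)" using elem[of a] c by simp
        have "cross \<omega> [(a, s a)] (drop (Suc l) (gs ! c)) =
          (\<Sum>i\<in>fst ` set [(a, s a)]. \<Sum>j\<in>fst ` set (drop (Suc l) (gs ! c)). if s i \<noteq> s j then \<omega> i j else 0)"
        proof (rule pair_sum_set)
          show "distinct (map fst (drop (Suc l) (gs ! c)))" using dgs[OF c(1)] by (metis distinct_drop drop_map)
          show "snd y = s (fst y)" if "y \<in> set (drop (Suc l) (gs ! c))" for y
            using sgn[OF _ c(1)] in_set_dropD[OF that] by blast
        qed simp_all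
        also have "\<dots> = (\<Sum>j | q j = q a \<and> k a < k j. if s a \<noteq> s j then \<omega> a j else 0)"
        proof -
          have "fst ` set [(a, s a)] = {a}" by simp
          then show ?thesis unfolding rest[OF c(1)] a by (simp only: sum.insert sum.empty finite.emptyI empty_iff not_False_eq_True add_0_right)
        qed
        finally show "cross \<omega> [g ! l] (drop (Suc l) g) = 0" unfolding ga c(2)[symmetric] br .
      qed
    qed
    moreover have "row_rel S \<omega>"
    proof -
      have "\<omega> i j = 0" if "i \<le> j" "(i, j) \<notin> S" for i j
      proof (cases "i = j")
        case False
        with that have "(j, i) \<notin> S" using S by (auto simp: sym_entries_def)
        with that show ?thesis using supp by blast
      qed (use supp that in blast)
      then show ?thesis unfolding row_rel_def using sym row by blast
    qed
    ultimately show "\<omega> = (\<lambda>_ _. 0)" using rel by blast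
  qed
  then have "linear_indep (span (symbic_cone gr.tree)) S" by (simp add: gr.sy.span_symbic_cone)
  moreover have "gr.tree \<in> regular_symbic_trees"
    using gr.symbic_tree_tree gr.regular_tree by (simp add: regular_symbic_trees_def)
  ultimately show ?thesis using gr.caterpillar_tree by blast
qed

section \<open>The bases\<close>

text \<open>The rank 2 n - 1 is the same for all regular trees, which makes maximality comparable
  between different trees.\<close>

lemma regular_symbic_treeD:
  fixes T :: "(nat, 'n::{finite,linorder}) labelled_tree"
  assumes "T \<in> regular_symbic_trees"
  shows "linear_indep (span (symbic_cone T)) S \<Longrightarrow>
      alg_indep (sym_rank_le_2 :: ('k::{alg_closed_field,field_char_0}^'n::{finite,linorder}^'n::{finite,linorder}) set) S"
    "linear_indep (span (symbic_cone T)) S \<Longrightarrow> card S \<le> 2 * CARD('n) - 1"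
    "B \<in> tree_bases T \<Longrightarrow> 2 * CARD('n) - 1 \<le> card B"
proof -
  have T: "symbic_tree T" "regular T" using assms by (auto simp: regular_symbic_trees_def)
  interpret symbic_nat T using T(1) by unfold_locales
  show "linear_indep (span (symbic_cone T)) S \<Longrightarrow> alg_indep (sym_rank_le_2 :: ('k^'n::{finite,linorder}^'n::{finite,linorder}) set) S"
    unfolding span_symbic_cone by (rule linear_indep_imp_alg_indep)
  show "linear_indep (span (symbic_cone T)) S \<Longrightarrow> card S \<le> 2 * CARD('n) - 1"
    unfolding span_symbic_cone using linear_indep_card_le dim_height_space[OF T(2)] by metis
  show "B \<in> tree_bases T \<Longrightarrow> 2 * CARD('n) - 1 \<le> card B"
    unfolding tree_bases_def span_symbic_cone dim_height_space[OF T(2), symmetric]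
    by (rule linear_base_card_ge[OF subspace_height_space height_space_sym])
qed

theorem proposition6p3:
  fixes V :: "('k::{alg_closed_field,field_char_0}^'n::{finite,linorder}^'n::{finite,linorder}) set"
  assumes "V = sym_rank_le_2"
  shows "variety_bases V = (\<Union>T\<in>regular_symbic_trees. tree_bases T) \<and>
         variety_bases V =
           (\<Union>T\<in>{T \<in> regular_symbic_trees. caterpillar_branches T}. tree_bases T)"
proof -
  let ?all = "\<Union>T\<in>regular_symbic_trees. tree_bases (T :: (nat, 'n) labelled_tree)"
  let ?cat = "\<Union>T\<in>{T \<in> regular_symbic_trees. caterpillar_branches T}. tree_bases (T :: (nat, 'n) labelled_tree)"
  have "variety_bases V \<subseteq> ?cat"
  proof
    fix B assume "B \<in> variety_bases V"
    then have B: "B \<subseteq> sym_entries" "alg_indep V B" "\<And>B'. B \<subset> B' \<Longrightarrow> B' \<subseteq> sym_entries \<Longrightarrow> \<not> alg_indep V B'"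
      unfolding variety_bases_def matroid_bases_def by blast+
    obtain T :: "(nat, 'n) labelled_tree" where
      T: "T \<in> regular_symbic_trees" "caterpillar_branches T" "linear_indep (span (symbic_cone T)) B"
      using caterpillar_symbic_tree[OF B(1)] B(2) unfolding assms by blast
    have "\<not> linear_indep (span (symbic_cone T)) B'" if "B \<subset> B'" "B' \<subseteq> sym_entries" for B'
      using B(3)[OF that] regular_symbic_treeD(1)[OF T(1), of B'] unfolding assms by blast
    then have "B \<in> tree_bases T" using B(1) T(3) unfolding tree_bases_def matroid_bases_def by blast
    with T show "B \<in> ?cat" by blast
  qed
  moreover have "?all \<subseteq> variety_bases V"
  proof
    fix B assume "B \<in> ?all"
    then obtain T :: "(nat, 'n) labelled_tree" where T: "T \<in> regular_symbic_trees" "B \<in> tree_bases T" by blast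
    then have B: "B \<subseteq> sym_entries" "linear_indep (span (symbic_cone T)) B"
      unfolding tree_bases_def matroid_bases_def by blast+
    \<comment> \<open>A larger algebraically independent set would be independent in some regular
      tree, possibly a different one, whose rank is again 2 n - 1.\<close>
    have "\<not> alg_indep V B'" if B': "B \<subset> B'" "B' \<subseteq> sym_entries" for B'
    proof
      assume "alg_indep V B'"
      then obtain T' :: "(nat, 'n) labelled_tree" where
        "T' \<in> regular_symbic_trees" "linear_indep (span (symbic_cone T')) B'"
        using caterpillar_symbic_tree[OF B'(2)] unfolding assms by blast
      then have "card B' \<le> 2 * CARD('n) - 1" using regular_symbic_treeD(2) by blast
      moreover have "2 * CARD('n) - 1 \<le> card B" using regular_symbic_treeD(3)[OF T] .
      moreover have "card B < card B'" using B'(1) by (intro psubset_card_mono) auto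
      ultimately show False by simp
    qed
    moreover have "alg_indep V B" using regular_symbic_treeD(1)[OF T(1) B(2)] unfolding assms .
    ultimately show "B \<in> variety_bases V"
      using B(1) unfolding variety_bases_def matroid_bases_def by blast
  qed
  moreover have "?cat \<subseteq> ?all" by blast
  ultimately show ?thesis by blast
qed

end
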